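(* Let $t\in\mathbb{C}\setminus\{0\}$. Then the map $$\phi:\bigcup_{b\in\mathbb{N}_0}\{0,1\}^b\to\{\text{isomorphism classes of non-zero indecomposable objects in }\underline{\mathrm{Rep}}(H_t^+)\},\quad a\mapsto\mathcal{L}_{h_a}(V_{\mathrm{triv}})$$ is a bijection.
   Context: For $k,l\in\mathbb{N}_0$ let $P(k,l)$ be the set of set partitions of $\{1,\dots,k,1',\dots,l'\}$ ($k$ upper points, $l$ lower points). Operations: the tensor product $p\otimes q$ is horizontal concatenation; the involution $p^*\in P(l,k)$ swaps upper and lower points; for $p\in P(k,l)$, $q\in P(l,m)$, stack $p$ above $q$, identifying the lower points of $p$ with the upper points of $q$; $q\cdot p\in P(k,m)$ is the induced partition of the outer points by connected components, and $\ell(q,p)$ is the number of connected components containing only middle points. $\mathcal{C}=NC_{\mathrm{even}}$ consists of all partitions all of whose blocks have even size and which are non-crossing, i.e. with points ordered $1,\dots,k,l',\dots,1'$ there are no points $a<b<c<d$ with $a,c$ in one block and $b,d$ in a different block; it is closed under these operations. For $t\in\mathbb{C}$, $\underline{\mathrm{Rep}}_0(\mathcal{C},t)$ is the $\mathbb{C}$-linear category with objects $[k]$, $k\in\mathbb{N}_0$, $\mathrm{Hom}([k],[l])=\mathbb{C}\,\mathcal{C}(k,l)$, and composition extending $qp:=t^{\ell(q,p)}\,q\cdot p$; $\underline{\mathrm{Rep}}(\mathcal{C},t)$ is its Karoubi envelope (idempotent completion of the additive completion), and $\underline{\mathrm{Rep}}(H_t^+):=\underline{\mathrm{Rep}}(NC_{\mathrm{even}},t)$.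 For an idempotent $e\in\mathrm{End}([k])$, $([k],e)$ denotes its image. For a binary sequence $a=(a_1,\dots,a_b)\in\{0,1\}^b$, $b\in\mathbb{N}_0$, set $h_a:=h_{a_1}\otimes\cdots\otimes h_{a_b}\in NC_{\mathrm{even}}(k,k)$, where $h_0=\{\{1,1'\}\}\in P(1,1)$, $h_1=\{\{1,2,1',2'\}\}\in P(2,2)$ and $k=b+a_1+\dots+a_b$. Objects: a through-block is a block containing both upper and lower points; $t(p)$ is the number of through-blocks. The partition $p=h_a$ is projective, i.e. $p=p_0^*\cdot p_0$ for some $p_0\in P(k,t(p))$. With $E=\mathrm{End}([k])$, let $I_p\subseteq pEp$ be the ideal of elements that are linear combinations of partitions with fewer than $t(p)$ through-blocks. Then $pEp/I_p\cong\mathbb{C}$, with unit the class of $t^{-\ell(p,p)}p$ (this is the group algebra of the trivial group, whose trivial representation is $V_{\mathrm{triv}}$). Let $\mathcal{L}_p\in pEp$ be a primitive idempotent lifting this unit (unique up to conjugation); $\mathcal{L}_p(V_{\mathrm{triv}})$ is the isomorphism class of $([k],\mathcal{L}_p)$. *)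

theory Defs
  imports Complex_Main "HOL-Library.Disjoint_Sets" "HOL-Library.Poly_Mapping"
    "Jordan_Normal_Form.Matrix"
begin

section \<open>Set partitions of upper and lower points\<close>

datatype point = Up nat | Lo nat

type_synonym part = "point set set"

definition partitions :: "nat \<Rightarrow> nat \<Rightarrow> part set" where
  "partitions k l = {p. partition_on (Up ` {1..k} \<union> Lo ` {1..l}) p}"

fun shift :: "nat \<Rightarrow> nat \<Rightarrow> point \<Rightarrow> point" where
  "shift k l (Up i) = Up (k + i)"
| "shift k l (Lo j) = Lo (l + j)"

text \<open>Tensor product of \<open>p \<in> partitions k l\<close> with an arbitrary partition \<open>q\<close>.\<close>

definition tensor :: "nat \<Rightarrow> nat \<Rightarrow> part \<Rightarrow> part \<Rightarrow> part" where
  "tensor k l p q = p \<union> (\<lambda>B. shift k l ` B) ` q"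

definition through :: "part \<Rightarrow> nat" where
  "through p = card {B \<in> p. B \<inter> range Up \<noteq> {} \<and> B \<inter> range Lo \<noteq> {}}"

text \<open>
  Stacking \<open>p \<in> partitions k l\<close> above \<open>q \<in> partitions l m\<close>: the lower points of \<open>p\<close>
  and the upper points of \<open>q\<close> are both sent to \<open>Mid\<close>. The numbers \<open>k, l, m\<close> need not be passed on, since a partition
  determines its underlying set of points.
\<close>

datatype stack_point = Top nat | Mid nat | Bot nat

fun in_upper :: "point \<Rightarrow> stack_point" where
  "in_upper (Up i) = Top i"
| "in_upper (Lo j) = Mid j"

fun in_lower :: "point \<Rightarrow> stack_point" where
  "in_lower (Up i) = Mid i"
| "in_lower (Lo j) = Bot j"

fun outer :: "point \<Rightarrow> stack_point" where
  "outer (Up i) = Top i"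
| "outer (Lo j) = Bot j"

definition stacked :: "part \<Rightarrow> part \<Rightarrow> stack_point set set" where
  "stacked q p = (\<lambda>B. in_upper ` B) ` p \<union> (\<lambda>B. in_lower ` B) ` q"

definition components :: "part \<Rightarrow> part \<Rightarrow> stack_point set set" where
  "components q p =
     \<Union>(stacked q p) // {(x, y). \<exists>B \<in> stacked q p. x \<in> B \<and> y \<in> B}\<^sup>*"

definition stack :: "part \<Rightarrow> part \<Rightarrow> part" where
  "stack q p = (\<lambda>c. outer -` c) ` components q p - {{}}"

definition loops :: "part \<Rightarrow> part \<Rightarrow> nat" where
  "loops q p = card {c \<in> components q p. c \<subseteq> range Mid}"

section \<open>Non-crossing partitions with blocks of even size\<close>

text \<open>Position of a point in the order \<open>1, \<dots>, k, l', \<dots>, 1'\<close>.\<close>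

fun position :: "nat \<Rightarrow> nat \<Rightarrow> point \<Rightarrow> nat" where
  "position k l (Up i) = i"
| "position k l (Lo j) = k + (l + 1 - j)"

definition noncrossing :: "nat \<Rightarrow> nat \<Rightarrow> part \<Rightarrow> bool" where
  "noncrossing k l p \<longleftrightarrow>
     \<not> (\<exists>B \<in> p. \<exists>B' \<in> p. B \<noteq> B' \<and>
          (\<exists>a \<in> B. \<exists>b \<in> B'. \<exists>c \<in> B. \<exists>d \<in> B'.
             position k l a < position k l b \<and> position k l b < position k l c \<and>
             position k l c < position k l d))"

definition NC_even :: "nat \<Rightarrow> nat \<Rightarrow> part set" where
  "NC_even k l = {p \<in> partitions k l. (\<forall>B \<in> p. even (card B)) \<and> noncrossing k l p}"

section \<open>The linear category of non-crossing even partitions\<close>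

text \<open>
  Objects are natural numbers. All morphisms live in the space of formal \<open>\<complex>\<close>-linear
  combinations of partitions.
\<close>

type_synonym lincomb = "part \<Rightarrow>\<^sub>0 complex"

definition hom0 :: "nat \<Rightarrow> nat \<Rightarrow> lincomb set" where
  "hom0 k l = {f. Poly_Mapping.keys f \<subseteq> NC_even k l}"

definition comp0 :: "complex \<Rightarrow> lincomb \<Rightarrow> lincomb \<Rightarrow> lincomb" where
  "comp0 t g f =
     (\<Sum>q \<in> Poly_Mapping.keys g. \<Sum>p \<in> Poly_Mapping.keys f.
        Poly_Mapping.single (stack q p)
          (t ^ loops q p * Poly_Mapping.lookup g q * Poly_Mapping.lookup f p))"

section \<open>Karoubi envelope\<close>

text \<open>
  Additive completion: objects are finite lists of natural numbers (formal direct sums), morphisms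
  are matrices of morphisms, where the entry in row \<open>i\<close> and column \<open>j\<close> goes from the \<open>j\<close>-th
  summand of the source to the \<open>i\<close>-th summand of the target.
\<close>

definition add_hom :: "nat list \<Rightarrow> nat list \<Rightarrow> lincomb mat set" where
  "add_hom ks ls =
     {x \<in> carrier_mat (length ls) (length ks).
        \<forall>i < length ls. \<forall>j < length ks. x $$ (i, j) \<in> hom0 (ks ! j) (ls ! i)}"

definition add_comp :: "complex \<Rightarrow> lincomb mat \<Rightarrow> lincomb mat \<Rightarrow> lincomb mat" where
  "add_comp t y x =
     mat (dim_row y) (dim_col x)
       (\<lambda>(i, j). \<Sum>r < dim_row x. comp0 t (y $$ (i, r)) (x $$ (r, j)))"

text \<open>
  Idempotent completion: an object is an object of the additive completion together with an
  idempotent, which is also its identity morphism. Composition is \<open>add_comp\<close>.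
\<close>

type_synonym rep_obj = "nat list \<times> lincomb mat"

definition Rep :: "complex \<Rightarrow> rep_obj set" where
  "Rep t = {(ks, e). e \<in> add_hom ks ks \<and> add_comp t e e = e}"

definition rep_hom :: "complex \<Rightarrow> rep_obj \<Rightarrow> rep_obj \<Rightarrow> lincomb mat set" where
  "rep_hom t X Y =
     {x \<in> add_hom (fst X) (fst Y). add_comp t (snd Y) (add_comp t x (snd X)) = x}"

definition rep_id :: "rep_obj \<Rightarrow> lincomb mat" where
  "rep_id X = snd X"

definition rep_iso :: "complex \<Rightarrow> rep_obj rel" where
  "rep_iso t =
     {(X, Y). X \<in> Rep t \<and> Y \<in> Rep t \<and>
        (\<exists>u \<in> rep_hom t X Y. \<exists>v \<in> rep_hom t Y X.
           add_comp t v u = rep_id X \<and> add_comp t u v = rep_id Y)}"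

definition rep_zero :: "rep_obj \<Rightarrow> bool" where
  "rep_zero X \<longleftrightarrow> rep_id X = 0\<^sub>m (length (fst X)) (length (fst X))"

definition rep_sum :: "rep_obj \<Rightarrow> rep_obj \<Rightarrow> rep_obj" where
  "rep_sum X Y =
     (fst X @ fst Y,
      four_block_mat (snd X) (0\<^sub>m (length (fst X)) (length (fst Y)))
                     (0\<^sub>m (length (fst Y)) (length (fst X))) (snd Y))"

definition indecomposable :: "complex \<Rightarrow> rep_obj \<Rightarrow> bool" where
  "indecomposable t X \<longleftrightarrow>
     (\<forall>Y \<in> Rep t. \<forall>Z \<in> Rep t. (X, rep_sum Y Z) \<in> rep_iso t \<longrightarrow> rep_zero Y \<or> rep_zero Z)"

definition indec_classes :: "complex \<Rightarrow> rep_obj set set" where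
  "indec_classes t = {X \<in> Rep t. \<not> rep_zero X \<and> indecomposable t X} // rep_iso t"

section \<open>Lifted idempotents\<close>

text \<open>\<open>pEp\<close> for \<open>E = End([k])\<close>, and its ideal \<open>I\<^sub>p\<close>.\<close>

definition corner :: "complex \<Rightarrow> nat \<Rightarrow> part \<Rightarrow> lincomb set" where
  "corner t k p =
     {comp0 t (Poly_Mapping.single p 1) (comp0 t x (Poly_Mapping.single p 1)) | x. x \<in> hom0 k k}"

definition corner_ideal :: "complex \<Rightarrow> nat \<Rightarrow> part \<Rightarrow> lincomb set" where
  "corner_ideal t k p = {x \<in> corner t k p. \<forall>q \<in> Poly_Mapping.keys x. through q < through p}"

definition primitive_idempotent :: "complex \<Rightarrow> lincomb set \<Rightarrow> lincomb \<Rightarrow> bool" where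
  "primitive_idempotent t A e \<longleftrightarrow>
     e \<in> A \<and> e \<noteq> 0 \<and> comp0 t e e = e \<and>
     \<not> (\<exists>f \<in> A. \<exists>g \<in> A. f \<noteq> 0 \<and> g \<noteq> 0 \<and> comp0 t f f = f \<and> comp0 t g g = g \<and>
          comp0 t f g = 0 \<and> comp0 t g f = 0 \<and> e = f + g)"

definition lifts_unit :: "complex \<Rightarrow> nat \<Rightarrow> part \<Rightarrow> lincomb \<Rightarrow> bool" where
  "lifts_unit t k p e \<longleftrightarrow>
     primitive_idempotent t (corner t k p) e \<and>
     e - Poly_Mapping.single p (inverse (t ^ loops p p)) \<in> corner_ideal t k p"

text \<open>
  The isomorphism class of \<open>([k], e)\<close>, where \<open>e\<close> is a primitive idempotent lifting the unit of
  \<open>pEp / I\<^sub>p\<close>. No choice of \<open>e\<close> is made: the set below is the union of the classes of all such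
  \<open>([k], e)\<close>. It is a single isomorphism class precisely because \<open>e\<close> exists and is unique up to
  conjugation.
\<close>

definition lift_class :: "complex \<Rightarrow> nat \<Rightarrow> part \<Rightarrow> rep_obj set" where
  "lift_class t k p = rep_iso t `` {([k], mat 1 1 (\<lambda>_. e)) | e. lifts_unit t k p e}"

section \<open>The partitions associated with binary sequences\<close>

definition h_gen :: "nat \<Rightarrow> part" where
  "h_gen x = (if x = 0 then {{Up 1, Lo 1}} else {{Up 1, Up 2, Lo 1, Lo 2}})"

fun h_part :: "nat list \<Rightarrow> part" where
  "h_part [] = {}"
| "h_part (x # a) = tensor (1 + x) (1 + x) (h_gen x) (h_part a)"

definition h_size :: "nat list \<Rightarrow> nat" where
  "h_size a = length a + sum_list a"

definition phi :: "complex \<Rightarrow> nat list \<Rightarrow> rep_obj set" where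
  "phi t a = lift_class t (h_size a) (h_part a)"

end

theory Submission
  imports Defs "HOL-Library.Infinite_Set"
begin

text \<open>
  Call a through-block odd or even according to the parity of its number of upper points, which is
  also the parity of its number of lower points. By noncrossingness a partition in \<open>NC_even\<close> factors
  through the \<open>h\<^sub>a\<close> whose sequence \<open>a\<close> lists the parities of its through-blocks from left to right
  (\<open>0\<close> for odd, \<open>1\<close> for even),
  and a composite with \<open>h\<^sub>a\<close> and \<open>h\<^sub>b\<close> at its ends that keeps all their through-blocks forces \<open>a = b\<close>
  and equals \<open>h\<^sub>a\<close>. So the coefficient \<open>chi a\<close> at \<open>h\<^sub>a\<close> is a character of the corner of \<open>h\<^sub>a\<close>, and the
  lifted idempotents are the primitive idempotents on which it is \<open>1\<close>. The corner is
  finite-dimensional, so an element cut down by such an idempotent on which \<open>chi a\<close> does not vanish is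
  invertible. Hence an indecomposable object \<open>X\<close> is isomorphic to the lift at \<open>a\<close> as soon as some
  composite from the lift to \<open>X\<close> and back is not killed by \<open>chi a\<close>. This gives independence of the
  lift, and looking at the partitions with the most through-blocks in the idempotent of \<open>X\<close> it gives
  surjectivity.
\<close>

text \<open>Cutting a through-block in the middle leaves two even blocks only if the bridge between
  the halves has the parity of both ends. One point or two points suffice for this, which is the
  origin of the two digits and of the sizes 1 and 2 in \<open>h_part\<close>. The factorisation
  controls the stacked partition; the power of \<open>t\<close> that accompanies it is divided out,
  and this is where \<open>t \<noteq> 0\<close> enters. The \<open>h_part a\<close> close no
  component when stacked on themselves, so they are idempotent without rescaling. Finite dimension
  enters through one device: a linear relation in a sequence of morphisms, solved for its lowest
  term. For the powers of an element it yields a stable idempotent; for a decreasing chain of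
  idempotents it yields a contradiction. Blocks and connectivity are handled as equivalence
  relations on points, since stacking, gluing and noncrossingness then become statements about pairs
  of points.\<close>

definition same :: "'a set set \<Rightarrow> 'a \<Rightarrow> 'a \<Rightarrow> bool" where
  "same p x y \<longleftrightarrow> (\<exists>B \<in> p. x \<in> B \<and> y \<in> B)"

text \<open>Inverse to \<open>same\<close>: the two translate between sets of blocks and equivalence
  relations. \<open>S\<close> may also relate points outside \<open>P\<close>; the classes are cut
  down to \<open>P\<close>, so connectivity in a larger diagram can be used as it is.\<close>

definition quot :: "'a set \<Rightarrow> ('a \<Rightarrow> 'a \<Rightarrow> bool) \<Rightarrow> 'a set set" where
  "quot P S = (\<lambda>x. {y \<in> P. S x y}) ` P"

lemma same_sym: "same p x y \<Longrightarrow> same p y x"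
  by (auto simp: same_def)

text \<open>Both bracketings of a triple stack have the components of the diagram of all three partitions;
  they only differ in which row of interior points, the complement of \<open>V\<close> below, is contracted first.\<close>

lemma rtrancl_elim_iff:
  assumes S: "S \<subseteq> V \<times> V" and x: "x \<in> V" and y: "y \<in> V"
  shows "(x, y) \<in> (R \<union> S)\<^sup>* \<longleftrightarrow> (x, y) \<in> (R\<^sup>* \<inter> V \<times> V \<union> S)\<^sup>*"
proof
  assume "(x, y) \<in> (R \<union> S)\<^sup>*"
  \<comment> \<open>\<open>z\<close> is \<open>x\<close> or the end of the last
    \<open>S\<close>-step taken. The \<open>R\<close>-path from \<open>z\<close> onwards stays open
    until the next \<open>S\<close>-step: that step starts in \<open>V\<close>, so the path closes
    to a contracted step.\<close>
  then have "\<exists>z \<in> V. (x, z) \<in> (R\<^sup>* \<inter> V \<times> V \<union> S)\<^sup>* \<and> (z, y) \<in> R\<^sup>*"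
  proof (induction rule: rtrancl_induct)
    case base
    then show ?case using x by blast
  next
    case (step u w)
    then obtain z where z: "z \<in> V" "(x, z) \<in> (R\<^sup>* \<inter> V \<times> V \<union> S)\<^sup>*" "(z, u) \<in> R\<^sup>*" by blast
    show ?case
    proof (cases "(u, w) \<in> R")
      case True
      then show ?thesis using z by (meson rtrancl.rtrancl_into_rtrancl)
    next
      case False
      then have uw: "(u, w) \<in> S" using step by blast
      then have "(z, u) \<in> R\<^sup>* \<inter> V \<times> V" and w: "w \<in> V" using z S by auto
      then have "(x, w) \<in> (R\<^sup>* \<inter> V \<times> V \<union> S)\<^sup>*"
        using uw z(2) by (meson UnI1 UnI2 rtrancl.rtrancl_into_rtrancl)
      then show ?thesis using w by blast
    qed
  qed
  then obtain z where z: "z \<in> V" "(x, z) \<in> (R\<^sup>* \<inter> V \<times> V \<union> S)\<^sup>*" "(z, y) \<in> R\<^sup>*" by blast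
  then have "(z, y) \<in> R\<^sup>* \<inter> V \<times> V" using y by blast
  then show "(x, y) \<in> (R\<^sup>* \<inter> V \<times> V \<union> S)\<^sup>*"
    using z(2) by (meson UnI1 rtrancl.rtrancl_into_rtrancl)
next
  assume "(x, y) \<in> (R\<^sup>* \<inter> V \<times> V \<union> S)\<^sup>*"
  moreover have "R\<^sup>* \<inter> V \<times> V \<union> S \<subseteq> (R \<union> S)\<^sup>*"
    using rtrancl_mono[of R "R \<union> S"] by auto
  ultimately show "(x, y) \<in> (R \<union> S)\<^sup>*"
    by (metis rtrancl_idemp rtrancl_mono subsetD)
qed

text \<open>Components avoiding \<open>V\<close> use no \<open>S\<close>-edge and are components of
  \<open>R\<close> alone; those meeting \<open>V\<close> correspond, by intersection with
  \<open>V\<close>, to components of the contracted graph. With \<open>V\<close> the complement of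
  one interior row and \<open>W\<close> the other interior row, the loops of a triple stack are
  counted by contracting the first row.\<close>

lemma card_components_split:
  assumes fin: "finite PR" "finite PS"
    and R: "R \<subseteq> PR \<times> PR" "sym R" and S: "S \<subseteq> PS \<times> PS" "sym S"
    and V: "PS \<subseteq> V" "W \<subseteq> V"
  shows "card {c \<in> (PR \<union> PS) // (R \<union> S)\<^sup>*. c \<subseteq> - V \<union> W} =
         card {c \<in> PR // R\<^sup>*. c \<subseteq> - V} +
         card {d \<in> ((PR \<union> PS) \<inter> V) // (R\<^sup>* \<inter> V \<times> V \<union> S)\<^sup>*. d \<subseteq> W}"
proof -
  let ?P = "PR \<union> PS" and ?E = "(R \<union> S)\<^sup>*" and ?E' = "(R\<^sup>* \<inter> V \<times> V \<union> S)\<^sup>*"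
  let ?A1 = "{c \<in> ?P // ?E. c \<subseteq> - V}"
  let ?A2 = "{c \<in> ?P // ?E. c \<subseteq> - V \<union> W \<and> c \<inter> V \<noteq> {}}"
  have SV: "S \<subseteq> V \<times> V" using S V by auto
  have finq: "finite (?P // ?E)" using fin by (simp add: quotient_def)
  have eq: "equiv UNIV ?E"
    using R S by (intro equivI) (simp_all add: refl_rtrancl sym_rtrancl sym_Un trans_rtrancl)
  have "{c \<in> ?P // ?E. c \<subseteq> - V \<union> W} = ?A1 \<union> ?A2" by auto
  then have split: "card {c \<in> ?P // ?E. c \<subseteq> - V \<union> W} = card ?A1 + card ?A2"
    using finq by (simp only:) (rule card_Un_disjoint; auto)
  \<comment> \<open>A path inside a class that avoids \<open>V\<close> never stands at the start of
    an \<open>S\<close>-edge, because \<open>S\<close> lives on \<open>V\<close>.\<close>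
  have cls: "?E `` {x} = R\<^sup>* `` {x}" if "?E `` {x} \<subseteq> - V \<or> R\<^sup>* `` {x} \<subseteq> - V" for x
  proof -
    have "(x, y) \<in> R\<^sup>*" if "(x, y) \<in> ?E" for y
      using that
    proof (induction rule: rtrancl_induct)
      case (step y z)
      then have "y \<notin> V" using \<open>?E `` {x} \<subseteq> - V \<or> R\<^sup>* `` {x} \<subseteq> - V\<close> by blast
      then show ?case using step SV by (auto intro: rtrancl.rtrancl_into_rtrancl)
    qed simp
    moreover have "R\<^sup>* \<subseteq> ?E" by (rule rtrancl_mono) simp
    ultimately show ?thesis by auto
  qed
  have A1: "?A1 = {c \<in> PR // R\<^sup>*. c \<subseteq> - V}"
  proof (intro equalityI subsetI)
    fix c assume "c \<in> ?A1"
    then obtain x where x: "x \<in> ?P" "c = ?E `` {x}" "c \<subseteq> - V" by (auto elim: quotientE)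
    then have "x \<notin> V" by auto
    then have "x \<in> PR" using x V by auto
    then show "c \<in> {c \<in> PR // R\<^sup>*. c \<subseteq> - V}" using cls[of x] x by (auto intro!: quotientI)
  next
    fix c assume "c \<in> {c \<in> PR // R\<^sup>*. c \<subseteq> - V}"
    then obtain x where x: "x \<in> PR" "c = R\<^sup>* `` {x}" "c \<subseteq> - V" by (auto elim: quotientE)
    then show "c \<in> ?A1" using cls[of x] by (metis (no_types, lifting) UnCI mem_Collect_eq quotientI)
  qed
  have E'V: "y \<in> V" if "(x, y) \<in> ?E'" "x \<in> V" for x y
    using that SV by (induction rule: rtrancl_induct) auto
  have cut: "?E' `` {x} = ?E `` {x} \<inter> V" if "x \<in> V" for x
    using that E'V[of x] rtrancl_elim_iff[OF SV that] by auto
  have "bij_betw (\<lambda>c. c \<inter> V) ?A2 {d \<in> (?P \<inter> V) // ?E'. d \<subseteq> W}"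
  proof (rule bij_betw_imageI)
    \<comment> \<open>Distinct classes are disjoint and every class in \<open>?A2\<close> meets
      \<open>V\<close>, so the trace on \<open>V\<close> determines the class.\<close>
    show "inj_on (\<lambda>c. c \<inter> V) ?A2"
    proof (rule inj_onI)
      fix c d assume c: "c \<in> ?A2" and d: "d \<in> ?A2" and cd: "c \<inter> V = d \<inter> V"
      have "c \<in> UNIV // ?E" "d \<in> UNIV // ?E" using c d by (auto simp: quotient_def)
      moreover have "c \<inter> d \<noteq> {}" using c cd by blast
      ultimately show "c = d" using quotient_disj[OF eq] by blast
    qed
    show "(\<lambda>c. c \<inter> V) ` ?A2 = {d \<in> (?P \<inter> V) // ?E'. d \<subseteq> W}"
    proof (intro equalityI subsetI)
      fix d assume "d \<in> (\<lambda>c. c \<inter> V) ` ?A2"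
      then obtain c x where c: "x \<in> ?P" "c = ?E `` {x}" "c \<subseteq> - V \<union> W" "c \<inter> V \<noteq> {}" "d = c \<inter> V"
        by (auto elim!: quotientE)
      then obtain z where z: "(x, z) \<in> ?E" "z \<in> V" by auto
      have "z \<in> ?P" using z(1) c(1) R S by (induction rule: rtrancl_induct) auto
      moreover have "c = ?E `` {z}" using z c(2) eq by (metis equiv_class_eq)
      ultimately show "d \<in> {d \<in> (?P \<inter> V) // ?E'. d \<subseteq> W}"
        using c z cut[of z] quotientI[of z "?P \<inter> V" ?E'] by auto
    next
      fix d assume "d \<in> {d \<in> (?P \<inter> V) // ?E'. d \<subseteq> W}"
      then obtain x where x: "x \<in> ?P" "x \<in> V" "d = ?E' `` {x}" "d \<subseteq> W" by (auto elim!: quotientE)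
      then have "d = ?E `` {x} \<inter> V" using cut by simp
      moreover from this have "?E `` {x} \<in> ?A2" using x by (auto intro!: quotientI)
      ultimately show "d \<in> (\<lambda>c. c \<inter> V) ` ?A2" by blast
    qed
  qed
  then have "card ?A2 = card {d \<in> (?P \<inter> V) // ?E'. d \<subseteq> W}" by (rule bij_betw_same_card)
  then show ?thesis using split A1 by simp
qed

lemma rtrancl_map_prod_inj:
  assumes "inj f"
  shows "(f x, z) \<in> (map_prod f f ` R)\<^sup>* \<longleftrightarrow> (\<exists>y. z = f y \<and> (x, y) \<in> R\<^sup>*)"
proof
  assume "(f x, z) \<in> (map_prod f f ` R)\<^sup>*"
  then show "\<exists>y. z = f y \<and> (x, y) \<in> R\<^sup>*"
  proof (induction rule: rtrancl_induct)
    case (step y z)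
    then obtain u v w where "y = f u" "(x, u) \<in> R\<^sup>*" "(v, w) \<in> R" "y = f v" "z = f w"
      by (auto simp del: rtrancl_into_rtrancl)
    moreover from this have "u = v" using assms by (simp add: inj_def)
    ultimately show ?case by (metis rtrancl.rtrancl_into_rtrancl)
  qed blast
next
  assume "\<exists>y. z = f y \<and> (x, y) \<in> R\<^sup>*"
  then obtain y where y: "z = f y" "(x, y) \<in> R\<^sup>*" by blast
  from y(2) have "(f x, f y) \<in> (map_prod f f ` R)\<^sup>*"
  proof (induction rule: rtrancl_induct)
    case (step y z)
    then have "(f y, f z) \<in> map_prod f f ` R" by force
    then show ?case using step by (metis rtrancl.rtrancl_into_rtrancl)
  qed simp
  then show "(f x, z) \<in> (map_prod f f ` R)\<^sup>*" using y by simp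
qed

text \<open>Points are placed on numbered rows, so that stacks of two and of three partitions live in one type.\<close>

definition em :: "nat \<Rightarrow> nat \<Rightarrow> point \<Rightarrow> nat \<times> nat" where
  "em a b x = (case x of Up i \<Rightarrow> (a, i) | Lo j \<Rightarrow> (b, j))"

definition rel :: "nat \<Rightarrow> nat \<Rightarrow> part \<Rightarrow> (nat \<times> nat) rel" where
  "rel a b p = {(em a b x, em a b y) | x y. same p x y}"

definition conn :: "nat \<Rightarrow> nat \<Rightarrow> nat \<Rightarrow> part \<Rightarrow> part \<Rightarrow> (nat \<times> nat) rel" where
  "conn a b c q p = (rel a b p \<union> rel b c q)\<^sup>*"

definition ends :: "part \<Rightarrow> part \<Rightarrow> point set" where
  "ends q p = \<Union>p \<inter> range Up \<union> \<Union>q \<inter> range Lo"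

lemma em_simps [simp]: "em a b (Up i) = (a, i)" "em a b (Lo j) = (b, j)"
  by (simp_all add: em_def)

section \<open>Stacks as graphs on numbered rows\<close>

definition row :: "nat \<Rightarrow> nat \<Rightarrow> nat \<Rightarrow> stack_point \<Rightarrow> nat \<times> nat" where
  "row a b c x = (case x of Top i \<Rightarrow> (a, i) | Mid i \<Rightarrow> (b, i) | Bot i \<Rightarrow> (c, i))"

lemma row_simps [simp]: "row a b c (Top i) = (a, i)" "row a b c (Mid i) = (b, i)"
  "row a b c (Bot i) = (c, i)"
  by (simp_all add: row_def)

lemma row_in_upper: "row a b c (in_upper x) = em a b x"
  by (cases x) auto

lemma row_in_lower: "row a b c (in_lower x) = em b c x"
  by (cases x) auto

lemma row_outer: "row a b c (outer x) = em a c x"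
  by (cases x) auto

lemma inj_row: "distinct [a, b, c] \<Longrightarrow> inj (row a b c)"
  by (rule injI) (auto simp: row_def split: stack_point.splits)

lemma row_rel:
  "map_prod (row a b c) (row a b c) ` {(x, y). \<exists>B \<in> stacked q p. x \<in> B \<and> y \<in> B} =
   rel a b p \<union> rel b c q"
proof -
  have "{(x, y). \<exists>B \<in> stacked q p. x \<in> B \<and> y \<in> B} =
    {(in_upper x, in_upper y) | x y. same p x y} \<union> {(in_lower x, in_lower y) | x y. same q x y}"
  proof (intro equalityI subsetI)
    fix z assume "z \<in> {(x, y). \<exists>B \<in> stacked q p. x \<in> B \<and> y \<in> B}"
    then obtain x y B where z: "z = (x, y)" "B \<in> stacked q p" "x \<in> B" "y \<in> B" by blast
    then consider C where "C \<in> p" "B = in_upper ` C" | C where "C \<in> q" "B = in_lower ` C"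
      unfolding stacked_def by blast
    then show "z \<in> {(in_upper x, in_upper y) | x y. same p x y} \<union> {(in_lower x, in_lower y) | x y. same q x y}"
      using z by cases (auto simp: same_def)
  qed (auto simp: same_def stacked_def)
  moreover have "map_prod f f ` {(g x, g y) | x y. Q x y} = {(f (g x), f (g y)) | x y. Q x y}"
    for f :: "stack_point \<Rightarrow> nat \<times> nat" and g :: "point \<Rightarrow> stack_point" and Q
  proof (intro equalityI subsetI)
    fix z assume "z \<in> {(f (g x), f (g y)) | x y. Q x y}"
    then obtain x y where "Q x y" "z = map_prod f f (g x, g y)" by auto
    then show "z \<in> map_prod f f ` {(g x, g y) | x y. Q x y}" by blast
  qed auto
  ultimately show ?thesis
    by (simp only: image_Un row_in_upper row_in_lower rel_def)
qed

lemma eq_in_upper_iff: "Top i = in_upper x \<longleftrightarrow> x = Up i" "Mid i = in_upper x \<longleftrightarrow> x = Lo i"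
  "Bot i \<noteq> in_upper x"
  by (cases x; auto)+

lemma eq_in_lower_iff: "Mid i = in_lower x \<longleftrightarrow> x = Up i" "Bot i = in_lower x \<longleftrightarrow> x = Lo i"
  "Top i \<noteq> in_lower x"
  by (cases x; auto)+

lemma row_points: "row a b c ` \<Union>(stacked q p) = em a b ` \<Union>p \<union> em b c ` \<Union>q"
  by (simp add: stacked_def image_Un image_UN image_image row_in_upper row_in_lower)
     (simp add: image_Union image_UN)

text \<open>\<open>row\<close> is injective for distinct row numbers, so connectivity is transported
  unchanged. The freedom in \<open>a\<close>, \<open>b\<close>, \<open>c\<close> lets the same stack
  be read off at any rows of a larger diagram.\<close>

lemma stack_conv_quot:
  assumes "distinct [a, b, c]"
  shows "stack q p = quot (ends q p) (\<lambda>x y. (em a c x, em a c y) \<in> conn a b c q p)"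
proof -
  let ?L = "{(x, y). \<exists>B \<in> stacked q p. x \<in> B \<and> y \<in> B}"
  have tr: "(em a c x, em a c y) \<in> conn a b c q p \<longleftrightarrow> (outer x, outer y) \<in> ?L\<^sup>*" for x y
    using rtrancl_map_prod_inj[OF inj_row[OF assms], of "outer x" "row a b c (outer y)" ?L]
      inj_row[OF assms]
    by (auto simp: row_rel conn_def row_outer[of a b c, symmetric] inj_def)
  have pts: "ends q p = outer -` \<Union>(stacked q p)"
  proof (rule Set.set_eqI)
    fix x
    have "Top i \<in> in_upper ` B \<longleftrightarrow> Up i \<in> B" "Top i \<notin> in_lower ` B"
      "Bot i \<in> in_lower ` B \<longleftrightarrow> Lo i \<in> B" "Bot i \<notin> in_upper ` B" for i B
      by (auto simp: image_iff eq_in_upper_iff eq_in_lower_iff)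
    then show "x \<in> ends q p \<longleftrightarrow> x \<in> outer -` \<Union>(stacked q p)"
      by (cases x) (auto simp: ends_def stacked_def)
  qed
  have symL: "sym (?L\<^sup>*)" by (rule sym_rtrancl) (auto simp: sym_def)
  have memL: "y \<in> \<Union>(stacked q p)" if "(x, y) \<in> ?L\<^sup>*" "x \<in> \<Union>(stacked q p)" for x y
    using that by (induction rule: rtrancl_induct) auto
  have *: "outer -` (?L\<^sup>* `` {outer x}) = {y \<in> ends q p. (outer x, outer y) \<in> ?L\<^sup>*}"
    if "x \<in> ends q p" for x
    using that memL[of "outer x"] by (auto simp: pts)
  show ?thesis
  proof (intro equalityI subsetI)
    fix B assume "B \<in> stack q p"
    then obtain z where z: "z \<in> \<Union>(stacked q p)" "B = outer -` (?L\<^sup>* `` {z})" "B \<noteq> {}"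
      by (auto simp: stack_def components_def elim!: quotientE)
    \<comment> \<open>The component may be represented by a middle point \<open>z\<close>; since its
      outer trace is nonempty, an outer representative can be taken instead.\<close>
    then obtain x where x: "(z, outer x) \<in> ?L\<^sup>*" by auto
    then have "x \<in> ends q p" using memL z(1) pts by auto
    moreover have "?L\<^sup>* `` {z} = ?L\<^sup>* `` {outer x}"
      using x symL unfolding Image_singleton sym_def by (meson rtrancl_trans)
    ultimately show "B \<in> quot (ends q p) (\<lambda>x y. (em a c x, em a c y) \<in> conn a b c q p)"
      using z * by (auto simp: quot_def tr)
  next
    fix B assume "B \<in> quot (ends q p) (\<lambda>x y. (em a c x, em a c y) \<in> conn a b c q p)"
    then obtain x where x: "x \<in> ends q p" "B = outer -` (?L\<^sup>* `` {outer x})"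
      by (auto simp: quot_def tr *)
    then have "x \<in> B" "?L\<^sup>* `` {outer x} \<in> components q p"
      by (auto simp: components_def pts intro!: quotientI)
    then show "B \<in> stack q p" using x by (auto simp: stack_def)
  qed
qed

lemma quotient_conv_image: "A // r = (\<lambda>x. r `` {x}) ` A"
  by (auto simp: quotient_def)

lemma Collect_mem_image: "{d \<in> g ` C. Q d} = g ` {d \<in> C. Q (g d)}"
  by blast

text \<open>The injective \<open>row\<close> carries components bijectively to classes of
  \<open>conn\<close>, and a component consists of middle points exactly when its image lies in row
  \<open>b\<close>.\<close>

lemma loops_conv_card:
  assumes "distinct [a, b, c]"
  shows "loops q p =
    card {d \<in> (em a b ` \<Union>p \<union> em b c ` \<Union>q) // conn a b c q p. d \<subseteq> {b} \<times> UNIV}"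
proof -
  define L where "L = {(x, y). \<exists>B \<in> stacked q p. x \<in> B \<and> y \<in> B}"
  define f where "f = row a b c"
  have inj: "inj f" unfolding f_def by (rule inj_row[OF assms])
  have "conn a b c q p = (map_prod f f ` L)\<^sup>*"
    unfolding conn_def f_def L_def row_rel ..
  then have img: "conn a b c q p `` {f x} = f ` (L\<^sup>* `` {x})" for x
    unfolding Image_singleton by (simp only: rtrancl_map_prod_inj[OF inj]) blast
  have sub: "f ` d \<subseteq> {b} \<times> UNIV \<longleftrightarrow> d \<subseteq> range Mid" for d
  proof -
    have "f x \<in> {b} \<times> UNIV \<longleftrightarrow> x \<in> range Mid" for x
      using assms by (cases x) (auto simp: f_def)
    then show ?thesis by blast
  qed
  have "(em a b ` \<Union>p \<union> em b c ` \<Union>q) // conn a b c q p = image f ` components q p"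
    unfolding row_points[symmetric] components_def quotient_conv_image L_def[symmetric] f_def[symmetric]
      image_image img ..
  then have "{d \<in> (em a b ` \<Union>p \<union> em b c ` \<Union>q) // conn a b c q p. d \<subseteq> {b} \<times> UNIV} =
        image f ` {d \<in> components q p. f ` d \<subseteq> {b} \<times> UNIV}"
    by (simp only: Collect_mem_image)
  moreover have "inj_on (image f) {d \<in> components q p. f ` d \<subseteq> {b} \<times> UNIV}"
    by (rule inj_onI) (simp add: inj_image_eq_iff[OF inj])
  ultimately show ?thesis by (simp add: card_image loops_def sub)
qed

lemma same_quot:
  assumes "\<And>x. x \<in> P \<Longrightarrow> S x x" "\<And>x y. S x y \<Longrightarrow> S y x" "\<And>x y z. S x y \<Longrightarrow> S y z \<Longrightarrow> S x z"
  shows "same (quot P S) x y \<longleftrightarrow> x \<in> P \<and> y \<in> P \<and> S x y"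
proof -
  have "S x' x \<Longrightarrow> S x' y \<Longrightarrow> S x y" for x' using assms(2,3) by blast
  then show ?thesis using assms(1) by (auto simp: same_def quot_def)
qed

lemma Union_quot: "(\<And>x. x \<in> P \<Longrightarrow> S x x) \<Longrightarrow> \<Union>(quot P S) = P"
  by (auto simp: quot_def)

lemma sym_rel: "sym (rel a b p)"
  by (auto simp: sym_def rel_def same_def)

lemma sym_conn: "sym (conn a b c q p)"
  unfolding conn_def by (intro sym_rtrancl sym_Un sym_rel)

lemma trans_conn: "trans (conn a b c q p)"
  unfolding conn_def by (rule trans_rtrancl)

lemma same_stack:
  assumes "distinct [a, b, c]"
  shows "same (stack q p) x y \<longleftrightarrow>
    x \<in> ends q p \<and> y \<in> ends q p \<and> (em a c x, em a c y) \<in> conn a b c q p"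
  unfolding stack_conv_quot[OF assms]
proof (rule same_quot)
  show "(em a c x, em a c x) \<in> conn a b c q p" for x by (simp add: conn_def)
qed (fact symD[OF sym_conn] transD[OF trans_conn])+

lemma Union_stack: "\<Union>(stack q p) = ends q p"
  unfolding stack_conv_quot[of 0 1 2, simplified]
  by (rule Union_quot) (simp add: conn_def)

lemma rel_subset: "rel a b p \<subseteq> em a b ` \<Union>p \<times> em a b ` \<Union>p"
  by (auto simp: rel_def same_def)

text \<open>Contracting the middle row of a two-layer diagram produces the relation of the stacked
  partition. The two relations differ by reflexive pairs at points outside the diagram, so the
  equality is stated after taking closures.\<close>

lemma rtrancl_conn_restrict:
  assumes "distinct [a, b, c]" and V: "V = {x. fst x \<noteq> b}"
  shows "(conn a b c q p \<inter> V \<times> V \<union> S)\<^sup>* = (rel a c (stack q p) \<union> S)\<^sup>*"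
proof (rule antisym; rule rtrancl_subset_rtrancl; rule subrelI)
  fix x y assume xy: "(x, y) \<in> conn a b c q p \<inter> V \<times> V \<union> S"
  show "(x, y) \<in> (rel a c (stack q p) \<union> S)\<^sup>*"
  proof (cases "(x, y) \<in> S \<or> x = y")
    case False
    then have c: "(x, y) \<in> conn a b c q p" "x \<in> V" "y \<in> V" "x \<noteq> y" using xy by auto
    \<comment> \<open>Two distinct connected points lie on edges, hence belong to the diagram; off
      row \<open>b\<close> they are then points of \<open>ends q p\<close>.\<close>
    have F: "x \<in> Field (rel a b p \<union> rel b c q)" "y \<in> Field (rel a b p \<union> rel b c q)"
      using c(1,4) unfolding conn_def
      by (metis FieldI1 converse_rtranclE) (metis FieldI2 c(1,4) conn_def rtranclE)
    have "\<exists>x' \<in> ends q p. z = em a c x'" if z: "z \<in> Field (rel a b p \<union> rel b c q)" "z \<in> V" for z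
    proof -
      have "z \<in> em a b ` \<Union>p \<union> em b c ` \<Union>q"
        using z rel_subset[of a b p] rel_subset[of b c q] by (auto simp: Field_def)
      then consider w where "w \<in> \<Union>p" "z = em a b w" | w where "w \<in> \<Union>q" "z = em b c w" by auto
      then show ?thesis
      proof cases
        case 1
        then obtain i where "w = Up i" using z(2) 1 unfolding V by (cases w) auto
        then show ?thesis using 1 by (intro bexI[of _ "Up i"]) (auto simp: ends_def)
      next
        case 2
        then obtain i where "w = Lo i" using z(2) 2 unfolding V by (cases w) auto
        then show ?thesis using 2 by (intro bexI[of _ "Lo i"]) (auto simp: ends_def)
      qed
    qed
    then obtain x' y' where "x' \<in> ends q p" "y' \<in> ends q p" "x = em a c x'" "y = em a c y'"
      using F c by metis
    then have "(x, y) \<in> rel a c (stack q p)"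
      using c same_stack[OF assms(1), of q p x' y'] by (auto simp: rel_def)
    then show ?thesis by auto
  qed auto
next
  fix x y assume "(x, y) \<in> rel a c (stack q p) \<union> S"
  moreover have "em a c z \<in> V" for z using assms by (cases z) auto
  ultimately have "(x, y) \<in> conn a b c q p \<inter> V \<times> V \<union> S"
    using same_stack[OF assms(1), of q p] by (auto simp: rel_def)
  then show "(x, y) \<in> (conn a b c q p \<inter> V \<times> V \<union> S)\<^sup>*" by auto
qed

lemma ends_stack_left: "ends r (stack q p) = ends r p"
  unfolding ends_def Union_stack by (auto simp: ends_def)

lemma ends_stack_right: "ends (stack r q) p = ends r p"
  unfolding ends_def Union_stack by (auto simp: ends_def)

lemma rel_in_rows: "rel a b p \<subseteq> {x. fst x \<in> {a, b}} \<times> {x. fst x \<in> {a, b}}"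
proof -
  have "fst (em a b x) \<in> {a, b}" for x by (cases x) auto
  then show ?thesis unfolding rel_def by blast
qed

lemma conn_stack_left:
  assumes "distinct [a, b, c, d]" "fst x \<noteq> b" "fst y \<noteq> b"
  shows "(x, y) \<in> conn a c d r (stack q p) \<longleftrightarrow> (x, y) \<in> (rel a b p \<union> rel b c q \<union> rel c d r)\<^sup>*"
proof -
  let ?V = "{x. fst x \<noteq> b}"
  have "rel c d r \<subseteq> ?V \<times> ?V" using rel_in_rows[of c d r] assms(1) by auto
  then show ?thesis
    using rtrancl_elim_iff[of "rel c d r" ?V x y "rel a b p \<union> rel b c q"] assms
      rtrancl_conn_restrict[of a b c ?V q p "rel c d r"]
    by (simp add: conn_def)
qed

lemma conn_stack_right:
  assumes "distinct [a, b, c, d]" "fst x \<noteq> c" "fst y \<noteq> c"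
  shows "(x, y) \<in> conn a b d (stack r q) p \<longleftrightarrow> (x, y) \<in> (rel a b p \<union> rel b c q \<union> rel c d r)\<^sup>*"
proof -
  let ?V = "{x. fst x \<noteq> c}"
  have "rel a b p \<subseteq> ?V \<times> ?V" using rel_in_rows[of a b p] assms(1) by auto
  then show ?thesis
    using rtrancl_elim_iff[of "rel a b p" ?V x y "rel b c q \<union> rel c d r"] assms
      rtrancl_conn_restrict[of b c d ?V r q "rel a b p"]
    by (simp add: conn_def Un_ac)
qed

lemma stack_assoc: "stack r (stack q p) = stack (stack r q) p"
proof -
  have ne: "fst (em 0 3 x) \<noteq> 1" "fst (em 0 3 x) \<noteq> 2" for x by (cases x; simp)+
  have "stack r (stack q p) =
      quot (ends r (stack q p)) (\<lambda>x y. (em 0 3 x, em 0 3 y) \<in> conn 0 2 3 r (stack q p))"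
    by (rule stack_conv_quot) simp
  moreover have "stack (stack r q) p =
      quot (ends (stack r q) p) (\<lambda>x y. (em 0 3 x, em 0 3 y) \<in> conn 0 1 3 (stack r q) p)"
    by (rule stack_conv_quot) simp
  ultimately show ?thesis
    using conn_stack_left[of 0 1 2 3 _ _ r q p, OF _ ne(1) ne(1)]
      conn_stack_right[of 0 1 2 3 _ _ r q p, OF _ ne(2) ne(2)]
    by (simp add: ends_stack_left ends_stack_right)
qed

lemma em_ends_subset: "em a c ` ends q p = (em a b ` \<Union>p \<union> em b c ` \<Union>q) \<inter> {x. fst x \<noteq> b}"
  if "distinct [a, b, c]"
proof (intro equalityI subsetI)
  fix z assume "z \<in> (em a b ` \<Union>p \<union> em b c ` \<Union>q) \<inter> {x. fst x \<noteq> b}"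
  then have zb: "fst z \<noteq> b" and "z \<in> em a b ` \<Union>p \<or> z \<in> em b c ` \<Union>q" by auto
  then consider w where "w \<in> \<Union>p" "z = em a b w" | w where "w \<in> \<Union>q" "z = em b c w" by auto
  then show "z \<in> em a c ` ends q p"
  proof cases
    case 1
    then show ?thesis using zb by (cases w) (auto simp: ends_def intro!: rev_image_eqI[of w])
  next
    case 2
    then show ?thesis using zb by (cases w) (auto simp: ends_def intro!: rev_image_eqI[of w])
  qed
next
  fix z assume "z \<in> em a c ` ends q p"
  then obtain w where w: "w \<in> ends q p" "z = em a c w" by auto
  show "z \<in> (em a b ` \<Union>p \<union> em b c ` \<Union>q) \<inter> {x. fst x \<noteq> b}"
  proof (cases w)
    case (Up i)
    then have "w \<in> \<Union>p" "z = em a b w" using w by (auto simp: ends_def)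
    moreover from this have "fst z \<noteq> b" using that Up by simp
    ultimately show ?thesis by blast
  next
    case (Lo i)
    then have "w \<in> \<Union>q" "z = em b c w" using w by (auto simp: ends_def)
    moreover from this have "fst z \<noteq> b" using that Lo by simp
    ultimately show ?thesis by blast
  qed
qed

text \<open>\<open>?N\<close> counts the components of the four-row diagram contained in its two
  interior rows. Contracting row 1 first gives the left-hand side, contracting row 2 first the
  right-hand side. The identity makes the powers of \<open>t\<close> agree in the associativity of
  composition.\<close>

lemma loops_assoc:
  assumes fin: "finite (\<Union>p)" "finite (\<Union>q)" "finite (\<Union>r)"
  shows "loops r (stack q p) + loops q p = loops (stack r q) p + loops r q"
proof -
  let ?P0 = "em 0 1 ` \<Union>p" and ?P1 = "em 1 2 ` \<Union>q" and ?P2 = "em 2 3 ` \<Union>r"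
  let ?R0 = "rel 0 1 p" and ?R1 = "rel 1 2 q" and ?R2 = "rel 2 3 r"
  let ?V1 = "{x :: nat \<times> nat. fst x \<noteq> 1}" and ?V2 = "{x :: nat \<times> nat. fst x \<noteq> 2}"
  let ?N = "card {c \<in> (?P0 \<union> ?P1 \<union> ?P2) // (?R0 \<union> ?R1 \<union> ?R2)\<^sup>*. c \<subseteq> {x. fst x = 1 \<or> fst x = 2}}"
  have "fst (em 2 3 x) \<noteq> 1" "fst (em 0 1 x) \<noteq> 2" for x by (cases x; simp)+
  then have sub: "?P2 \<subseteq> ?V1" "?P0 \<subseteq> ?V2" by (auto intro!: image_subsetI simp del: One_nat_def)
  have rows: "- {x. fst x \<noteq> b} = {b} \<times> UNIV" "{x. fst x = b} = {b} \<times> UNIV" for b :: nat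
    by auto
  have symU: "sym (rel a b p \<union> rel c d q)" for a b c d p q by (intro sym_Un sym_rel)
  have "?N = card {c \<in> (?P0 \<union> ?P1) // (?R0 \<union> ?R1)\<^sup>*. c \<subseteq> - ?V1} +
    card {d \<in> ((?P0 \<union> ?P1 \<union> ?P2) \<inter> ?V1) // ((?R0 \<union> ?R1)\<^sup>* \<inter> ?V1 \<times> ?V1 \<union> ?R2)\<^sup>*. d \<subseteq> {x. fst x = 2}}"
  proof (subst card_components_split[symmetric])
    show "?P2 \<subseteq> ?V1" by fact
    show "?R0 \<union> ?R1 \<subseteq> (?P0 \<union> ?P1) \<times> (?P0 \<union> ?P1)" using rel_subset by blast
  qed (use fin rel_subset sym_rel symU in \<open>auto intro!: arg_cong[where f = card]\<close>)
  moreover have "(?P0 \<union> ?P1 \<union> ?P2) \<inter> ?V1 = em 0 2 ` \<Union>(stack q p) \<union> ?P2"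
    unfolding Union_stack using sub em_ends_subset[of 0 1 2 q p] by (simp add: Int_Un_distrib2 Int_absorb2)
  moreover have "((?R0 \<union> ?R1)\<^sup>* \<inter> ?V1 \<times> ?V1 \<union> ?R2)\<^sup>* = conn 0 2 3 r (stack q p)"
    using rtrancl_conn_restrict[of 0 1 2 ?V1 q p ?R2] by (simp add: conn_def)
  ultimately have N1: "?N = loops q p + loops r (stack q p)"
    by (simp add: loops_conv_card[of 0 1 2 q p] loops_conv_card[of 0 2 3 r] conn_def rows)
  have "?N = card {c \<in> (?P1 \<union> ?P2) // (?R1 \<union> ?R2)\<^sup>*. c \<subseteq> - ?V2} +
    card {d \<in> ((?P1 \<union> ?P2 \<union> ?P0) \<inter> ?V2) // ((?R1 \<union> ?R2)\<^sup>* \<inter> ?V2 \<times> ?V2 \<union> ?R0)\<^sup>*. d \<subseteq> {x. fst x = 1}}"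
  proof (subst card_components_split[symmetric])
    show "?P0 \<subseteq> ?V2" by fact
    show "?R1 \<union> ?R2 \<subseteq> (?P1 \<union> ?P2) \<times> (?P1 \<union> ?P2)" using rel_subset by blast
  qed (use fin rel_subset sym_rel symU in \<open>auto simp: Un_ac intro!: arg_cong[where f = card]\<close>)
  moreover have "(?P1 \<union> ?P2 \<union> ?P0) \<inter> ?V2 = ?P0 \<union> em 1 3 ` \<Union>(stack r q)"
    unfolding Union_stack using sub em_ends_subset[of 1 2 3 r q] by (simp add: Int_Un_distrib2 Int_absorb2 Un_ac)
  moreover have "((?R1 \<union> ?R2)\<^sup>* \<inter> ?V2 \<times> ?V2 \<union> ?R0)\<^sup>* = conn 0 1 3 (stack r q) p"
    using rtrancl_conn_restrict[of 1 2 3 ?V2 r q ?R0] by (simp add: conn_def Un_ac)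
  ultimately have N2: "?N = loops r q + loops (stack r q) p"
    by (simp add: loops_conv_card[of 1 2 3 r q] loops_conv_card[of 0 1 3 _ p] conn_def rows)
  show ?thesis using N1 N2 by simp
qed

section \<open>Partitions with prescribed numbers of upper and lower points\<close>

definition pts :: "nat \<Rightarrow> nat \<Rightarrow> point set" where
  "pts k l = Up ` {1..k} \<union> Lo ` {1..l}"

lemma pts_iff [simp]: "Up i \<in> pts k l \<longleftrightarrow> 1 \<le> i \<and> i \<le> k" "Lo j \<in> pts k l \<longleftrightarrow> 1 \<le> j \<and> j \<le> l"
  by (auto simp: pts_def)

lemma finite_pts [simp]: "finite (pts k l)"
  by (simp add: pts_def)

lemma partitions_iff: "p \<in> partitions k l \<longleftrightarrow> partition_on (pts k l) p"
  by (simp add: partitions_def pts_def)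

lemma Union_partitions: "p \<in> partitions k l \<Longrightarrow> \<Union>p = pts k l"
  by (simp add: partitions_iff partition_on_def)

lemma finite_partitions: "finite (partitions k l)"
  using finitely_many_partition_on[OF finite_pts, of k l] by (simp add: partitions_def pts_def)

lemma same_refl: "same p x x \<longleftrightarrow> x \<in> \<Union>p"
  by (auto simp: same_def)

lemma same_trans: "partition_on P p \<Longrightarrow> same p x y \<Longrightarrow> same p y z \<Longrightarrow> same p x z"
  unfolding same_def partition_on_def disjoint_def by blast

lemma partition_on_conv_quot:
  assumes p: "partition_on P p"
  shows "p = quot P (same p)"
proof (intro equalityI subsetI)
  fix B assume B: "B \<in> p"
  then obtain x where x: "x \<in> B" using p partition_onD3 by (metis equals0I)
  have "B = {y \<in> P. same p x y}"
  proof (intro equalityI subsetI)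
    fix y assume "y \<in> {y \<in> P. same p x y}"
    then obtain C where "C \<in> p" "x \<in> C" "y \<in> C" by (auto simp: same_def)
    then show "y \<in> B" using B x p by (auto simp: partition_on_def disjoint_def)
  qed (use B x p in \<open>auto simp: same_def partition_on_def\<close>)
  then show "B \<in> quot P (same p)" using B x p by (auto simp: quot_def partition_on_def)
next
  fix B assume "B \<in> quot P (same p)"
  then obtain x where x: "x \<in> P" "B = {y \<in> P. same p x y}" by (auto simp: quot_def)
  then obtain C where C: "C \<in> p" "x \<in> C" using p by (auto simp: partition_on_def)
  have "B = C"
  proof (intro equalityI subsetI)
    fix y assume "y \<in> B"
    then obtain D where "D \<in> p" "x \<in> D" "y \<in> D" using x by (auto simp: same_def)
    then show "y \<in> C" using C p by (auto simp: partition_on_def disjoint_def)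
  qed (use x C p in \<open>auto simp: same_def partition_on_def\<close>)
  then show "B \<in> p" using C by simp
qed

lemma partition_eqI:
  assumes "partition_on P p" "partition_on P q"
    and "\<And>x y. x \<in> P \<Longrightarrow> y \<in> P \<Longrightarrow> same p x y \<longleftrightarrow> same q x y"
  shows "p = q"
proof -
  have "quot P (same p) = quot P (same q)"
    unfolding quot_def using assms(3) by (intro image_cong) auto
  then show ?thesis
    using partition_on_conv_quot[OF assms(1)] partition_on_conv_quot[OF assms(2)] by simp
qed

lemma partition_on_quot:
  assumes "\<And>x. x \<in> P \<Longrightarrow> S x x" "\<And>x y. S x y \<Longrightarrow> S y x" "\<And>x y z. S x y \<Longrightarrow> S y z \<Longrightarrow> S x z"
  shows "partition_on P (quot P S)"
  unfolding partition_on_def disjoint_def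
proof (intro conjI ballI impI)
  show "\<Union>(quot P S) = P" by (rule Union_quot[OF assms(1)])
  show "{} \<notin> quot P S" using assms(1) by (auto simp: quot_def)
  fix B C assume "B \<in> quot P S" "C \<in> quot P S" "B \<noteq> C"
  then obtain x y where xy: "B = {z \<in> P. S x z}" "C = {z \<in> P. S y z}"
    by (auto simp: quot_def)
  show "B \<inter> C = {}"
  proof (rule ccontr)
    assume "B \<inter> C \<noteq> {}"
    then obtain z where "S x z" "S y z" by (auto simp: xy)
    then have "S x w \<longleftrightarrow> S y w" for w by (meson assms(2,3))
    then show False using \<open>B \<noteq> C\<close> xy by simp
  qed
qed

lemma ends_partitions:
  "p \<in> partitions k l \<Longrightarrow> q \<in> partitions l' m \<Longrightarrow> ends q p = pts k m"
  by (auto simp: ends_def Union_partitions pts_def)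

lemma stack_partitions:
  assumes "p \<in> partitions k l" "q \<in> partitions l m"
  shows "stack q p \<in> partitions k m"
proof -
  have "stack q p = quot (pts k m) (\<lambda>x y. (em 0 2 x, em 0 2 y) \<in> conn 0 1 2 q p)"
    using stack_conv_quot[of 0 1 2 q p] ends_partitions[OF assms] by simp
  moreover have "partition_on (pts k m) \<dots>"
    by (rule partition_on_quot) (simp_all add: conn_def, use sym_conn trans_conn in
        \<open>unfold conn_def sym_def trans_def, blast+\<close>)
  ultimately show ?thesis by (simp add: partitions_iff)
qed

section \<open>Evenness\<close>

lemma card_points:
  assumes "finite S"
  shows "card S = card {i. Up i \<in> S} + card {j. Lo j \<in> S}"
proof -
  have "S = Up ` {i. Up i \<in> S} \<union> Lo ` {j. Lo j \<in> S}"
    by (auto simp: image_iff) (metis point.exhaust)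
  moreover have "finite (Up ` {i. Up i \<in> S})" "finite (Lo ` {j. Lo j \<in> S})"
    by (rule finite_subset[OF _ assms]; auto)+
  moreover have "Up ` {i. Up i \<in> S} \<inter> Lo ` {j. Lo j \<in> S} = {}" by auto
  ultimately have "card S = card (Up ` {i. Up i \<in> S}) + card (Lo ` {j. Lo j \<in> S})"
    by (metis card_Un_disjoint)
  then show ?thesis by (simp add: card_image inj_on_def)
qed

lemma even_card_saturated:
  assumes p: "partition_on P p" and fin: "finite P" and even: "\<forall>B \<in> p. even (card B)"
    and sub: "A \<subseteq> P" and sat: "\<And>x y. x \<in> A \<Longrightarrow> same p x y \<Longrightarrow> y \<in> A"
  shows "even (card A)"
proof -
  have "A = \<Union>{B \<in> p. B \<subseteq> A}"
    using p sub sat unfolding same_def partition_on_def by blast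
  moreover have "finite B" if "B \<in> p" for B
    using that p fin by (metis Union_upper finite_subset partition_onD1)
  moreover have "pairwise disjnt {B \<in> p. B \<subseteq> A}"
    using p unfolding partition_on_def disjoint_def pairwise_def disjnt_def by blast
  ultimately have "card A = (\<Sum>B \<in> {B \<in> p. B \<subseteq> A}. card B)"
    by (metis (no_types, lifting) card_Union_disjoint mem_Collect_eq)
  then show ?thesis using even by (auto intro!: dvd_sum)
qed

text \<open>A component of the diagram meets \<open>p\<close> in a union \<open>A\<close> of blocks
  and \<open>q\<close> in a union \<open>A'\<close> of blocks, both of even size. The middle points
  occur in \<open>A\<close> and in \<open>A'\<close>, so removing them from both keeps the parity of
  the total.\<close>

lemma even_stack:
  assumes p: "p \<in> partitions k l" "\<forall>B \<in> p. even (card B)"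
    and q: "q \<in> partitions l m" "\<forall>B \<in> q. even (card B)"
    and B: "B \<in> stack q p"
  shows "even (card B)"
proof -
  let ?c = "conn 0 1 2 q p"
  obtain x where x: "x \<in> pts k m" "B = {y \<in> pts k m. (em 0 2 x, em 0 2 y) \<in> ?c}"
    using B stack_conv_quot[of 0 1 2 q p] ends_partitions[OF p(1) q(1)] by (auto simp: quot_def)
  define A where "A = {y \<in> pts k l. (em 0 2 x, em 0 1 y) \<in> ?c}"
  define A' where "A' = {y \<in> pts l m. (em 0 2 x, em 1 2 y) \<in> ?c}"
  have step: "(u, w) \<in> ?c" if "(u, v) \<in> ?c" "(v, w) \<in> rel 0 1 p \<or> (v, w) \<in> rel 1 2 q" for u v w
    using that unfolding conn_def by (meson UnI1 UnI2 rtrancl.rtrancl_into_rtrancl)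
  have "even (card A)"
  proof (rule even_card_saturated)
    show "partition_on (pts k l) p" using p by (simp add: partitions_iff)
    fix u v assume "u \<in> A" "same p u v"
    moreover from this have "v \<in> pts k l" using p by (auto simp: same_def Union_partitions[symmetric])
    ultimately show "v \<in> A" using step[of "em 0 2 x" "em 0 1 u" "em 0 1 v"] unfolding A_def rel_def by auto
  qed (use p in \<open>auto simp: A_def\<close>)
  moreover have "even (card A')"
  proof (rule even_card_saturated)
    show "partition_on (pts l m) q" using q by (simp add: partitions_iff)
    fix u v assume "u \<in> A'" "same q u v"
    moreover from this have "v \<in> pts l m" using q by (auto simp: same_def Union_partitions[symmetric])
    ultimately show "v \<in> A'" using step[of "em 0 2 x" "em 1 2 u" "em 1 2 v"] unfolding A'_def rel_def by auto
  qed (use q in \<open>auto simp: A'_def\<close>)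
  moreover have "finite A" "finite A'" "finite B"
    unfolding A_def A'_def x(2) by simp_all
  moreover have "{j. Lo j \<in> A} = {i. Up i \<in> A'}" "{i. Up i \<in> B} = {i. Up i \<in> A}"
    "{j. Lo j \<in> B} = {j. Lo j \<in> A'}"
    by (auto simp: A_def A'_def x(2))
  ultimately show ?thesis
    using card_points[of A] card_points[of A'] card_points[of B] by (metis even_add)
qed

section \<open>Noncrossing partitions\<close>

text \<open>Inverse of \<open>position\<close> on the interval from \<open>1\<close> to
  \<open>k + l\<close>; it moves questions about crossings onto a line of numbers.\<close>

definition pt :: "nat \<Rightarrow> nat \<Rightarrow> nat \<Rightarrow> point" where
  "pt k l u = (if u \<le> k then Up u else Lo (k + l + 1 - u))"

lemma position_pt: "u \<le> k + l \<Longrightarrow> position k l (pt k l u) = u"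
  by (auto simp: pt_def)

lemma pt_position: "x \<in> pts k l \<Longrightarrow> pt k l (position k l x) = x"
  by (cases x) (auto simp: pt_def)

lemma position_bounds: "x \<in> pts k l \<Longrightarrow> 1 \<le> position k l x \<and> position k l x \<le> k + l"
  by (cases x) auto

lemma block_eq: "partition_on P p \<Longrightarrow> B \<in> p \<Longrightarrow> C \<in> p \<Longrightarrow> x \<in> B \<Longrightarrow> x \<in> C \<Longrightarrow> B = C"
  by (auto simp: partition_on_def disjoint_def)

text \<open>The contrapositive form mentions only related pairs, not blocks, so it can be
  transported along maps of points.\<close>

lemma noncrossing_iff:
  assumes "p \<in> partitions k l"
  shows "noncrossing k l p \<longleftrightarrow> (\<forall>a b c d. same p a c \<longrightarrow> same p b d \<longrightarrow>
    position k l a < position k l b \<longrightarrow> position k l b < position k l c \<longrightarrow>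
    position k l c < position k l d \<longrightarrow> same p a b)"
proof -
  have p: "partition_on (pts k l) p" using assms by (simp add: partitions_iff)
  have eq: "B = B' \<longleftrightarrow> same p a b" if "B \<in> p" "B' \<in> p" "a \<in> B" "b \<in> B'" for B B' a b
    using that block_eq[OF p] unfolding same_def by metis
  show ?thesis
  proof (intro iffI allI impI)
    fix a b c d
    assume nc: "noncrossing k l p" and "same p a c" "same p b d"
      and ord: "position k l a < position k l b" "position k l b < position k l c"
        "position k l c < position k l d"
    then obtain B B' where B: "B \<in> p" "B' \<in> p" "a \<in> B" "c \<in> B" "b \<in> B'" "d \<in> B'"
      unfolding same_def by blast
    have "\<exists>a \<in> B. \<exists>b \<in> B'. \<exists>c \<in> B. \<exists>d \<in> B'. position k l a < position k l b \<and>
        position k l b < position k l c \<and> position k l c < position k l d"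
      using B ord by (intro bexI[of _ a] bexI[of _ b] bexI[of _ c] bexI[of _ d]) auto
    then have "B = B'" using nc B(1,2) unfolding noncrossing_def by metis
    then show "same p a b" using B by (auto simp: same_def)
  next
    assume *: "\<forall>a b c d. same p a c \<longrightarrow> same p b d \<longrightarrow>
      position k l a < position k l b \<longrightarrow> position k l b < position k l c \<longrightarrow>
      position k l c < position k l d \<longrightarrow> same p a b"
    show "noncrossing k l p"
      unfolding noncrossing_def
    proof (intro notI, elim bexE conjE)
      fix B B' a b c d
      assume B: "B \<in> p" "B' \<in> p" "B \<noteq> B'" "a \<in> B" "b \<in> B'" "c \<in> B" "d \<in> B'"
        and ord: "position k l a < position k l b" "position k l b < position k l c"
          "position k l c < position k l d"
      then have "same p a c" "same p b d" unfolding same_def by blast+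
      then have "same p a b" using * ord by blast
      then show False using eq B by blast
    qed
  qed
qed

section \<open>Noncrossing relations on a line and the gluing of neighbours\<close>

definition nc_on :: "nat set \<Rightarrow> (nat \<Rightarrow> nat \<Rightarrow> bool) \<Rightarrow> bool" where
  "nc_on T E \<longleftrightarrow> (\<forall>a \<in> T. \<forall>b \<in> T. \<forall>c \<in> T. \<forall>d \<in> T.
     a < b \<longrightarrow> b < c \<longrightarrow> c < d \<longrightarrow> E a c \<longrightarrow> E b d \<longrightarrow> E a b)"

text \<open>For an equivalence relation \<open>E\<close> this is the equivalence generated by
  \<open>E\<close> and the pair \<open>x\<close>, \<open>y\<close>. The closed form makes crossings
  accessible to a case analysis.\<close>

definition merge :: "('a \<Rightarrow> 'a \<Rightarrow> bool) \<Rightarrow> 'a \<Rightarrow> 'a \<Rightarrow> 'a \<Rightarrow> 'a \<Rightarrow> bool" where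
  "merge E x y u v \<longleftrightarrow> E u v \<or> E u x \<and> E y v \<or> E u y \<and> E x v"

lemma equivp_merge:
  assumes "equivp E" shows "equivp (merge E x y)"
proof -
  have [simp]: "E u u" for u using assms by (simp add: equivp_reflp)
  have s: "E u v \<Longrightarrow> E v u" for u v using assms by (rule equivp_symp)
  have t: "E u v \<Longrightarrow> E v w \<Longrightarrow> E u w" for u v w using assms by (rule equivp_transp)
  show ?thesis
  proof (rule equivpI)
    show "reflp (merge E x y)" by (simp add: reflp_def merge_def)
    show "symp (merge E x y)" by (rule sympI) (auto simp: merge_def intro: s)
    show "transp (merge E x y)"
      by (rule transpI) (unfold merge_def, meson s t)
  qed
qed

lemma nc_on_subset: "nc_on T E \<Longrightarrow> T' \<subseteq> T \<Longrightarrow> nc_on T' E"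
  unfolding nc_on_def by blast

text \<open>Joining the classes of neighbouring points creates no crossing: in a new crossing the
  other class would have to separate \<open>x\<close> from \<open>y\<close>, but \<open>T\<close>
  has no point strictly between them.\<close>

lemma nc_on_merge:
  assumes E: "equivp E" and nc: "nc_on T E" and T: "x \<in> T" "y \<in> T" "x < y"
    and adj: "\<And>z. z \<in> T \<Longrightarrow> z \<le> x \<or> y \<le> z"
  shows "nc_on T (merge E x y)"
  unfolding nc_on_def
proof (intro ballI impI)
  fix a b c d
  assume abcd: "a \<in> T" "b \<in> T" "c \<in> T" "d \<in> T" "a < b" "b < c" "c < d"
    and ac: "merge E x y a c" and bd: "merge E x y b d"
  have r: "E u u" for u using E by (rule equivp_reflp)
  have s: "E u v \<Longrightarrow> E v u" for u v using E by (rule equivp_symp)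
  have t: "E u v \<Longrightarrow> E v w \<Longrightarrow> E u w" for u v w using E by (rule equivp_transp)
  have nc: "E u v" if "u \<in> T" "v \<in> T" "w \<in> T" "z \<in> T" "u < v" "v < w" "w < z" "E u w" "E v z" for u v w z
    using nc that unfolding nc_on_def by blast
  show "merge E x y a b"
  proof (rule ccontr)
    assume "\<not> merge E x y a b"
    then have no: "\<not> E a b" "\<not> (E a x \<and> E b y)" "\<not> (E a y \<and> E b x)" using s by (auto simp: merge_def)
    \<comment> \<open>Here \<open>a\<close> and \<open>c\<close> are linked only through the new
      pair. Noncrossingness of \<open>E\<close> puts \<open>v\<close> between \<open>b\<close> and
      \<open>d\<close> and \<open>u\<close> outside, so \<open>b\<close> or \<open>d\<close>
      separates \<open>u\<close> from \<open>v\<close>.\<close>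
    have key: False if uv: "{u, v} = {x, y}" "E a u" "E c v" "E b d" "\<not> E b x" "\<not> E b y" for u v
    proof -
      have uT: "u \<in> T" "v \<in> T" using uv(1) T by (auto simp: doubleton_eq_iff)
      have ub: "u \<noteq> b" "u \<noteq> d" "v \<noteq> b" "v \<noteq> d"
        using uv s r by (auto simp: doubleton_eq_iff)
      have "\<not> (b < u \<and> u < d)"
        using nc[of a b u d] abcd uT uv(2,4) no(1) by blast
      moreover have "\<not> (v < b)"
        using nc[of v b c d] abcd uT uv s t by (metis doubleton_eq_iff)
      moreover have "\<not> d < v"
        using nc[of b c d v] abcd uT uv s t by (metis doubleton_eq_iff)
      ultimately have "b < v" "v < d" "u < b \<or> d < u" using ub by auto
      then show False using adj[of b] adj[of d] abcd uv(1) T by (auto simp: doubleton_eq_iff)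
    qed
    \<comment> \<open>The mirror case: \<open>b\<close> and \<open>d\<close> are linked through the
      new pair, \<open>u\<close> lies between \<open>a\<close> and \<open>c\<close> and
      \<open>v\<close> outside, so \<open>a\<close> or \<open>c\<close> separates them.\<close>
    have key': False if uv: "{u, v} = {x, y}" "E b u" "E d v" "E a c" "\<not> E a x" "\<not> E a y" for u v
    proof -
      have uT: "u \<in> T" "v \<in> T" using uv(1) T by (auto simp: doubleton_eq_iff)
      have ub: "u \<noteq> a" "u \<noteq> c" "v \<noteq> a" "v \<noteq> c"
        using uv r by (auto simp: doubleton_eq_iff)
      have ne: "\<not> E a u" "\<not> E a v" "E u b" "E v d"
        using uv s by (auto simp: doubleton_eq_iff)
      have "\<not> (c < u)"
        using nc[of a b c u] abcd uT uv(2,4) no(1) by blast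
      moreover have "\<not> u < a"
        using nc[of u a b c] abcd uT uv(4) ne s by blast
      moreover have "\<not> (a < v \<and> v < c)"
        using nc[of a v c d] abcd uT uv(4) ne by blast
      ultimately have "a < u" "u < c" "v < a \<or> c < v" using ub by auto
      then show False using adj[of a] adj[of c] abcd uv(1) T by (auto simp: doubleton_eq_iff)
    qed
    have nE: "\<not> (E a c \<and> E b d)" using nc[of a b c d] abcd no(1) by blast
    show False
    \<comment> \<open>If \<open>b\<close> belongs to the merged class then \<open>a\<close> does
      not, since otherwise they would already be merged; so at most one of the two links uses the
      new pair.\<close>
    proof (cases "E b x \<or> E b y")
      case True
      then have nax: "\<not> E a x" "\<not> E a y" using no s t by blast+
      then have "E a c" using ac by (auto simp: merge_def)
      then have "\<not> E b d" using nE by blast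
      then consider "E b x" "E d y" | "E b y" "E d x" using bd s by (auto simp: merge_def)
      then show False using key'[of x y] key'[of y x] nax \<open>E a c\<close> by cases auto
    next
      case False
      then have "E b d" using bd by (auto simp: merge_def)
      then have "\<not> E a c" using nE by blast
      then consider "E a x" "E c y" | "E a y" "E c x" using ac s by (auto simp: merge_def)
      then show False using key[of x y] key[of y x] False \<open>E b d\<close> by cases auto
    qed
  qed
qed

text \<open>With \<open>c = k + l\<close>, the last position of \<open>p\<close>, the positions
  \<open>c - i\<close> and \<open>c + 1 + i\<close> are the lower point \<open>i + 1\<close> of
  \<open>p\<close> and the upper point \<open>i + 1\<close> of \<open>q\<close>. The innermost pair
  is glued first.\<close>

primrec glue :: "nat \<Rightarrow> (nat \<Rightarrow> nat \<Rightarrow> bool) \<Rightarrow> nat \<Rightarrow> nat \<Rightarrow> nat \<Rightarrow> bool" where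
  "glue c E 0 = E"
| "glue c E (Suc i) = merge (glue c E i) (c - i) (c + 1 + i)"

lemma equivp_glue: "equivp E \<Longrightarrow> equivp (glue c E i)"
  by (induction i) (auto intro: equivp_merge)

text \<open>Glued positions are dropped from the index set after each step; only then do the members
  of the next pair become neighbours, as \<open>nc_on_merge\<close> demands.\<close>

lemma nc_on_glue:
  assumes "equivp E" "nc_on {1..n} E" "i \<le> c" "c + i \<le> n"
  shows "nc_on ({1..n} - {c + 1 - i..c + i}) (glue c E i)"
  using assms(3,4)
proof (induction i)
  case 0
  then show ?case using assms(2) by (auto intro: nc_on_subset)
next
  case (Suc i)
  let ?T = "{1..n} - {c + 1 - i..c + i}"
  have "nc_on ?T (merge (glue c E i) (c - i) (c + 1 + i))"
  proof (rule nc_on_merge)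
    show "equivp (glue c E i)" using assms(1) by (rule equivp_glue)
    show "nc_on ?T (glue c E i)" using Suc by simp
  qed (use Suc.prems in auto)
  then have "nc_on ({1..n} - {c + 1 - Suc i..c + Suc i}) (merge (glue c E i) (c - i) (c + 1 + i))"
    by (rule nc_on_subset) auto
  then show ?case by simp
qed

lemma glue_mono: "i \<le> j \<Longrightarrow> glue c E i u v \<Longrightarrow> glue c E j u v"
  by (induction j rule: dec_induct) (auto simp: merge_def)

lemma glue_pair: "equivp E \<Longrightarrow> i < j \<Longrightarrow> glue c E j (c - i) (c + 1 + i)"
  by (rule glue_mono[of "Suc i"]) (auto simp: merge_def equivp_reflp[OF equivp_glue])

text \<open>Writing the points of \<open>p\<close> and \<open>q\<close> on one line, the pairs of points to be identified are nested
  around the gap between \<open>p\<close> and \<open>q\<close>, so they can be glued one after the other.\<close>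

lemma noncrossing_stack:
  assumes p: "p \<in> partitions k l" "noncrossing k l p" and q: "q \<in> partitions l m" "noncrossing l m q"
  shows "noncrossing k m (stack q p)"
proof -
  let ?c = "k + l" and ?n = "k + l + l + m" and ?J = "conn 0 1 2 q p"
  \<comment> \<open>\<open>p\<close> occupies the positions up to \<open>?c\<close> and
    \<open>q\<close> the later ones. The clause \<open>u = v\<close> makes the relation reflexive
    also off the line.\<close>
  define E where "E = (\<lambda>u v. u = v \<or>
    (u \<in> {1..?c} \<and> v \<in> {1..?c} \<and> same p (pt k l u) (pt k l v)) \<or>
    (u \<in> {?c + 1..?n} \<and> v \<in> {?c + 1..?n} \<and> same q (pt l m (u - ?c)) (pt l m (v - ?c))))"
  have pp: "partition_on (pts k l) p" and qq: "partition_on (pts l m) q"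
    using p q by (simp_all add: partitions_iff)
  have tp: "same p u v \<Longrightarrow> same p v w \<Longrightarrow> same p u w" for u v w by (rule same_trans[OF pp])
  have tq: "same q u v \<Longrightarrow> same q v w \<Longrightarrow> same q u w" for u v w by (rule same_trans[OF qq])
  have eqE: "equivp E"
  proof (rule equivpI)
    show "reflp E" by (simp add: reflp_def E_def)
    show "symp E" by (rule sympI) (auto simp: E_def intro: same_sym)
    show "transp E" 
    proof (rule transpI)
      fix u v w assume uv: "E u v" and vw: "E v w"
      then consider "u = v" | "v = w" | "v \<le> ?c" "u \<noteq> v" "v \<noteq> w" | "v > ?c" "u \<noteq> v" "v \<noteq> w" by linarith
      then show "E u w"
      proof cases
        case 3
        then show ?thesis using uv vw tp[of "pt k l u" "pt k l v" "pt k l w"] by (simp add: E_def)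
      next
        case 4
        then show ?thesis
          using uv vw tq[of "pt l m (u - ?c)" "pt l m (v - ?c)" "pt l m (w - ?c)"] by (simp add: E_def)
      qed (use uv vw in auto)
    qed
  qed
  have ncE: "nc_on {1..?n} E"
    unfolding nc_on_def
  proof (intro ballI impI)
    fix a b c d assume abcd: "a < b" "b < c" "c < d" and ac: "E a c" and bd: "E b d"
      and in1: "a \<in> {1..?n}" "b \<in> {1..?n}" "c \<in> {1..?n}" "d \<in> {1..?n}"
    consider "c \<le> ?c" "same p (pt k l a) (pt k l c)"
      | "a > ?c" "same q (pt l m (a - ?c)) (pt l m (c - ?c))"
      using ac abcd by (auto simp: E_def)
    then show "E a b"
    proof cases
      case 1
      then have "d \<le> ?c" "same p (pt k l b) (pt k l d)" using bd abcd by (auto simp: E_def)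
      then have "same p (pt k l a) (pt k l b)"
        using 1 abcd p(2)[unfolded noncrossing_iff[OF p(1)], rule_format,
            of "pt k l a" "pt k l c" "pt k l b" "pt k l d"]
        by (simp add: position_pt)
      then show ?thesis using 1 abcd in1 by (auto simp: E_def)
    next
      case 2
      then have bd': "same q (pt l m (b - ?c)) (pt l m (d - ?c))" using bd abcd by (auto simp: E_def)
      have "a - ?c \<le> l + m" "b - ?c \<le> l + m" "c - ?c \<le> l + m" "d - ?c \<le> l + m"
        "a - ?c < b - ?c" "b - ?c < c - ?c" "c - ?c < d - ?c"
        using 2 abcd in1 by auto
      then have "same q (pt l m (a - ?c)) (pt l m (b - ?c))"
        using 2(2) bd' q(2)[unfolded noncrossing_iff[OF q(1)], rule_format,
            of "pt l m (a - ?c)" "pt l m (c - ?c)" "pt l m (b - ?c)" "pt l m (d - ?c)"]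
        by (simp add: position_pt)
      then show ?thesis using 2 abcd in1 by (auto simp: E_def)
    qed
  qed
  define G where "G = glue ?c E l"
  have eqG: "equivp G" unfolding G_def using eqE by (rule equivp_glue)
  have ncG: "nc_on ({1..?n} - {k + 1..k + l + l}) G"
    using nc_on_glue[OF eqE ncE, of l ?c] by (simp add: G_def)
  \<comment> \<open>From positions to points of the row diagram; both positions of a glued pair go
    to the same middle point, so gluing implies connectivity.\<close>
  define \<sigma> where "\<sigma> u = (if u \<le> ?c then em 0 1 (pt k l u) else em 1 2 (pt l m (u - ?c)))" for u
  have "(\<sigma> u, \<sigma> v) \<in> ?J" if "glue ?c E i u v" "i \<le> l" for i u v
    using that
  proof (induction i arbitrary: u v)
    case 0
    then have "\<sigma> u = \<sigma> v \<or> (\<sigma> u, \<sigma> v) \<in> rel 0 1 p \<union> rel 1 2 q"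
      by (auto simp: E_def rel_def \<sigma>_def)
    then show ?case by (auto simp: conn_def)
  next
    case (Suc i)
    have "\<sigma> (?c - i) = (1, Suc i)" "\<sigma> (?c + 1 + i) = (1, Suc i)"
      using Suc.prems(2) by (auto simp: \<sigma>_def pt_def)
    then show ?case
      using Suc.prems Suc.IH[of u v] Suc.IH[of u "?c - i"] Suc.IH[of u "?c + 1 + i"]
        Suc.IH[of "?c - i" v] Suc.IH[of "?c + 1 + i" v] trans_conn[of 0 1 2 q p]
      by (simp add: merge_def) (metis transD)
  qed
  then have GJ: "G u v \<Longrightarrow> (\<sigma> u, \<sigma> v) \<in> ?J" for u v by (simp add: G_def)
  \<comment> \<open>A section of \<open>\<sigma>\<close> on the outer points. A middle point has two
    positions, and the one in \<open>p\<close> is selected; hence upper points of \<open>q\<close>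
    reach their own position only up to the gluing, which is the content of
    \<open>rq\<close>.\<close>
  define \<rho> where "\<rho> x = (if fst x = 0 then snd x else if fst x = 1 then ?c + 1 - snd x
    else ?c + (l + m + 1 - snd x))" for x :: "nat \<times> nat"
  have EG: "E u v \<Longrightarrow> G u v" for u v unfolding G_def by (rule glue_mono[of 0]) auto
  have rp: "\<rho> (em 0 1 x) = position k l x" if "x \<in> pts k l" for x
    using that by (cases x) (auto simp: \<rho>_def)
  have rq: "G (\<rho> (em 1 2 x)) (?c + position l m x)" if "x \<in> pts l m" for x
  proof (cases x)
    case (Up i)
    then have "G (?c - (i - 1)) (?c + 1 + (i - 1))"
      using that unfolding G_def by (intro glue_pair[OF eqE]) auto
    then show ?thesis using Up that by (auto simp: \<rho>_def)
  next
    case (Lo j)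
    then show ?thesis using that equivp_reflp[OF eqG] by (auto simp: \<rho>_def)
  qed
  have relG: "G (\<rho> x) (\<rho> y)" if "(x, y) \<in> rel 0 1 p \<union> rel 1 2 q" for x y
    using that
  proof
    assume "(x, y) \<in> rel 0 1 p"
    then obtain x' y' where xy: "x = em 0 1 x'" "y = em 0 1 y'" "same p x' y'" by (auto simp: rel_def)
    then have "x' \<in> pts k l" "y' \<in> pts k l" using p(1) by (auto simp: same_def Union_partitions[symmetric])
    then have "E (\<rho> x) (\<rho> y)"
      using xy position_bounds[of x' k l] position_bounds[of y' k l] rp[of x'] rp[of y']
      by (auto simp: E_def pt_position)
    then show ?thesis by (rule EG)
  next
    assume "(x, y) \<in> rel 1 2 q"
    then obtain x' y' where xy: "x = em 1 2 x'" "y = em 1 2 y'" "same q x' y'" by (auto simp: rel_def)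
    then have in': "x' \<in> pts l m" "y' \<in> pts l m" using q(1) by (auto simp: same_def Union_partitions[symmetric])
    then have "E (?c + position l m x') (?c + position l m y')"
      using xy position_bounds[of x' l m] position_bounds[of y' l m] by (auto simp: E_def pt_position)
    then show ?thesis
      using EG rq[OF in'(1)] rq[OF in'(2)] xy(1,2) equivp_symp[OF eqG] equivp_transp[OF eqG] by meson
  qed
  have JG: "G (\<rho> x) (\<rho> y)" if "(x, y) \<in> ?J" for x y
    using that unfolding conn_def
  proof (induction rule: rtrancl_induct)
    case (step y z)
    then show ?case using relG[of y z] equivp_transp[OF eqG] by blast
  qed (rule equivp_reflp[OF eqG])
  have st: "stack q p \<in> partitions k m" using p(1) q(1) by (rule stack_partitions)
  have sig: "\<sigma> (\<rho> (em 0 2 x)) = em 0 2 x" if "x \<in> pts k m" for x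
    using that by (cases x) (auto simp: \<sigma>_def \<rho>_def pt_def)
  have inT: "\<rho> (em 0 2 x) \<in> {1..?n} - {k + 1..k + l + l}" if "x \<in> pts k m" for x
    using that by (cases x) (auto simp: \<rho>_def)
  have mono: "\<rho> (em 0 2 x) < \<rho> (em 0 2 y)" if "x \<in> pts k m" "y \<in> pts k m" "position k m x < position k m y" for x y
    using that by (cases x; cases y) (auto simp: \<rho>_def)
  show ?thesis
    unfolding noncrossing_iff[OF st]
  proof (intro allI impI)
    fix a b c d
    assume ac: "same (stack q p) a c" and bd: "same (stack q p) b d"
      and ord: "position k m a < position k m b" "position k m b < position k m c"
        "position k m c < position k m d"
    have sm: "same (stack q p) x y \<longleftrightarrow> x \<in> pts k m \<and> y \<in> pts k m \<and> (em 0 2 x, em 0 2 y) \<in> ?J" for x y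
      using same_stack[of 0 1 2 q p] ends_partitions[OF p(1) q(1)] by simp
    have P: "a \<in> pts k m" "b \<in> pts k m" "c \<in> pts k m" "d \<in> pts k m" using ac bd by (simp_all add: sm)
    have "G (\<rho> (em 0 2 a)) (\<rho> (em 0 2 b))"
      using ncG[unfolded nc_on_def, rule_format, OF inT inT inT inT mono mono mono, of a b c d]
        JG[of "em 0 2 a" "em 0 2 c"] JG[of "em 0 2 b" "em 0 2 d"] P ord ac bd by (simp add: sm)
    then show "same (stack q p) a b" using GJ[of "\<rho> (em 0 2 a)" "\<rho> (em 0 2 b)"] P by (simp add: sm sig)
  qed
qed

lemma stack_NC_even: "p \<in> NC_even k l \<Longrightarrow> q \<in> NC_even l m \<Longrightarrow> stack q p \<in> NC_even k m"
  unfolding NC_even_def using stack_partitions even_stack noncrossing_stack by blast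

section \<open>Through-blocks\<close>

definition through_blocks :: "part \<Rightarrow> part" where
  "through_blocks p = {B \<in> p. (\<exists>i. Up i \<in> B) \<and> (\<exists>j. Lo j \<in> B)}"

lemma through_conv: "through p = card (through_blocks p)"
  unfolding through_def through_blocks_def by (rule arg_cong[where f = card]) blast

lemma finite_partition: "p \<in> partitions k l \<Longrightarrow> finite p"
  using finite_elements[OF finite_pts] by (auto simp: partitions_iff)

lemma finite_through_blocks: "p \<in> partitions k l \<Longrightarrow> finite (through_blocks p)"
  unfolding through_blocks_def using finite_partition by auto

text \<open>A path can leave the top row only along a block of \<open>p\<close> with both upper and
  lower points. Together with its mirror image this bounds the through-blocks of a stack by those of
  either factor.\<close>

lemma conn_upper_through:
  assumes "((0, i), y) \<in> conn 0 1 2 q p"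
  shows "fst y = 0 \<or> (\<exists>i' j'. same p (Up i') (Lo j') \<and> ((0, i), (0, i')) \<in> conn 0 1 2 q p)"
  using assms unfolding conn_def
proof (induction rule: rtrancl_induct)
  case (step y z)
  from step.hyps(2) show ?case
  proof
    assume "(y, z) \<in> rel 0 1 p"
    then obtain u v where uv: "y = em 0 1 u" "z = em 0 1 v" "same p u v" by (auto simp: rel_def)
    then show ?thesis using step by (cases u; cases v) auto
  next
    assume "(y, z) \<in> rel 1 2 q"
    then obtain u v where uv: "y = em 1 2 u" by (auto simp: rel_def)
    then show ?thesis using step by (cases u) auto
  qed
qed simp

lemma conn_lower_through:
  assumes "((2, j), y) \<in> conn 0 1 2 q p"
  shows "fst y = 2 \<or> (\<exists>i' j'. same q (Up i') (Lo j') \<and> ((2, j), (2, j')) \<in> conn 0 1 2 q p)"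
  using assms unfolding conn_def
proof (induction rule: rtrancl_induct)
  case (step y z)
  from step.hyps(2) show ?case
  proof
    assume "(y, z) \<in> rel 1 2 q"
    then obtain u v where uv: "y = em 1 2 u" "z = em 1 2 v" "same q u v" by (auto simp: rel_def)
    then show ?thesis using step by (cases u; cases v) (auto dest: same_sym)
  next
    assume "(y, z) \<in> rel 0 1 p"
    then obtain u v where uv: "y = em 0 1 u" by (auto simp: rel_def)
    then show ?thesis using step by (cases u) auto
  qed
qed simp

lemma same_block: "partition_on P p \<Longrightarrow> B \<in> p \<Longrightarrow> x \<in> B \<Longrightarrow> same p x y \<longleftrightarrow> y \<in> B"
  using block_eq unfolding same_def by metis

lemma same_stack_upper:
  assumes "p \<in> partitions k l" "q \<in> partitions l m" "same p (Up i) (Up i')"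
  shows "same (stack q p) (Up i) (Up i')"
proof -
  have "Up i \<in> pts k l" "Up i' \<in> pts k l"
    using assms(1,3) by (auto simp: same_def Union_partitions[symmetric])
  moreover have "(em 0 1 (Up i), em 0 1 (Up i')) \<in> rel 0 1 p" using assms(3) unfolding rel_def by blast
  then have "(em 0 2 (Up i), em 0 2 (Up i')) \<in> conn 0 1 2 q p" unfolding conn_def by auto
  ultimately show ?thesis
    using same_stack[of 0 1 2 q p] ends_partitions[OF assms(1,2)] by simp
qed

lemma same_stack_lower:
  assumes "p \<in> partitions k l" "q \<in> partitions l m" "same q (Lo i) (Lo i')"
  shows "same (stack q p) (Lo i) (Lo i')"
proof -
  have "Lo i \<in> pts l m" "Lo i' \<in> pts l m"
    using assms(2,3) by (auto simp: same_def Union_partitions[symmetric])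
  moreover have "(em 1 2 (Lo i), em 1 2 (Lo i')) \<in> rel 1 2 q" using assms(3) unfolding rel_def by blast
  then have "(em 0 2 (Lo i), em 0 2 (Lo i')) \<in> conn 0 1 2 q p" unfolding conn_def by auto
  ultimately show ?thesis
    using same_stack[of 0 1 2 q p] ends_partitions[OF assms(1,2)] by simp
qed

text \<open>Assign to each through-block of \<open>s\<close> a through-block of \<open>p\<close>
  sharing a point \<open>c i\<close> with it. A block of \<open>p\<close> stays within one block of
  \<open>s\<close> as far as the points \<open>c i\<close> are concerned, so the assignment is
  injective. In use \<open>c\<close> is \<open>Up\<close> or \<open>Lo\<close>.\<close>

lemma through_le:
  assumes s: "partition_on P s" and fin: "finite (through_blocks p)"
    and ex: "\<And>B. B \<in> through_blocks s \<Longrightarrow> \<exists>i. \<exists>C \<in> through_blocks p. c i \<in> B \<and> c i \<in> C"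
    and same: "\<And>i j. same p (c i) (c j) \<Longrightarrow> same s (c i) (c j)"
  shows "through s \<le> through p"
  unfolding through_conv
proof (rule card_le_if_inj_on_rel[where r = "\<lambda>B C. \<exists>i. c i \<in> B \<and> c i \<in> C"])
  show "\<exists>C. C \<in> through_blocks p \<and> (\<exists>i. c i \<in> B \<and> c i \<in> C)" if "B \<in> through_blocks s" for B
    using ex[OF that] by blast
  fix B1 B2 C
  assume B: "B1 \<in> through_blocks s" "B2 \<in> through_blocks s" "C \<in> through_blocks p"
    "\<exists>i. c i \<in> B1 \<and> c i \<in> C" "\<exists>i. c i \<in> B2 \<and> c i \<in> C"
  then obtain i j where i: "c i \<in> B1" "c i \<in> C" "c j \<in> B2" "c j \<in> C" by blast
  then have "same s (c i) (c j)" using B(3) by (intro same) (auto simp: same_def through_blocks_def)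
  moreover have "B1 \<in> s" "B2 \<in> s" using B by (auto simp: through_blocks_def)
  ultimately show "B1 = B2" using i same_block[OF s] block_eq[OF s] by metis
qed (rule fin)

lemma through_stack_le:
  assumes p: "p \<in> partitions k l" and q: "q \<in> partitions l m"
  shows "through (stack q p) \<le> through p" "through (stack q p) \<le> through q"
proof -
  let ?s = "stack q p"
  have P: "partition_on (pts k m) ?s"
    using stack_partitions[OF p q] by (simp add: partitions_iff)
  have sm: "same ?s x y \<longleftrightarrow> x \<in> pts k m \<and> y \<in> pts k m \<and> (em 0 2 x, em 0 2 y) \<in> conn 0 1 2 q p" for x y
    using same_stack[of 0 1 2 q p] ends_partitions[OF p q] by simp
  show "through ?s \<le> through p"
  proof (rule through_le[OF P finite_through_blocks[OF p], of Up])
    fix B assume "B \<in> through_blocks ?s"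
    then obtain i j where B: "B \<in> ?s" "Up i \<in> B" "Lo j \<in> B" by (auto simp: through_blocks_def)
    then have "same ?s (Up i) (Lo j)" by (auto simp: same_def)
    then have i: "Up i \<in> pts k m" "((0, i), (2, j)) \<in> conn 0 1 2 q p" by (simp_all add: sm)
    then obtain i' j' where ij: "same p (Up i') (Lo j')" "((0, i), (0, i')) \<in> conn 0 1 2 q p"
      using conn_upper_through[OF i(2)] by auto
    then obtain C where C: "C \<in> p" "Up i' \<in> C" "Lo j' \<in> C" by (auto simp: same_def)
    then have "Up i' \<in> pts k l" using p by (auto simp: Union_partitions[symmetric])
    then have "same ?s (Up i) (Up i')" using i ij(2) by (simp add: sm)
    then show "\<exists>i. \<exists>C \<in> through_blocks p. Up i \<in> B \<and> Up i \<in> C"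
      using same_block[OF P B(1,2)] C unfolding through_blocks_def by blast
  qed (rule same_stack_upper[OF p q])
  show "through ?s \<le> through q"
  proof (rule through_le[OF P finite_through_blocks[OF q], of Lo])
    fix B assume "B \<in> through_blocks ?s"
    then obtain i j where B: "B \<in> ?s" "Up i \<in> B" "Lo j \<in> B" by (auto simp: through_blocks_def)
    then have "same ?s (Lo j) (Up i)" by (auto simp: same_def)
    then have i: "Lo j \<in> pts k m" "((2, j), (0, i)) \<in> conn 0 1 2 q p" by (simp_all add: sm)
    then obtain i' j' where ij: "same q (Up i') (Lo j')" "((2, j), (2, j')) \<in> conn 0 1 2 q p"
      using conn_lower_through[OF i(2)] by auto
    then obtain C where C: "C \<in> q" "Up i' \<in> C" "Lo j' \<in> C" by (auto simp: same_def)
    then have "Lo j' \<in> pts l m" using q by (auto simp: Union_partitions[symmetric])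
    then have "same ?s (Lo j) (Lo j')" using i ij(2) by (simp add: sm)
    then show "\<exists>i. \<exists>C \<in> through_blocks q. Lo i \<in> B \<and> Lo i \<in> C"
      using same_block[OF P B(1,3)] C unfolding through_blocks_def by blast
  qed (rule same_stack_lower[OF p q])
qed

section \<open>Partitions as kernels of labellings\<close>

text \<open>The labels may have any type: tensor factors are labelled by numbers, points of a
  factored partition by its blocks.\<close>

definition kern :: "nat \<Rightarrow> nat \<Rightarrow> (point \<Rightarrow> 'b) \<Rightarrow> part" where
  "kern k l f = quot (pts k l) (\<lambda>x y. f x = f y)"

lemma kern_partitions: "kern k l f \<in> partitions k l"
  unfolding kern_def partitions_iff by (rule partition_on_quot) auto

lemma same_kern: "same (kern k l f) x y \<longleftrightarrow> x \<in> pts k l \<and> y \<in> pts k l \<and> f x = f y"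
  unfolding kern_def by (rule same_quot) auto

lemma kern_cong:
  "(\<And>x y. x \<in> pts k l \<Longrightarrow> y \<in> pts k l \<Longrightarrow> f x = f y \<longleftrightarrow> g x = g y) \<Longrightarrow> kern k l f = kern k l g"
  unfolding kern_def quot_def by (intro image_cong) auto

text \<open>By \<open>mid\<close> the labels fit together to one labelling of the diagram that is
  constant along edges, so connected points have equal labels. Conversely, \<open>ex\<close> joins
  an upper and a lower point of equal label through a middle point with that label.\<close>

lemma stack_kern:
  assumes mid: "\<And>j. 1 \<le> j \<Longrightarrow> j \<le> l \<Longrightarrow> f (Lo j) = g (Up j)"
    and ex: "\<And>i j. 1 \<le> i \<Longrightarrow> i \<le> k \<Longrightarrow> 1 \<le> j \<Longrightarrow> j \<le> m \<Longrightarrow> f (Up i) = g (Lo j) \<Longrightarrow>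
      \<exists>j'. 1 \<le> j' \<and> j' \<le> l \<and> f (Lo j') = f (Up i)"
  shows "stack (kern l m g) (kern k l f) =
    kern k m (\<lambda>x. case x of Up i \<Rightarrow> f (Up i) | Lo j \<Rightarrow> g (Lo j))"
    (is "stack ?q ?p = kern k m ?h")
proof -
  define \<Lambda> where "\<Lambda> z = (if fst z = 0 then f (Up (snd z)) else if fst z = 1 then f (Lo (snd z))
    else g (Lo (snd z)))" for z :: "nat \<times> nat"
  have c: "(em 0 2 x, em 0 2 y) \<in> conn 0 1 2 ?q ?p \<longleftrightarrow> ?h x = ?h y"
    if xy: "x \<in> pts k m" "y \<in> pts k m" for x y
  proof
    have L: "\<Lambda> (em 0 2 w) = ?h w" for w by (cases w) (auto simp: \<Lambda>_def)
    have "\<Lambda> u = \<Lambda> v" if uv: "(u, v) \<in> rel 0 1 ?p \<union> rel 1 2 ?q" for u v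
      using uv
    proof
      assume "(u, v) \<in> rel 0 1 ?p"
      then obtain u' v' where *: "u = em 0 1 u'" "v = em 0 1 v'" "f u' = f v'"
        by (auto simp: rel_def same_kern)
      have "\<Lambda> (em 0 1 w) = f w" for w by (cases w) (auto simp: \<Lambda>_def)
      then show ?thesis using * by metis
    next
      assume "(u, v) \<in> rel 1 2 ?q"
      then obtain u' v' where *: "u = em 1 2 u'" "v = em 1 2 v'" "g u' = g v'"
          "u' \<in> pts l m" "v' \<in> pts l m"
        by (auto simp: rel_def same_kern)
      have "\<Lambda> (em 1 2 w) = g w" if "w \<in> pts l m" for w
        using that mid by (cases w) (auto simp: \<Lambda>_def)
      then show ?thesis using * by metis
    qed
    note R = this
    have "\<Lambda> u = \<Lambda> v" if "(u, v) \<in> conn 0 1 2 ?q ?p" for u v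
      using that unfolding conn_def
    proof (induction rule: rtrancl_induct)
      case (step v w)
      then show ?case using R[of v w] by simp
    qed simp
    then show "(em 0 2 x, em 0 2 y) \<in> conn 0 1 2 ?q ?p \<Longrightarrow> ?h x = ?h y"
      unfolding L[symmetric] by blast
  next
    assume h: "?h x = ?h y"
    have J: "(u, v) \<in> conn 0 1 2 ?q ?p" if "(u, v) \<in> rel 0 1 ?p \<union> rel 1 2 ?q" for u v
      using that unfolding conn_def by blast
    have Jp: "(em 0 1 u, em 0 1 v) \<in> conn 0 1 2 ?q ?p" if "same ?p u v" for u v
      using that J unfolding rel_def by blast
    have Jq: "(em 1 2 u, em 1 2 v) \<in> conn 0 1 2 ?q ?p" if "same ?q u v" for u v
      using that J unfolding rel_def by blast
    have UL: "((0, i), (2, j)) \<in> conn 0 1 2 ?q ?p"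
      if ij: "1 \<le> i" "i \<le> k" "1 \<le> j" "j \<le> m" "f (Up i) = g (Lo j)" for i j
    proof -
      obtain j' where j': "1 \<le> j'" "j' \<le> l" "f (Lo j') = f (Up i)" using ex[OF ij] by blast
      then have "same ?p (Up i) (Lo j')" "same ?q (Up j') (Lo j)"
        using ij mid[of j'] by (auto simp: same_kern)
      then show ?thesis using Jp Jq trans_conn by (metis em_simps transD)
    qed
    show "(em 0 2 x, em 0 2 y) \<in> conn 0 1 2 ?q ?p"
    proof (cases x; cases y)
      fix i i' assume "x = Up i" "y = Up i'"
      then show ?thesis using Jp[of "Up i" "Up i'"] h xy by (simp add: same_kern)
    next
      fix i i' assume "x = Lo i" "y = Lo i'"
      then show ?thesis using Jq[of "Lo i" "Lo i'"] h xy by (simp add: same_kern)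
    next
      fix i j assume "x = Up i" "y = Lo j"
      then show ?thesis using UL[of i j] h xy by simp
    next
      fix i j assume "y = Up i" "x = Lo j"
      then show ?thesis using symD[OF sym_conn UL[of i j]] h xy by simp
    qed
  qed
  show ?thesis
    unfolding stack_conv_quot[of 0 1 2 ?q ?p, simplified] kern_def[of k m]
      ends_partitions[OF kern_partitions kern_partitions]
    unfolding quot_def using c by (intro image_cong refl Collect_cong) auto
qed

text \<open>A weakly monotone map sends a crossing to a weakly ordered quadruple. Coinciding
  neighbours would relate points of different classes, so the order is strict and \<open>p\<close>
  would have a crossing.\<close>

lemma noncrossing_pullback:
  assumes p: "p \<in> partitions k l" "noncrossing k l p"
    and \<phi>: "\<And>x. x \<in> pts k' l' \<Longrightarrow> \<phi> x \<in> pts k l"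
      "\<And>x y. x \<in> pts k' l' \<Longrightarrow> y \<in> pts k' l' \<Longrightarrow> position k' l' x < position k' l' y \<Longrightarrow>
        position k l (\<phi> x) \<le> position k l (\<phi> y)"
    and f: "\<And>x y. x \<in> pts k' l' \<Longrightarrow> y \<in> pts k' l' \<Longrightarrow> f x = f y \<longleftrightarrow> same p (\<phi> x) (\<phi> y)"
  shows "noncrossing k' l' (kern k' l' f)"
  unfolding noncrossing_iff[OF kern_partitions]
proof (intro allI impI)
  fix a b c d
  let ?p = "position k l" and ?p' = "position k' l'"
  assume "same (kern k' l' f) a c" "same (kern k' l' f) b d" and ord: "?p' a < ?p' b" "?p' b < ?p' c" "?p' c < ?p' d"
  then have P: "a \<in> pts k' l'" "b \<in> pts k' l'" "c \<in> pts k' l'" "d \<in> pts k' l'" and fe: "f a = f c" "f b = f d"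
    by (auto simp: same_kern)
  have s: "same p (\<phi> a) (\<phi> c)" "same p (\<phi> b) (\<phi> d)" using fe f P by auto
  have le: "?p (\<phi> a) \<le> ?p (\<phi> b)" "?p (\<phi> b) \<le> ?p (\<phi> c)" "?p (\<phi> c) \<le> ?p (\<phi> d)" using \<phi>(2) P ord by auto
  have inj: "x = y" if "x \<in> pts k l" "y \<in> pts k l" "?p x = ?p y" for x y
    using pt_position that by metis
  have "f a = f b"
  proof (rule ccontr)
    assume "f a \<noteq> f b"
    then have "\<not> same p (\<phi> a) (\<phi> b)" "\<not> same p (\<phi> b) (\<phi> c)" "\<not> same p (\<phi> c) (\<phi> d)"
      using f[OF P(1,2)] f[OF P(2,3)] f[OF P(3,4)] fe by auto
    moreover have "same p x x" if "x \<in> pts k l" for x using that p Union_partitions by (auto simp: same_refl)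
    ultimately have "?p (\<phi> a) \<noteq> ?p (\<phi> b)" "?p (\<phi> b) \<noteq> ?p (\<phi> c)" "?p (\<phi> c) \<noteq> ?p (\<phi> d)"
      using inj \<phi>(1) P by metis+
    then have "same p (\<phi> a) (\<phi> b)" using p(2)[unfolded noncrossing_iff[OF p(1)]] s le by (meson order_le_neq_trans)
    then show False using \<open>\<not> same p (\<phi> a) (\<phi> b)\<close> by blast
  qed
  then show "same (kern k' l' f) a b" using P by (simp add: same_kern)
qed

text \<open>The blocks of the kernel are the nonempty preimages of the blocks of \<open>p\<close>;
  \<open>ev\<close> states that these preimages have even size.\<close>

lemma NC_even_pullback:
  assumes p: "p \<in> NC_even k l"
    and \<phi>: "\<And>x. x \<in> pts k' l' \<Longrightarrow> \<phi> x \<in> pts k l"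
      "\<And>x y. x \<in> pts k' l' \<Longrightarrow> y \<in> pts k' l' \<Longrightarrow> position k' l' x < position k' l' y \<Longrightarrow>
        position k l (\<phi> x) \<le> position k l (\<phi> y)"
    and f: "\<And>x y. x \<in> pts k' l' \<Longrightarrow> y \<in> pts k' l' \<Longrightarrow> f x = f y \<longleftrightarrow> same p (\<phi> x) (\<phi> y)"
    and ev: "\<And>B. B \<in> p \<Longrightarrow>
      even (card {i. Up i \<in> pts k' l' \<and> \<phi> (Up i) \<in> B} + card {j. Lo j \<in> pts k' l' \<and> \<phi> (Lo j) \<in> B})"
  shows "kern k' l' f \<in> NC_even k' l'"
  unfolding NC_even_def
proof (intro CollectI conjI ballI)
  have P: "p \<in> partitions k l" "noncrossing k l p" using p by (auto simp: NC_even_def)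
  then have Q: "partition_on (pts k l) p" by (simp add: partitions_iff)
  show "kern k' l' f \<in> partitions k' l'" by (rule kern_partitions)
  show "noncrossing k' l' (kern k' l' f)" by (rule noncrossing_pullback[OF P \<phi> f])
  fix C assume "C \<in> kern k' l' f"
  then obtain x where x: "x \<in> pts k' l'" "C = {y \<in> pts k' l'. f x = f y}" by (auto simp: kern_def quot_def)
  obtain B where B: "B \<in> p" "\<phi> x \<in> B" using \<phi>(1)[OF x(1)] Union_partitions[OF P(1)] by blast
  have "C = {y \<in> pts k' l'. \<phi> y \<in> B}"
    unfolding x(2) using f[OF x(1)] same_block[OF Q B] by auto
  then show "even (card C)" using card_points[of C] ev[OF B(1)] by simp
qed

section \<open>The partitions \<open>h\<^sub>a\<close>\<close>

text \<open>Index, counted from \<open>0\<close>, of the tensor factor of \<open>h_part a\<close>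
  containing point \<open>i\<close>; beyond \<open>h_size a\<close> the value is
  \<open>length a\<close>.\<close>

fun grp :: "nat list \<Rightarrow> nat \<Rightarrow> nat" where
  "grp [] i = 0"
| "grp (x # a) i = (if i \<le> 1 + x then 0 else Suc (grp a (i - (1 + x))))"

definition lab :: "nat list \<Rightarrow> point \<Rightarrow> nat" where
  "lab a x = (case x of Up i \<Rightarrow> grp a i | Lo i \<Rightarrow> grp a i)"

lemma lab_simps [simp]: "lab a (Up i) = grp a i" "lab a (Lo i) = grp a i"
  by (simp_all add: lab_def)

lemma h_size_simps [simp]: "h_size [] = 0" "h_size (x # a) = 1 + x + h_size a"
  by (simp_all add: h_size_def)

lemma grp_mono: "i \<le> j \<Longrightarrow> grp a i \<le> grp a j"
  by (induction a arbitrary: i j) auto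

lemma grp_less: "1 \<le> i \<Longrightarrow> i \<le> h_size a \<Longrightarrow> grp a i < length a"
  by (induction a arbitrary: i) auto

lemma card_grp: "j < length a \<Longrightarrow> card {i. 1 \<le> i \<and> i \<le> h_size a \<and> grp a i = j} = 1 + a ! j"
proof (induction a arbitrary: j)
  case (Cons x a)
  show ?case
  proof (cases j)
    case 0
    have "{i. 1 \<le> i \<and> i \<le> h_size (x # a) \<and> grp (x # a) i = j} = {1..1 + x}" using 0 by auto
    then show ?thesis using 0 by simp
  next
    case (Suc j')
    have "{i. 1 \<le> i \<and> i \<le> h_size (x # a) \<and> grp (x # a) i = j} =
        (\<lambda>i. i + (1 + x)) ` {i. 1 \<le> i \<and> i \<le> h_size a \<and> grp a i = j'}" (is "?A = ?f ` ?B")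
    proof (intro equalityI subsetI)
      fix i assume "i \<in> ?A"
      then have "i - (1 + x) \<in> ?B" "i = ?f (i - (1 + x))" using Suc by (auto split: if_splits)
      then show "i \<in> ?f ` ?B" by blast
    qed (use Suc in auto)
    then have "card ?A = card ?B" by (simp add: card_image inj_on_def)
    then show ?thesis using Cons Suc by simp
  qed
qed simp

lemma ex_grp: "j < length a \<Longrightarrow> \<exists>i. 1 \<le> i \<and> i \<le> h_size a \<and> grp a i = j"
proof (rule ccontr)
  assume "j < length a" "\<not> (\<exists>i. 1 \<le> i \<and> i \<le> h_size a \<and> grp a i = j)"
  then have "{i. 1 \<le> i \<and> i \<le> h_size a \<and> grp a i = j} = {}" by auto
  then have "card ({} :: nat set) = 1 + a ! j" using card_grp[OF \<open>j < length a\<close>] by (simp only:)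
  then show False by simp
qed

lemma pts_shift: "pts (k + k') (l + l') = pts k l \<union> shift k l ` pts k' l'"
proof (intro equalityI subsetI)
  fix x assume x: "x \<in> pts (k + k') (l + l')"
  show "x \<in> pts k l \<union> shift k l ` pts k' l'"
  proof (cases x)
    case (Up i)
    then have "i \<le> k \<or> x = shift k l (Up (i - k))" by auto
    then show ?thesis using x Up by (cases "i \<le> k") (auto intro!: rev_image_eqI[of "Up (i - k)"])
  next
    case (Lo i)
    then have "i \<le> l \<or> x = shift k l (Lo (i - l))" by auto
    then show ?thesis using x Lo by (cases "i \<le> l") (auto intro!: rev_image_eqI[of "Lo (i - l)"])
  qed
next
  fix x assume "x \<in> pts k l \<union> shift k l ` pts k' l'"
  then show "x \<in> pts (k + k') (l + l')" by (cases x) (auto simp: pts_def)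
qed

text \<open>Two points share a block exactly if they lie in the same tensor factor. Digits above
  \<open>1\<close> must be excluded: \<open>h_gen\<close> covers two columns for every nonzero
  digit, while \<open>tensor\<close> shifts by \<open>1 + x\<close>, which would leave gaps.\<close>

lemma h_part_conv_kern: "set a \<subseteq> {0, 1} \<Longrightarrow> h_part a = kern (h_size a) (h_size a) (lab a)"
proof (induction a)
  case Nil
  then show ?case by (simp add: kern_def quot_def pts_def)
next
  case (Cons x a)
  let ?s = "shift (1 + x) (1 + x)" and ?K = "h_size a" and ?L = "h_size (x # a)"
  have img: "kern k k f = (\<lambda>c. {y \<in> pts k k. f y = c}) ` f ` pts k k" for k and f :: "point \<Rightarrow> nat"
    unfolding kern_def quot_def image_image by (intro image_cong) auto
  have P: "pts ?L ?L = pts (1 + x) (1 + x) \<union> ?s ` pts ?K ?K"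
    using pts_shift[of "1 + x" ?K "1 + x" ?K] by simp
  have l0: "lab (x # a) y = 0" if "y \<in> pts (1 + x) (1 + x)" for y using that by (cases y) auto
  have l1: "lab (x # a) (?s y) = Suc (lab a y)" if "y \<in> pts ?K ?K" for y using that by (cases y) auto
  have gen: "h_gen x = {pts (1 + x) (1 + x)}"
    using Cons.prems by (auto simp: h_gen_def pts_def atLeastAtMost_insertL[symmetric] numeral_2_eq_2)
  have L: "lab (x # a) ` pts ?L ?L = insert 0 (Suc ` lab a ` pts ?K ?K)"
  proof -
    have "lab (x # a) ` pts (1 + x) (1 + x) = (\<lambda>_. 0) ` pts (1 + x) (1 + x)"
      by (intro image_cong refl l0)
    also have "\<dots> = {0}" by (rule image_constant[of "Up 1"]) simp
    finally have "lab (x # a) ` pts (1 + x) (1 + x) = {0}" .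
    moreover have "lab (x # a) ` ?s ` pts ?K ?K = Suc ` lab a ` pts ?K ?K"
      unfolding image_image by (intro image_cong refl l1)
    ultimately show ?thesis unfolding P image_Un by simp
  qed
  have c0: "{y \<in> pts ?L ?L. lab (x # a) y = 0} = pts (1 + x) (1 + x)"
    unfolding P using l0 l1 by auto
  have c1: "{y \<in> pts ?L ?L. lab (x # a) y = Suc c} = ?s ` {y \<in> pts ?K ?K. lab a y = c}" for c
    unfolding P using l0 l1 by auto
  have "h_part (x # a) = h_gen x \<union> (`) ?s ` kern ?K ?K (lab a)"
    using Cons by (simp add: tensor_def)
  also have "\<dots> = kern ?L ?L (lab (x # a))"
    unfolding img L image_insert c0 image_image c1 gen by simp
  finally show ?case .
qed

lemma same_h_part:
  "set a \<subseteq> {0, 1} \<Longrightarrow> same (h_part a) x y \<longleftrightarrow>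
    x \<in> pts (h_size a) (h_size a) \<and> y \<in> pts (h_size a) (h_size a) \<and> lab a x = lab a y"
  by (simp add: h_part_conv_kern same_kern)

text \<open>In the order of positions the labels first increase weakly and then decrease weakly. In
  such a sequence a value between two others is at least the smaller of them; applied twice to a
  crossing this makes all four labels equal. Evenness holds since each block has as many upper as
  lower points.\<close>

lemma h_part_NC_even:
  assumes a: "set a \<subseteq> {0, 1}"
  shows "h_part a \<in> NC_even (h_size a) (h_size a)"
  unfolding NC_even_def
proof (intro CollectI conjI ballI)
  let ?K = "h_size a"
  show P: "h_part a \<in> partitions ?K ?K" using a by (simp add: h_part_conv_kern kern_partitions)
  show "noncrossing ?K ?K (h_part a)"
    unfolding noncrossing_iff[OF P]
  proof (intro allI impI)
    fix u v w z
    assume *: "same (h_part a) u w" "same (h_part a) v z" "position ?K ?K u < position ?K ?K v"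
      "position ?K ?K v < position ?K ?K w" "position ?K ?K w < position ?K ?K z"
    show "same (h_part a) u v"
    proof (cases v)
      case (Up i)
      then obtain i' where i': "u = Up i'" "i' \<le> i" using * a by (cases u) (auto simp: same_h_part)
      show ?thesis
      proof (cases w)
        case (Up i'')
        then have "i \<le> i''" using * \<open>v = Up i\<close> by simp
        then show ?thesis
          using * a i' Up \<open>v = Up i\<close> grp_mono[of i' i a] grp_mono[of i i'' a] by (auto simp: same_h_part)
      next
        case (Lo j)
        then obtain j' where j': "z = Lo j'" "j' \<le> j" using * a by (cases z) (auto simp: same_h_part)
        then show ?thesis
          using * a i' Lo Up grp_mono[of i' i a] grp_mono[of j' j a] by (auto simp: same_h_part)
      qed
    next
      case (Lo j)
      then obtain j1 where j1: "w = Lo j1" "j1 \<le> j" using * a by (cases w) (auto simp: same_h_part)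
      then obtain j2 where j2: "z = Lo j2" "j2 \<le> j1" using * a by (cases z) (auto simp: same_h_part)
      then show ?thesis
        using * a j1 Lo grp_mono[of j1 j a] grp_mono[of j2 j1 a] by (auto simp: same_h_part)
    qed
  qed
  fix B assume "B \<in> h_part a"
  then obtain x where x: "B = {y \<in> pts ?K ?K. lab a x = lab a y}"
    using a by (auto simp: h_part_conv_kern kern_def quot_def)
  then have "{i. Up i \<in> B} = {j. Lo j \<in> B}" "finite B" by auto
  then show "even (card B)" using card_points[of B] by simp
qed

lemma h_part_partitions: "set a \<subseteq> {0, 1} \<Longrightarrow> h_part a \<in> partitions (h_size a) (h_size a)"
  using h_part_NC_even by (simp add: NC_even_def)

lemma through_h_part:
  assumes a: "set a \<subseteq> {0, 1}"
  shows "through (h_part a) = length a"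
proof -
  let ?K = "h_size a" and ?c = "\<lambda>c. {y \<in> pts (h_size a) (h_size a). lab a y = c}"
  have "lab a ` pts ?K ?K = {..<length a}"
  proof (intro equalityI subsetI)
    fix c assume "c \<in> {..<length a}"
    then obtain i where "1 \<le> i" "i \<le> ?K" "grp a i = c" using ex_grp by auto
    then show "c \<in> lab a ` pts ?K ?K" by (intro rev_image_eqI[of "Up i"]) auto
  next
    fix c assume "c \<in> lab a ` pts ?K ?K"
    then obtain x where "x \<in> pts ?K ?K" "c = lab a x" by blast
    then show "c \<in> {..<length a}" using grp_less by (cases x) auto
  qed
  moreover have "h_part a = ?c ` lab a ` pts ?K ?K"
    using a unfolding h_part_conv_kern[OF a] kern_def quot_def image_image by (intro image_cong) auto
  ultimately have h: "h_part a = ?c ` {..<length a}" by simp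
  have ne: "\<exists>i. Up i \<in> ?c c \<and> Lo i \<in> ?c c" if "c < length a" for c
    using ex_grp[OF that] by auto
  then have "through_blocks (h_part a) = h_part a"
    unfolding through_blocks_def h by blast
  moreover have "inj_on ?c {..<length a}"
    using ne by (intro inj_onI) (metis (mono_tags, lifting) lessThan_iff mem_Collect_eq)
  ultimately show ?thesis by (simp add: through_conv h card_image)
qed

lemma stack_h_part_h_part:
  assumes "set a \<subseteq> {0, 1}" shows "stack (h_part a) (h_part a) = h_part a"
  unfolding h_part_conv_kern[OF assms]
  by (subst stack_kern) (auto intro!: kern_cong simp: lab_def split: point.splits)

text \<open>Every middle point is joined to the top point with the same index, so no component stays
  in the middle. The unit of the corner is therefore \<open>h_part a\<close> with coefficient
  \<open>1\<close>.\<close>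

lemma loops_h_part:
  assumes "set a \<subseteq> {0, 1}" shows "loops (h_part a) (h_part a) = 0"
proof -
  let ?h = "h_part a" and ?P = "pts (h_size a) (h_size a)"
  have U: "\<Union>?h = ?P" using h_part_partitions[OF assms] by (rule Union_partitions)
  have False if d: "d \<in> (em 0 1 ` ?P \<union> em 1 2 ` ?P) // conn 0 1 2 ?h ?h" "d \<subseteq> {1} \<times> UNIV" for d
  proof -
    obtain x where x: "x \<in> em 0 1 ` ?P \<union> em 1 2 ` ?P" "d = conn 0 1 2 ?h ?h `` {x}"
      using d(1) unfolding quotient_def by blast
    then have "x \<in> d" by (simp add: conn_def)
    then have "fst x = 1" using d(2) by auto
    then obtain i where i: "x = (1, i)" "1 \<le> i" "i \<le> h_size a"
      using x(1) by (cases x) (auto simp: pts_def)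
    then have "same ?h (Lo i) (Up i)" using assms by (simp add: same_h_part)
    then have "(em 0 1 (Lo i), em 0 1 (Up i)) \<in> rel 0 1 ?h" unfolding rel_def by blast
    then have "(x, (0, i)) \<in> conn 0 1 2 ?h ?h" using i unfolding conn_def by auto
    then show False using x d by auto
  qed
  then have "{d \<in> (em 0 1 ` \<Union>?h \<union> em 1 2 ` \<Union>?h) // conn 0 1 2 ?h ?h. d \<subseteq> {1} \<times> UNIV} = {}"
    unfolding U by blast
  then show ?thesis by (simp only: loops_conv_card[of 0 1 2, simplified] card.empty flip: One_nat_def)
qed

section \<open>Rigidity of the \<open>h_part a\<close> and factorisation through them\<close>

text \<open>By \<open>up\<close> and \<open>lo\<close> each through-block of \<open>q\<close>
  swallows whole tensor factors above and below. The count in \<open>len\<close> leaves exactly one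
  of each per through-block, noncrossingness matches them in order, and evenness of the block forces
  matching digits to have equal parity, hence to be equal.\<close>

lemma NC_even_rigid:
  assumes ab: "set a \<subseteq> {0, 1}" "set b \<subseteq> {0, 1}"
    and q: "q \<in> NC_even (h_size a) (h_size b)"
    and up: "\<And>x y. x \<in> range Up \<Longrightarrow> y \<in> range Up \<Longrightarrow> same (h_part a) x y \<Longrightarrow> same q x y"
    and lo: "\<And>x y. x \<in> range Lo \<Longrightarrow> y \<in> range Lo \<Longrightarrow> same (h_part b) x y \<Longrightarrow> same q x y"
    and len: "length a \<le> through q" "length b \<le> through q"
  shows "a = b \<and> q = h_part a"
proof -
  let ?T = "through_blocks q" and ?P = "pts (h_size a) (h_size b)"
  have qp: "q \<in> partitions (h_size a) (h_size b)" and nc: "noncrossing (h_size a) (h_size b) q"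
    and ev: "\<And>B. B \<in> q \<Longrightarrow> even (card B)"
    using q by (auto simp: NC_even_def)
  then have Q: "partition_on ?P q" by (simp add: partitions_iff)
  have Tq: "B \<in> ?T \<Longrightarrow> B \<in> q" for B by (simp add: through_blocks_def)
  have sub: "B \<in> q \<Longrightarrow> x \<in> B \<Longrightarrow> x \<in> ?P" for B x using qp by (auto simp: Union_partitions[symmetric])
  have "\<forall>B \<in> ?T. \<exists>i. Up i \<in> B" "\<forall>B \<in> ?T. \<exists>j. Lo j \<in> B" by (auto simp: through_blocks_def)
  then obtain iu jl where iu: "\<And>B. B \<in> ?T \<Longrightarrow> Up (iu B) \<in> B" and jl: "\<And>B. B \<in> ?T \<Longrightarrow> Lo (jl B) \<in> B"
    by metis
  define gu where "gu B = grp a (iu B)" for B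
  define gl where "gl B = grp b (jl B)" for B
  have up': "Up i' \<in> B" if "B \<in> q" "Up i \<in> B" "grp a i = grp a i'" "1 \<le> i'" "i' \<le> h_size a" for B i i'
  proof -
    have "same q (Up i) (Up i')" using sub[OF that(1,2)] that ab up[of "Up i" "Up i'"] by (simp add: same_h_part)
    then show ?thesis using same_block[OF Q that(1,2)] by simp
  qed
  have lo': "Lo i' \<in> B" if "B \<in> q" "Lo i \<in> B" "grp b i = grp b i'" "1 \<le> i'" "i' \<le> h_size b" for B i i'
  proof -
    have "same q (Lo i) (Lo i')" using sub[OF that(1,2)] that ab lo[of "Lo i" "Lo i'"] by (simp add: same_h_part)
    then show ?thesis using same_block[OF Q that(1,2)] by simp
  qed
  have iu_bd: "1 \<le> iu B \<and> iu B \<le> h_size a" and jl_bd: "1 \<le> jl B \<and> jl B \<le> h_size b" if "B \<in> ?T" for B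
    using sub[OF Tq[OF that] iu[OF that]] sub[OF Tq[OF that] jl[OF that]] by auto
  \<comment> \<open>Different through-blocks meet different upper factors, and \<open>len\<close>
    says that there are at least as many through-blocks as factors; so \<open>gu\<close> is a
    bijection. The same holds below for \<open>gl\<close>.\<close>
  have "inj_on gu ?T" using up' iu iu_bd block_eq[OF Q] Tq unfolding gu_def inj_on_def by metis
  moreover have "gu ` ?T \<subseteq> {..<length a}" using iu_bd grp_less by (auto simp: gu_def)
  ultimately have guT: "inj_on gu ?T" "gu ` ?T = {..<length a}" "card ?T = length a"
    using len(1) card_mono[of "{..<length a}" "gu ` ?T"] card_subset_eq[of "{..<length a}" "gu ` ?T"]
    by (simp_all add: card_image through_conv)
  have "inj_on gl ?T" using lo' jl jl_bd block_eq[OF Q] Tq unfolding gl_def inj_on_def by metis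
  moreover have "gl ` ?T \<subseteq> {..<length b}" using jl_bd grp_less by (auto simp: gl_def)
  ultimately have glT: "inj_on gl ?T" "gl ` ?T = {..<length b}" "card ?T = length b"
    using len(2) card_mono[of "{..<length b}" "gl ` ?T"] card_subset_eq[of "{..<length b}" "gl ` ?T"]
    by (simp_all add: card_image through_conv)
  \<comment> \<open>Lower points are numbered against the order of positions, so two through-blocks
    whose lower ends were swapped would cross.\<close>
  have ord: "gl B < gl C" if BC: "B \<in> ?T" "C \<in> ?T" "gu B < gu C" for B C
  proof (rule ccontr)
    assume "\<not> gl B < gl C"
    moreover have "B \<noteq> C" using BC by auto
    ultimately have "gl C < gl B" using glT(1) BC by (metis inj_onD linorder_neqE_nat)
    then have "jl C < jl B" "iu B < iu C"
      using BC(3) grp_mono unfolding gl_def gu_def by (meson leD leI)+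
    moreover have "same q (Up (iu B)) (Lo (jl B))" "same q (Up (iu C)) (Lo (jl C))"
      using BC iu jl Tq unfolding same_def by blast+
    ultimately have "same q (Up (iu B)) (Up (iu C))"
      using nc[unfolded noncrossing_iff[OF qp], rule_format, of "Up (iu B)" "Lo (jl B)" "Up (iu C)" "Lo (jl C)"]
        iu_bd[OF BC(2)] jl_bd[OF BC(1)] by simp
    then show False using same_block[OF Q Tq[OF BC(1)] iu[OF BC(1)]] iu[OF BC(2)] block_eq[OF Q] Tq BC \<open>B \<noteq> C\<close> by metis
  qed
  \<comment> \<open>A bijection onto an initial segment is recovered from the order it induces, as
    the number of elements with smaller value; order agreement thus gives \<open>gu = gl\<close> on
    \<open>?T\<close>.\<close>
  have count: "card {C \<in> ?T. g C < g B} = g B"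
    if "inj_on g ?T" "g ` ?T = {..<n}" "B \<in> ?T" for g :: "point set \<Rightarrow> nat" and n B
  proof -
    have "g B < n" using that by auto
    then have "g ` {C \<in> ?T. g C < g B} = {..<g B}" using that(2) by (auto simp: set_eq_iff image_iff) (metis order.strict_trans)
    moreover have "inj_on g {C \<in> ?T. g C < g B}" using that(1) by (rule inj_on_subset) auto
    ultimately show ?thesis by (metis card_image card_lessThan)
  qed
  have gg: "gu B = gl B" if B: "B \<in> ?T" for B
  proof -
    have "{C \<in> ?T. gu C < gu B} = {C \<in> ?T. gl C < gl B}"
      using ord B guT(1) by (metis (no_types, lifting) inj_onD linorder_neqE_nat order_less_asym)
    then show ?thesis using count[OF guT(1,2) B] count[OF glT(1,2) B] by simp
  qed
  have len_eq: "length a = length b" using guT glT by simp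
  have memU: "Up i \<in> B \<longleftrightarrow> 1 \<le> i \<and> i \<le> h_size a \<and> grp a i = gu B" if B: "B \<in> ?T" for B i
  proof
    assume i: "Up i \<in> B"
    then have i2: "1 \<le> i" "i \<le> h_size a" using sub[OF Tq[OF B] i] by auto
    then obtain C where C: "C \<in> ?T" "gu C = grp a i"
      using guT(2) grp_less[OF i2] by (metis (no_types, lifting) imageE lessThan_iff)
    then have "Up i \<in> C" using up'[OF Tq[OF C(1)] iu[OF C(1)]] i2 by (simp add: gu_def)
    then have "C = B" using i block_eq[OF Q] C B Tq by metis
    then show "1 \<le> i \<and> i \<le> h_size a \<and> grp a i = gu B" using i2 C by simp
  next
    assume "1 \<le> i \<and> i \<le> h_size a \<and> grp a i = gu B"
    then show "Up i \<in> B" using up'[OF Tq[OF B] iu[OF B]] by (simp add: gu_def)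
  qed
  have memL: "Lo i \<in> B \<longleftrightarrow> 1 \<le> i \<and> i \<le> h_size b \<and> grp b i = gu B" if B: "B \<in> ?T" for B i
  proof
    assume i: "Lo i \<in> B"
    then have i2: "1 \<le> i" "i \<le> h_size b" using sub[OF Tq[OF B] i] by auto
    then obtain C where C: "C \<in> ?T" "gl C = grp b i"
      using glT(2) grp_less[OF i2] by (metis (no_types, lifting) imageE lessThan_iff)
    then have "Lo i \<in> C" using lo'[OF Tq[OF C(1)] jl[OF C(1)]] i2 by (simp add: gl_def)
    then have "C = B" using i block_eq[OF Q] C B Tq by metis
    then show "1 \<le> i \<and> i \<le> h_size b \<and> grp b i = gu B" using i2 C gg[OF B] by simp
  next
    assume "1 \<le> i \<and> i \<le> h_size b \<and> grp b i = gu B"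
    then show "Lo i \<in> B" using lo'[OF Tq[OF B] jl[OF B]] gg[OF B] by (simp add: gl_def)
  qed
  have "a ! j = b ! j" if j: "j < length a" for j
  proof -
    obtain B where B: "B \<in> ?T" "gu B = j" using guT(2) j by (metis (no_types, lifting) imageE lessThan_iff)
    have "finite B" using sub Tq[OF B(1)] finite_subset[OF _ finite_pts] by blast
    then have "card B = (1 + a ! j) + (1 + b ! j)"
      using card_points[of B] card_grp[OF j] card_grp[of j b] j len_eq
      by (simp add: memU[OF B(1)] memL[OF B(1)] B(2))
    then have "even (a ! j + b ! j)" using ev[OF Tq[OF B(1)]] by simp
    moreover have "a ! j \<in> {0, 1}" "b ! j \<in> {0, 1}" using subsetD[OF ab(1) nth_mem[OF j]] subsetD[OF ab(2) nth_mem[of j b]] j len_eq by auto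
    ultimately show ?thesis by auto
  qed
  then have eq: "a = b" using len_eq by (intro nth_equalityI) auto
  have "q = h_part a"
  proof (rule partition_eqI[OF Q])
    show "partition_on ?P (h_part a)" using h_part_partitions[OF ab(1)] eq by (simp add: partitions_iff)
    fix x y assume xy: "x \<in> ?P" "y \<in> ?P"
    have "\<exists>B \<in> ?T. \<forall>w \<in> ?P. w \<in> B \<longleftrightarrow> lab a w = lab a x" if x: "x \<in> ?P" for x
    proof -
      have "lab a x < length a" using x grp_less eq by (cases x) auto
      then obtain B where B: "B \<in> ?T" "gu B = lab a x" using guT(2) by (metis (no_types, lifting) imageE lessThan_iff)
      have "w \<in> B \<longleftrightarrow> lab a w = lab a x" if "w \<in> ?P" for w
        using that memU[OF B(1)] memL[OF B(1)] B(2) eq by (cases w) auto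
      then show ?thesis using B by blast
    qed
    then obtain B where B: "B \<in> ?T" "\<And>w. w \<in> ?P \<Longrightarrow> w \<in> B \<longleftrightarrow> lab a w = lab a x" using xy by metis
    have "same q x y \<longleftrightarrow> y \<in> B" using same_block[OF Q Tq[OF B(1)]] B(2)[OF xy(1)] by simp
    then show "same q x y \<longleftrightarrow> same (h_part a) x y" using B(2)[OF xy(2)] xy ab eq by (auto simp: same_h_part)
  qed
  then show ?thesis using eq by simp
qed

text \<open>Between the upper and the lower half of each through-block one tensor factor of
  \<open>h_part a\<close> is inserted. A block of even size has upper and lower parts of equal
  parity, so one digit makes both halves even; blocks lying on one side go into \<open>v\<close> or
  \<open>u\<close> unchanged.\<close>

lemma NC_even_factor:
  assumes p: "p \<in> NC_even k l"
  obtains a u v where "set a \<subseteq> {0, 1}" "length a = through p" "v \<in> NC_even k (h_size a)"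
    "u \<in> NC_even (h_size a) l" "stack u (stack (h_part a) v) = p"
proof -
  let ?T = "through_blocks p"
  have pp: "p \<in> partitions k l" and nc: "noncrossing k l p" and ev: "\<And>B. B \<in> p \<Longrightarrow> even (card B)"
    using p by (auto simp: NC_even_def)
  then have Q: "partition_on (pts k l) p" by (simp add: partitions_iff)
  have finT: "finite ?T" using pp by (rule finite_through_blocks)
  have Tq: "B \<in> ?T \<Longrightarrow> B \<in> p" for B by (simp add: through_blocks_def)
  have sub: "B \<in> p \<Longrightarrow> x \<in> B \<Longrightarrow> x \<in> pts k l" for B x using pp by (auto simp: Union_partitions[symmetric])
  have "\<forall>B \<in> ?T. \<exists>i. Up i \<in> B" "\<forall>B \<in> ?T. \<exists>j. Lo j \<in> B" by (auto simp: through_blocks_def)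
  then obtain ku kl where ku: "\<And>B. B \<in> ?T \<Longrightarrow> Up (ku B) \<in> B" and kl: "\<And>B. B \<in> ?T \<Longrightarrow> Lo (kl B) \<in> B"
    by metis
  have bd: "1 \<le> ku B \<and> ku B \<le> k \<and> 1 \<le> kl B \<and> kl B \<le> l" if "B \<in> ?T" for B
    using sub[OF Tq[OF that] ku[OF that]] sub[OF Tq[OF that] kl[OF that]] by auto
  have inj: "inj_on ku ?T" using ku block_eq[OF Q] Tq unfolding inj_on_def by metis
  have kl_less: "kl B < kl C" if BC: "B \<in> ?T" "C \<in> ?T" "ku B < ku C" for B C
  proof (rule ccontr)
    assume "\<not> kl B < kl C"
    have "B \<noteq> C" using BC by auto
    then have "kl C \<noteq> kl B" using kl[OF BC(1)] kl[OF BC(2)] block_eq[OF Q] Tq BC by metis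
    then have "kl C < kl B" using \<open>\<not> kl B < kl C\<close> by simp
    moreover have "same p (Up (ku B)) (Lo (kl B))" "same p (Up (ku C)) (Lo (kl C))"
      using BC ku kl Tq unfolding same_def by blast+
    ultimately have "same p (Up (ku B)) (Up (ku C))"
      using nc[unfolded noncrossing_iff[OF pp], rule_format, of "Up (ku B)" "Lo (kl B)" "Up (ku C)" "Lo (kl C)"]
        bd[OF BC(2)] bd[OF BC(1)] BC(3) by auto
    then show False
      using same_block[OF Q Tq[OF BC(1)] ku[OF BC(1)]] ku[OF BC(2)] block_eq[OF Q] Tq BC \<open>B \<noteq> C\<close> by metis
  qed
  \<comment> \<open>Through-blocks are enumerated from left to right by a chosen upper point
    \<open>ku\<close>; by noncrossingness the chosen lower points \<open>kl\<close> follow the same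
    order.\<close>
  obtain h where h: "bij_betw h {..<card (ku ` ?T)} (ku ` ?T)" "strict_mono_on {..<card (ku ` ?T)} h"
    by (rule ex_bij_betw_strict_mono_card[OF finite_imageI[OF finT, of ku]])
  define n where "n = card ?T"
  have nT: "card (ku ` ?T) = n" using inj by (simp add: card_image n_def)
  define \<beta> where "\<beta> j = inv_into ?T ku (h j)" for j
  have \<beta>T: "\<beta> j \<in> ?T" "ku (\<beta> j) = h j" if "j < n" for j
  proof -
    have "h j \<in> ku ` ?T" using h(1) that nT by (auto simp: bij_betw_def)
    then show "\<beta> j \<in> ?T" "ku (\<beta> j) = h j" unfolding \<beta>_def by (rule inv_into_into, rule f_inv_into_f)
  qed
  have ku_mono: "ku (\<beta> i) < ku (\<beta> j)" if "i < j" "j < n" for i j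
    using h(2) that nT \<beta>T by (auto simp: strict_mono_on_def)
  have \<beta>_inj: "\<beta> i = \<beta> j \<longleftrightarrow> i = j" if "i < n" "j < n" for i j
    using ku_mono[of i j] ku_mono[of j i] that by (metis linorder_neqE_nat order_less_irrefl)
  have \<beta>_surj: "\<exists>j < n. \<beta> j = B" if B: "B \<in> ?T" for B
  proof -
    obtain j where "j < n" "h j = ku B" using h(1) B nT by (auto simp: bij_betw_def) (metis imageE imageI lessThan_iff)
    then show ?thesis using B inj by (auto simp: \<beta>_def)
  qed
  \<comment> \<open>The factor for digit \<open>d\<close> has \<open>1 + d\<close> columns, so an
    odd number of upper points needs digit \<open>0\<close>.\<close>
  define a where "a = map (\<lambda>j. if odd (card {i. Up i \<in> \<beta> j}) then 0 else 1 :: nat) [0..<n]"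
  have a: "set a \<subseteq> {0, 1}" "length a = n" by (auto simp: a_def)
  let ?K = "h_size a"
  have grpn: "grp a j < n" if "1 \<le> j" "j \<le> ?K" for j using grp_less[OF that] a by simp
  have ku_le: "ku (\<beta> i) \<le> ku (\<beta> j)" if "i \<le> j" "j < n" for i j
    using ku_mono[of i j] that by (cases "i = j") auto
  have kl_le: "kl (\<beta> i) \<le> kl (\<beta> j)" if "i \<le> j" "j < n" for i j
    using kl_less[OF \<beta>T(1) \<beta>T(1) ku_mono, of i j] that by (cases "i = j") auto
  define blk where "blk x = {y. same p x y}" for x
  have blk_eq: "blk x = B" if "B \<in> p" "x \<in> B" for B x
    using same_block[OF Q that] by (auto simp: blk_def)
  have blk_in: "blk x \<in> p" "x \<in> blk x" if x: "x \<in> pts k l" for x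
  proof -
    obtain B where "B \<in> p" "x \<in> B" using Q x unfolding partition_on_def by blast
    then show "blk x \<in> p" "x \<in> blk x" using blk_eq by auto
  qed
  have blk_mem: "blk x = B \<longleftrightarrow> x \<in> B" if "x \<in> pts k l" "B \<in> p" for x B
    using blk_in[OF that(1)] blk_eq[OF that(2)] by auto
  have blk_same: "blk x = blk y \<longleftrightarrow> same p x y" if "x \<in> pts k l" "y \<in> pts k l" for x y
  proof -
    have "blk x = blk y \<longleftrightarrow> x \<in> blk y" using blk_mem[OF that(1) blk_in(1)[OF that(2)]] .
    also have "\<dots> \<longleftrightarrow> same p x y" using same_sym[of p x y] same_sym[of p y x] by (auto simp: blk_def)
    finally show ?thesis .
  qed
  \<comment> \<open>Outer points are labelled by their block of \<open>p\<close>, points of the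
    inserted row by the through-block that their factor serves.\<close>
  define fv where "fv x = (case x of Up i \<Rightarrow> blk (Up i) | Lo j \<Rightarrow> \<beta> (grp a j))" for x
  define fu where "fu x = (case x of Up j \<Rightarrow> \<beta> (grp a j) | Lo i \<Rightarrow> blk (Lo i))" for x
  define v where "v = kern k ?K fv"
  define u where "u = kern ?K l fu"
  \<comment> \<open>Relabelling the factors of \<open>h_part a\<close> by through-blocks makes the
    labels on the shared rows literally equal, as \<open>stack_kern\<close> asks.\<close>
  have hk: "h_part a = kern ?K ?K (\<lambda>x. \<beta> (lab a x))"
    unfolding h_part_conv_kern[OF a(1)]
  proof (rule kern_cong)
    fix x y assume "x \<in> pts ?K ?K" "y \<in> pts ?K ?K"
    then have "lab a x < n" "lab a y < n" using grpn by (cases x; cases y; auto)+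
    then show "lab a x = lab a y \<longleftrightarrow> \<beta> (lab a x) = \<beta> (lab a y)" using \<beta>_inj by simp
  qed
  have pk: "p = kern k l blk"
    by (rule partition_eqI[OF Q kern_partitions[unfolded partitions_iff]]) (simp add: same_kern blk_same)
  have "stack (h_part a) v = v"
    unfolding hk v_def
    by (subst stack_kern) (auto simp: fv_def intro!: kern_cong split: point.split)
  moreover have "stack u v = p"
    unfolding u_def v_def
  proof (subst stack_kern)
    fix i j assume ij: "1 \<le> i" "i \<le> k" "1 \<le> j" "j \<le> l" "fv (Up i) = fu (Lo j)"
    then have "blk (Up i) = blk (Lo j)" by (simp add: fv_def fu_def)
    \<comment> \<open>A block with an upper and a lower point is a through-block, so it owns a
      factor in the inserted row, and that factor supplies the connecting middle point.\<close>
    then have "blk (Up i) \<in> ?T"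
      using blk_in[of "Up i"] blk_in[of "Lo j"] ij by (auto simp: through_blocks_def)
    then obtain m where m: "m < n" "\<beta> m = blk (Up i)" using \<beta>_surj by blast
    then obtain j' where "1 \<le> j'" "j' \<le> ?K" "grp a j' = m" using ex_grp[of m a] a by auto
    then show "\<exists>j'. 1 \<le> j' \<and> j' \<le> ?K \<and> fv (Lo j') = fv (Up i)" using m by (auto simp: fv_def)
  next
    show "kern k l (\<lambda>x. case x of Up i \<Rightarrow> fv (Up i) | Lo j \<Rightarrow> fu (Lo j)) = p"
      unfolding pk by (rule kern_cong) (auto simp: fv_def fu_def split: point.split)
  qed (simp add: fv_def fu_def)
  ultimately have fact: "stack u (stack (h_part a) v) = p" by simp
  have card_\<beta>: "card {i. Up i \<in> \<beta> j} + card {i. Lo i \<in> \<beta> j} = card (\<beta> j)" if "j < n" for j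
    using card_points[of "\<beta> j"] sub[OF Tq[OF \<beta>T(1)[OF that]]] finite_subset[OF _ finite_pts, of "\<beta> j" k l]
    by (simp add: subsetI)
  have par: "even (card {i. Up i \<in> \<beta> j} + (1 + a ! j))" "even ((1 + a ! j) + card {i. Lo i \<in> \<beta> j})"
    if j: "j < n" for j
  proof -
    show u: "even (card {i. Up i \<in> \<beta> j} + (1 + a ! j))" using j by (simp add: a_def)
    have "even (card {i. Up i \<in> \<beta> j} + card {i. Lo i \<in> \<beta> j})"
      using card_\<beta>[OF j] ev[OF Tq[OF \<beta>T(1)[OF j]]] by simp
    then show "even ((1 + a ! j) + card {i. Lo i \<in> \<beta> j})" using u by presburger
  qed
  have grpK: "card {i. 1 \<le> i \<and> i \<le> ?K \<and> \<beta> (grp a i) = \<beta> j} = 1 + a ! j" if j: "j < n" for j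
  proof -
    have "{i. 1 \<le> i \<and> i \<le> ?K \<and> \<beta> (grp a i) = \<beta> j} = {i. 1 \<le> i \<and> i \<le> ?K \<and> grp a i = j}"
      using grpn \<beta>_inj[OF _ j] by auto
    then show ?thesis using card_grp[of j a] j a by simp
  qed
  have \<beta>B: "card {i. 1 \<le> i \<and> i \<le> ?K \<and> \<beta> (grp a i) = B} = 0" if "B \<notin> ?T" for B
  proof -
    have "{i. 1 \<le> i \<and> i \<le> ?K \<and> \<beta> (grp a i) = B} = {}" using \<beta>T(1)[OF grpn] that by blast
    then show ?thesis by (simp only: card.empty)
  qed
  have fin: "finite B" if "B \<in> p" for B using sub[OF that] finite_subset[OF _ finite_pts] by blast
  \<comment> \<open>Such a block lies entirely above or entirely below, so one count is zero and the
    other is the even size of the block.\<close>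
  have nth: "even (card {i. Up i \<in> B})" "even (card {j. Lo j \<in> B})" if B: "B \<in> p" "B \<notin> ?T" for B
  proof -
    have "{i. Up i \<in> B} = {} \<or> {j. Lo j \<in> B} = {}" using B by (auto simp: through_blocks_def)
    then show "even (card {i. Up i \<in> B})" "even (card {j. Lo j \<in> B})"
      using card_points[OF fin[OF B(1)]] ev[OF B(1)] by auto
  qed
  have "v \<in> NC_even k ?K"
    unfolding v_def
  proof (rule NC_even_pullback[OF p])
    \<comment> \<open>\<open>v\<close> is the pullback of \<open>p\<close> along the map that sends
      a whole factor to the chosen lower point of its through-block; this is only weakly monotone.
      For \<open>u\<close> the chosen upper points serve in the same way.\<close>
    let ?\<phi> = "\<lambda>x. case x of Up i \<Rightarrow> Up i | Lo j \<Rightarrow> Lo (kl (\<beta> (grp a j)))"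
    show \<phi>in: "?\<phi> x \<in> pts k l" if "x \<in> pts k ?K" for x
      using that bd[OF \<beta>T(1)[OF grpn]] by (auto split: point.split)
    have klB: "Lo (kl (\<beta> (grp a j))) \<in> B \<longleftrightarrow> \<beta> (grp a j) = B" if "1 \<le> j" "j \<le> ?K" "B \<in> p" for j B
      using kl[OF \<beta>T(1)[OF grpn[OF that(1,2)]]] Tq[OF \<beta>T(1)[OF grpn[OF that(1,2)]]] block_eq[OF Q] that(3) by metis
    show "even (card {i. Up i \<in> pts k ?K \<and> ?\<phi> (Up i) \<in> B} + card {j. Lo j \<in> pts k ?K \<and> ?\<phi> (Lo j) \<in> B})"
      if B: "B \<in> p" for B
    proof -
      have s1: "{i. Up i \<in> pts k ?K \<and> ?\<phi> (Up i) \<in> B} = {i. Up i \<in> B}" by (auto dest: sub[OF B])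
      have s2: "{j. Lo j \<in> pts k ?K \<and> ?\<phi> (Lo j) \<in> B} = {j. 1 \<le> j \<and> j \<le> ?K \<and> \<beta> (grp a j) = B}"
        using klB[OF _ _ B] by auto
      show ?thesis
      proof (cases "B \<in> ?T")
        case True
        then obtain j where "j < n" "\<beta> j = B" using \<beta>_surj by blast
        then have "card {j. 1 \<le> j \<and> j \<le> ?K \<and> \<beta> (grp a j) = B} = 1 + a ! j" "\<beta> j = B" "j < n"
          using grpK by auto
        then show ?thesis using par(1)[of j] unfolding s1 s2 by simp
      next
        case False
        then show ?thesis unfolding s1 s2 \<beta>B[OF False] using nth(1)[OF B] by simp
      qed
    qed
    fix x y assume xy: "x \<in> pts k ?K" "y \<in> pts k ?K"
    have "fv w = blk (?\<phi> w)" if "w \<in> pts k ?K" for w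
      using that blk_eq[OF Tq[OF \<beta>T(1)] kl[OF \<beta>T(1)]] grpn by (auto simp: fv_def split: point.split)
    then show "fv x = fv y \<longleftrightarrow> same p (?\<phi> x) (?\<phi> y)"
      using xy blk_same[OF \<phi>in \<phi>in] by simp
    assume "position k ?K x < position k ?K y"
    then show "position k l (?\<phi> x) \<le> position k l (?\<phi> y)"
      using xy kl_le[OF grp_mono grpn] bd[OF \<beta>T(1)[OF grpn]]
      by (cases x; cases y) (auto intro!: diff_le_mono2)
  qed
  moreover have "u \<in> NC_even ?K l"
    unfolding u_def
  proof (rule NC_even_pullback[OF p])
    let ?\<phi> = "\<lambda>x. case x of Up j \<Rightarrow> Up (ku (\<beta> (grp a j))) | Lo i \<Rightarrow> Lo i"
    show \<phi>in: "?\<phi> x \<in> pts k l" if "x \<in> pts ?K l" for x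
      using that bd[OF \<beta>T(1)[OF grpn]] by (auto split: point.split)
    have kuB: "Up (ku (\<beta> (grp a j))) \<in> B \<longleftrightarrow> \<beta> (grp a j) = B" if "1 \<le> j" "j \<le> ?K" "B \<in> p" for j B
      using ku[OF \<beta>T(1)[OF grpn[OF that(1,2)]]] Tq[OF \<beta>T(1)[OF grpn[OF that(1,2)]]] block_eq[OF Q] that(3) by metis
    show "even (card {i. Up i \<in> pts ?K l \<and> ?\<phi> (Up i) \<in> B} + card {j. Lo j \<in> pts ?K l \<and> ?\<phi> (Lo j) \<in> B})"
      if B: "B \<in> p" for B
    proof -
      have s1: "{j. Lo j \<in> pts ?K l \<and> ?\<phi> (Lo j) \<in> B} = {j. Lo j \<in> B}" by (auto dest: sub[OF B])
      have s2: "{i. Up i \<in> pts ?K l \<and> ?\<phi> (Up i) \<in> B} = {j. 1 \<le> j \<and> j \<le> ?K \<and> \<beta> (grp a j) = B}"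
        using kuB[OF _ _ B] by auto
      show ?thesis
      proof (cases "B \<in> ?T")
        case True
        then obtain j where "j < n" "\<beta> j = B" using \<beta>_surj by blast
        then have "card {j. 1 \<le> j \<and> j \<le> ?K \<and> \<beta> (grp a j) = B} = 1 + a ! j" "\<beta> j = B" "j < n"
          using grpK by auto
        then show ?thesis using par(2)[of j] unfolding s1 s2 by simp
      next
        case False
        then show ?thesis unfolding s1 s2 \<beta>B[OF False] using nth(2)[OF B] by simp
      qed
    qed
    fix x y assume xy: "x \<in> pts ?K l" "y \<in> pts ?K l"
    have "fu w = blk (?\<phi> w)" if "w \<in> pts ?K l" for w
      using that blk_eq[OF Tq[OF \<beta>T(1)] ku[OF \<beta>T(1)]] grpn by (auto simp: fu_def split: point.split)
    then show "fu x = fu y \<longleftrightarrow> same p (?\<phi> x) (?\<phi> y)"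
      using xy blk_same[OF \<phi>in \<phi>in] by simp
    assume "position ?K l x < position ?K l y"
    then show "position k l (?\<phi> x) \<le> position k l (?\<phi> y)"
      using xy ku_le[OF grp_mono grpn] bd[OF \<beta>T(1)[OF grpn]]
      by (cases x; cases y) (auto intro: order_trans[of "ku (\<beta> (grp a _))" k])
  qed
  ultimately show thesis using that[of a v u] a fact by (simp add: n_def through_conv)
qed

section \<open>Linear combinations of partitions\<close>

abbreviation (input) "keys \<equiv> Poly_Mapping.keys"
abbreviation (input) "lookup \<equiv> Poly_Mapping.lookup"
abbreviation (input) "single \<equiv> Poly_Mapping.single"

text \<open>The support of a sum may be smaller than the union of the supports; summing over larger
  fixed index sets makes bilinearity a termwise matter.\<close>

lemma comp0_conv_sum:
  assumes "finite A" "keys g \<subseteq> A" "finite B" "keys f \<subseteq> B"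
  shows "comp0 t g f = (\<Sum>q \<in> A. \<Sum>p \<in> B. single (stack q p)
    (t ^ loops q p * lookup g q * lookup f p))"
proof -
  have "comp0 t g f = (\<Sum>q \<in> keys g. \<Sum>p \<in> B. single (stack q p)
    (t ^ loops q p * lookup g q * lookup f p))"
    unfolding comp0_def using assms
    by (intro sum.cong refl sum.mono_neutral_left) (auto simp: in_keys_iff)
  also have "\<dots> = (\<Sum>q \<in> A. \<Sum>p \<in> B. single (stack q p)
    (t ^ loops q p * lookup g q * lookup f p))"
    using assms by (intro sum.mono_neutral_left) (auto simp: in_keys_iff)
  finally show ?thesis .
qed

lemma comp0_zero [simp]: "comp0 t 0 f = 0" "comp0 t g 0 = 0"
  by (simp_all add: comp0_def)

lemma comp0_add_left: "comp0 t (g + g') f = comp0 t g f + comp0 t g' f"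
proof -
  let ?A = "keys g \<union> keys g'" and ?B = "keys f"
  have "keys (g + g') \<subseteq> ?A" by (rule keys_add)
  then show ?thesis
    by (simp add: comp0_conv_sum[of ?A _ ?B] lookup_add distrib_left distrib_right single_add sum.distrib)
qed

lemma comp0_add_right: "comp0 t g (f + f') = comp0 t g f + comp0 t g f'"
proof -
  let ?A = "keys g" and ?B = "keys f \<union> keys f'"
  have "keys (f + f') \<subseteq> ?B" by (rule keys_add)
  then show ?thesis
    by (simp add: comp0_conv_sum[of ?A _ ?B] lookup_add distrib_left distrib_right single_add sum.distrib)
qed

lemma comp0_diff_left: "comp0 t (g - g') f = comp0 t g f - comp0 t g' f"
  using comp0_add_left[of t "g - g'" g' f] by (simp add: algebra_simps)

lemma comp0_diff_right: "comp0 t g (f - f') = comp0 t g f - comp0 t g f'"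
  using comp0_add_right[of t g "f - f'" f'] by (simp add: algebra_simps)

lemma comp0_sum_left: "comp0 t (\<Sum>i \<in> I. g i) f = (\<Sum>i \<in> I. comp0 t (g i) f)"
  by (induction I rule: infinite_finite_induct) (simp_all add: comp0_add_left)

lemma comp0_sum_right: "comp0 t g (\<Sum>i \<in> I. f i) = (\<Sum>i \<in> I. comp0 t g (f i))"
  by (induction I rule: infinite_finite_induct) (simp_all add: comp0_add_right)

lemma comp0_single:
  "comp0 t (single q b) (single p a) =
    single (stack q p) (t ^ loops q p * b * a)"
  by (subst comp0_conv_sum[of "{q}" _ "{p}"]) auto

lemma sum_single_lookup:
  fixes f :: "'a \<Rightarrow>\<^sub>0 'b::comm_monoid_add"
  shows "(\<Sum>p \<in> keys f. single p (lookup f p)) = f"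
proof (rule poly_mapping_eqI)
  fix k
  have "(\<Sum>p \<in> keys f. lookup (single p (lookup f p)) k) =
    (\<Sum>p \<in> keys f. if p = k then lookup f p else 0)"
    by (intro sum.cong refl) (auto simp: lookup_single when_def)
  then show "lookup (\<Sum>p \<in> keys f. single p (lookup f p)) k =
      lookup f k"
    by (auto simp: lookup_sum in_keys_iff)
qed

lemma keys_comp0:
  assumes "r \<in> keys (comp0 t g f)"
  shows "\<exists>q \<in> keys g. \<exists>p \<in> keys f. r = stack q p"
proof (rule ccontr)
  assume "\<not> ?thesis"
  then have "lookup (comp0 t g f) r = 0"
    unfolding comp0_def lookup_sum by (intro sum.neutral ballI) (auto simp: lookup_single when_def)
  then show False using assms by (simp add: in_keys_iff)
qed

text \<open>Finiteness of the point sets is what \<open>loops_assoc\<close> asks for, so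
  associativity can be proved before sizes are matched.\<close>

definition fin_supp :: "lincomb set" where
  "fin_supp = {f. \<forall>p \<in> keys f. finite (\<Union>p)}"

text \<open>On single partitions \<open>stack_assoc\<close> compares the partitions and
  \<open>loops_assoc\<close> the exponents of \<open>t\<close>; bilinearity does the rest.\<close>

lemma comp0_assoc:
  assumes "f \<in> fin_supp" "g \<in> fin_supp" "h \<in> fin_supp"
  shows "comp0 t h (comp0 t g f) = comp0 t (comp0 t h g) f"
proof -
  let ?s = "\<lambda>f. (\<Sum>p \<in> keys f. single p (lookup f p))"
  have "comp0 t (single r c) (comp0 t (single q b) (single p a)) =
      comp0 t (comp0 t (single r c) (single q b)) (single p a)"
    if "p \<in> keys f" "q \<in> keys g" "r \<in> keys h" for a b c p q r
  proof -
    have "loops r (stack q p) + loops q p = loops (stack r q) p + loops r q"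
      using assms that by (intro loops_assoc) (auto simp: fin_supp_def)
    then have "t ^ loops r (stack q p) * t ^ loops q p = t ^ loops (stack r q) p * t ^ loops r q"
      by (simp flip: power_add)
    then have "t ^ loops r (stack q p) * c * (t ^ loops q p * b * a) =
        t ^ loops (stack r q) p * (t ^ loops r q * c * b) * a"
      by (simp add: mult.assoc mult.left_commute[of _ c])
    then show ?thesis unfolding comp0_single stack_assoc by (rule arg_cong)
  qed
  then have "comp0 t (?s h) (comp0 t (?s g) (?s f)) = comp0 t (comp0 t (?s h) (?s g)) (?s f)"
    unfolding comp0_sum_left comp0_sum_right by (intro sum.cong refl) simp
  then show ?thesis unfolding sum_single_lookup .
qed

lemma hom0_fin_supp: "f \<in> hom0 k l \<Longrightarrow> f \<in> fin_supp"
proof -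
  assume "f \<in> hom0 k l"
  then have "p \<in> partitions k l" if "p \<in> keys f" for p
    using that by (auto simp: hom0_def NC_even_def)
  then show "f \<in> fin_supp" by (simp add: fin_supp_def Union_partitions[of _ k l])
qed

lemma hom0_zero [simp]: "0 \<in> hom0 k l"
  by (simp add: hom0_def)

lemma hom0_add: "f \<in> hom0 k l \<Longrightarrow> g \<in> hom0 k l \<Longrightarrow> f + g \<in> hom0 k l"
  using keys_add[of f g] by (auto simp: hom0_def)

lemma hom0_diff: "f \<in> hom0 k l \<Longrightarrow> g \<in> hom0 k l \<Longrightarrow> f - g \<in> hom0 k l"
proof -
  have "keys (f - g) \<subseteq> keys f \<union> keys g"
    by (auto simp: in_keys_iff lookup_minus)
  then show "f \<in> hom0 k l \<Longrightarrow> g \<in> hom0 k l \<Longrightarrow> f - g \<in> hom0 k l" unfolding hom0_def by blast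
qed

lemma hom0_sum: "(\<And>i. i \<in> I \<Longrightarrow> f i \<in> hom0 k l) \<Longrightarrow> (\<Sum>i \<in> I. f i) \<in> hom0 k l"
  by (induction I rule: infinite_finite_induct) (simp_all add: hom0_add)

lemma hom0_single: "p \<in> NC_even k l \<Longrightarrow> single p c \<in> hom0 k l"
  by (simp add: hom0_def)

lemma hom0_comp0:
  assumes "f \<in> hom0 k l" "g \<in> hom0 l m"
  shows "comp0 t g f \<in> hom0 k m"
  unfolding hom0_def
proof (intro CollectI subsetI)
  fix r assume "r \<in> keys (comp0 t g f)"
  then obtain q p where "q \<in> keys g" "p \<in> keys f" "r = stack q p"
    using keys_comp0 by blast
  then show "r \<in> NC_even k m" using assms stack_NC_even[of p k l q m] by (auto simp: hom0_def)
qed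

lemma hom0_assoc:
  "f \<in> hom0 k l \<Longrightarrow> g \<in> hom0 k' l' \<Longrightarrow> h \<in> hom0 k'' l'' \<Longrightarrow>
    comp0 t h (comp0 t g f) = comp0 t (comp0 t h g) f"
  by (intro comp0_assoc hom0_fin_supp)

definition scale :: "complex \<Rightarrow> lincomb \<Rightarrow> lincomb" where
  "scale c f = Poly_Mapping.map ((*) c) f"

lemma lookup_scale [simp]: "lookup (scale c f) p = c * lookup f p"
  by (auto simp: scale_def Poly_Mapping.map.rep_eq when_def)

lemma scale_zero [simp]: "scale 0 f = 0" "scale c 0 = 0"
  by (rule poly_mapping_eqI; simp)+

lemma scale_single: "scale c (single p b) = single p (c * b)"
  by (rule poly_mapping_eqI) (simp add: lookup_single when_def)

lemma scale_sum: "scale c (\<Sum>i \<in> I. f i) = (\<Sum>i \<in> I. scale c (f i))"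
  by (rule poly_mapping_eqI) (simp add: lookup_sum sum_distrib_left)

lemma hom0_scale: "f \<in> hom0 k l \<Longrightarrow> scale c f \<in> hom0 k l"
  by (auto simp: hom0_def in_keys_iff subset_iff)

lemma comp0_scale_left: "comp0 t (scale c g) f = scale c (comp0 t g f)"
proof -
  have "keys (scale c g) \<subseteq> keys g" by (auto simp: in_keys_iff)
  then show ?thesis
    by (simp add: comp0_conv_sum[of "keys g" _ "keys f"] scale_sum scale_single
        mult.assoc mult.left_commute[of c])
qed

lemma comp0_scale_right: "comp0 t g (scale c f) = scale c (comp0 t g f)"
proof -
  have "keys (scale c f) \<subseteq> keys f" by (auto simp: in_keys_iff)
  then show ?thesis
    by (simp add: comp0_conv_sum[of "keys g" _ "keys f"] scale_sum scale_single
        mult.assoc mult.left_commute[of c])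
qed

lemma finite_NC_even: "finite (NC_even k l)"
  by (rule finite_subset[OF _ finite_partitions[of k l]]) (auto simp: NC_even_def)

text \<open>Gaussian elimination on the coordinates in \<open>F\<close>. Vectors are indexed by
  \<open>I\<close>, so repeated vectors count separately, as is needed for powers of an element that
  may coincide.\<close>

lemma ex_linear_relation:
  fixes v :: "'i \<Rightarrow> 'b \<Rightarrow> 'c::field"
  assumes "finite F" "finite I" "card F < card I"
  shows "\<exists>c. (\<exists>i \<in> I. c i \<noteq> 0) \<and> (\<forall>q \<in> F. (\<Sum>i \<in> I. c i * v i q) = 0)"
  using assms
proof (induction F arbitrary: I v rule: finite_induct)
  case empty
  then have "I \<noteq> {}" by auto
  then show ?case by (intro exI[of _ "\<lambda>_. 1"]) auto
next
  case (insert q F)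
  show ?case
  proof (cases "\<forall>i \<in> I. v i q = 0")
    case True
    then show ?thesis using insert.IH[of I v] insert.prems insert.hyps by auto
  next
    case False
    then obtain j where j: "j \<in> I" "v j q \<noteq> 0" by blast
    define w where "w i = (\<lambda>r. v i r - v i q / v j q * v j r)" for i
    have "card F < card (I - {j})" using insert j by simp
    then obtain c where c: "\<exists>i \<in> I - {j}. c i \<noteq> 0" "\<forall>r \<in> F. (\<Sum>i \<in> I - {j}. c i * w i r) = 0"
      using insert.IH[of "I - {j}" w] insert.prems by auto
    \<comment> \<open>The coefficient at the pivot \<open>j\<close> undoes the elimination, turning
      a relation among the \<open>w i\<close> into one among the \<open>v i\<close>.\<close>
    define d where "d = c(j := - (\<Sum>i \<in> I - {j}. c i * v i q / v j q))"
    have sum: "(\<Sum>i \<in> I. d i * v i r) = (\<Sum>i \<in> I - {j}. c i * w i r)" for r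
    proof -
      have "(\<Sum>i \<in> I. d i * v i r) = d j * v j r + (\<Sum>i \<in> I - {j}. c i * v i r)"
        using insert.prems j by (subst sum.remove[of _ j]) (auto simp: d_def intro!: sum.cong)
      also have "\<dots> = (\<Sum>i \<in> I - {j}. c i * w i r)"
        by (simp add: d_def w_def algebra_simps sum_subtractf sum_distrib_right sum_distrib_left)
      finally show ?thesis .
    qed
    have "(\<Sum>i \<in> I. d i * v i r) = 0" if "r \<in> insert q F" for r
    proof (cases "r = q")
      case True
      then have "w i r = 0" for i using j(2) by (simp add: w_def)
      then show ?thesis unfolding sum by simp
    qed (use that c(2) in \<open>simp add: sum\<close>)
    moreover have "\<exists>i \<in> I. d i \<noteq> 0" using c(1) by (auto simp: d_def)
    ultimately show ?thesis by blast
  qed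
qed

text \<open>Since \<open>m\<close> is the lowest index with a nonzero coefficient, the relation
  expresses \<open>v m\<close> through later members of the sequence.\<close>

lemma hom0_linear_relation:
  fixes v :: "nat \<Rightarrow> lincomb"
  assumes "\<And>i. v i \<in> hom0 k l"
  obtains N m c where "m \<le> N" "c m \<noteq> 0" "\<And>i. i < m \<Longrightarrow> c i = 0" "(\<Sum>i \<le> N. scale (c i) (v i)) = 0"
proof -
  let ?N = "card (NC_even k l)"
  obtain c :: "nat \<Rightarrow> complex" where c: "\<exists>i \<in> {..?N}. c i \<noteq> 0"
      "\<forall>q \<in> NC_even k l. (\<Sum>i \<in> {..?N}. c i * lookup (v i) q) = 0"
    using ex_linear_relation[OF finite_NC_even[of k l], of "{..?N}" "\<lambda>i. lookup (v i)"] by auto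
  have "(\<Sum>i \<le> ?N. scale (c i) (v i)) = 0"
  proof (rule poly_mapping_eqI)
    fix q
    show "lookup (\<Sum>i \<le> ?N. scale (c i) (v i)) q = lookup 0 q"
    proof (cases "q \<in> NC_even k l")
      case False
      then have "lookup (v i) q = 0" for i
        using assms[of i] by (auto simp: hom0_def in_keys_iff)
      then show ?thesis by (simp add: lookup_sum)
    qed (use c in \<open>simp add: lookup_sum\<close>)
  qed
  moreover define m where "m = (LEAST i. c i \<noteq> 0)"
  have "c m \<noteq> 0" using c(1) unfolding m_def by (metis (mono_tags, lifting) LeastI)
  moreover have "c i = 0" if "i < m" for i using not_less_Least that unfolding m_def by blast
  moreover have "m \<le> ?N" using c(1) unfolding m_def by (meson Least_le atMost_iff order_trans)
  ultimately show thesis using that by blast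
qed

section \<open>Corner algebras\<close>

text \<open>\<open>cut t k l e f\<close> is the space of morphisms between the images of the idempotents \<open>f\<close> and \<open>e\<close>.\<close>

definition cut :: "complex \<Rightarrow> nat \<Rightarrow> nat \<Rightarrow> lincomb \<Rightarrow> lincomb \<Rightarrow> lincomb set" where
  "cut t k l e f = {x \<in> hom0 k l. comp0 t e x = x \<and> comp0 t x f = x}"

lemma cut_comp0:
  assumes "x \<in> cut t k l e f" "y \<in> cut t l m g e" "e \<in> hom0 l l" "f \<in> hom0 k k" "g \<in> hom0 m m"
  shows "comp0 t y x \<in> cut t k m g f"
proof -
  have x: "x \<in> hom0 k l" "comp0 t x f = x" and y: "y \<in> hom0 l m" "comp0 t g y = y"
    using assms by (auto simp: cut_def)
  show ?thesis
    unfolding cut_def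
    using hom0_comp0[OF x(1) y(1)] hom0_assoc[OF x(1) y(1) assms(5), of t]
      hom0_assoc[OF assms(4) x(1) y(1), of t, symmetric] x y by simp
qed

lemma cut_add: "x \<in> cut t k l e f \<Longrightarrow> y \<in> cut t k l e f \<Longrightarrow> x + y \<in> cut t k l e f"
  by (simp add: cut_def hom0_add comp0_add_left comp0_add_right)

lemma cut_diff: "x \<in> cut t k l e f \<Longrightarrow> y \<in> cut t k l e f \<Longrightarrow> x - y \<in> cut t k l e f"
  by (simp add: cut_def hom0_diff comp0_diff_left comp0_diff_right)

lemma cut_scale: "x \<in> cut t k l e f \<Longrightarrow> scale c x \<in> cut t k l e f"
  by (simp add: cut_def hom0_scale comp0_scale_left comp0_scale_right)

lemma cut_zero: "0 \<in> cut t k l e f"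
  by (simp add: cut_def)

lemma cut_sum: "(\<And>i. i \<in> I \<Longrightarrow> x i \<in> cut t k l e f) \<Longrightarrow> (\<Sum>i \<in> I. x i) \<in> cut t k l e f"
  by (induction I rule: infinite_finite_induct) (simp_all add: cut_add cut_zero)

text \<open>Packaging the endomorphisms of the image of \<open>e\<close> as a monoid gives access to
  powers with \<open>e\<close> as the empty product.\<close>

definition cut_monoid :: "complex \<Rightarrow> nat \<Rightarrow> lincomb \<Rightarrow> lincomb monoid" where
  "cut_monoid t k e = \<lparr>carrier = cut t k k e e, monoid.mult = comp0 t, one = e\<rparr>"

lemma cut_monoid_simps [simp]: "carrier (cut_monoid t k e) = cut t k k e e"
  "monoid.mult (cut_monoid t k e) = comp0 t" "one (cut_monoid t k e) = e"
  by (simp_all add: cut_monoid_def)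

lemma monoid_cut:
  assumes "e \<in> hom0 k k" "comp0 t e e = e"
  shows "monoid (cut_monoid t k e)"
proof (rule monoidI; simp)
  show "e \<in> cut t k k e e" using assms by (simp add: cut_def)
next
  fix x y z assume xyz: "x \<in> cut t k k e e" "y \<in> cut t k k e e" "z \<in> cut t k k e e"
  then show "comp0 t (comp0 t x y) z = comp0 t x (comp0 t y z)"
    by (auto simp: cut_def intro!: hom0_assoc[symmetric])
  show "comp0 t x y \<in> cut t k k e e" using xyz assms(1) by (intro cut_comp0)
qed (auto simp: cut_def)

text \<open>A multiplicative form of Fitting's lemma: once the powers of \<open>x\<close> become
  stable, the power \<open>f\<close> of \<open>g = x \<otimes> w\<close> is the idempotent of the
  stable part, and \<open>y\<close> inverts \<open>x\<close> relative to \<open>f\<close>.\<close>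

lemma (in monoid) strongly_regular_idempotent:
  assumes x: "x \<in> carrier G" and w: "w \<in> carrier G" and xw: "x \<otimes> w = w \<otimes> x"
    and m: "x [^] Suc m = x [^] Suc (Suc m) \<otimes> w"
  obtains f y where "f \<in> carrier G" "y \<in> carrier G" "f \<otimes> f = f" "x [^] Suc m \<otimes> f = x [^] Suc m"
    "x \<otimes> y = f" "y \<otimes> x = f"
proof -
  define g where "g = x \<otimes> w"
  have g: "g \<in> carrier G" "g \<otimes> x = x \<otimes> g" using x w m_assoc[OF x w x] xw by (simp_all add: g_def)
  define f where "f = g [^] Suc m"
  have fc: "f \<in> carrier G" unfolding f_def using g(1) by (rule nat_pow_closed)
  have xm: "x [^] Suc m \<in> carrier G" using x by (rule nat_pow_closed)
  have "x [^] Suc m \<otimes> x = x [^] Suc (Suc m)" by simp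
  then have xg: "x [^] Suc m \<otimes> g = x [^] Suc m"
    using m m_assoc[OF xm x w] by (simp only: g_def)
  have "x [^] Suc m \<otimes> g [^] j = x [^] Suc m" for j :: nat
  proof (induction j)
    case (Suc j)
    then show ?case
      using m_assoc[OF xm nat_pow_closed[OF g(1)] g(1), of j] xg by (simp only: nat_pow_Suc)
  qed (use xm in \<open>simp only: nat_pow_0 r_one\<close>)
  then have xf: "x [^] Suc m \<otimes> f = x [^] Suc m" unfolding f_def .
  \<comment> \<open>\<open>x [^] Suc m\<close> absorbs \<open>g\<close> and hence \<open>f\<close>;
    writing \<open>f\<close> as a left multiple of this power therefore gives
    \<open>f \<otimes> f = f\<close>.\<close>
  have fwx: "f = w [^] Suc m \<otimes> x [^] Suc m"
    unfolding f_def g_def xw by (rule pow_mult_distrib[OF xw[symmetric] w x])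
  have "f \<otimes> f = w [^] Suc m \<otimes> (x [^] Suc m \<otimes> f)"
    using m_assoc[OF nat_pow_closed[OF w] nat_pow_closed[OF x] fc, of "Suc m" "Suc m"] by (simp only: fwx[symmetric])
  then have ff: "f \<otimes> f = f" by (simp only: xf fwx[symmetric])
  define y where "y = w \<otimes> g [^] m"
  have gm: "g [^] m \<in> carrier G" using g(1) by (rule nat_pow_closed)
  have "x \<otimes> y = f" using m_assoc[OF x w gm] nat_pow_Suc2[OF g(1)] by (simp only: y_def f_def g_def)
  moreover have "y \<otimes> x = f"
  proof -
    have "y \<otimes> x = w \<otimes> (x \<otimes> g [^] m)"
      unfolding y_def using m_assoc[OF w gm x] group_commutes_pow[OF g(2) g(1) x] by simp
    also have "\<dots> = g \<otimes> g [^] m" using m_assoc[OF w x gm] xw by (simp add: g_def)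
    finally show ?thesis using nat_pow_Suc2[OF g(1)] by (simp only: f_def)
  qed
  moreover have "y \<in> carrier G" using w gm by (simp add: y_def)
  ultimately show thesis using that[OF fc] ff xf by blast
qed

text \<open>In finite dimension the powers of \<open>x\<close> satisfy a relation, and its lowest
  term is a multiple of the next power of \<open>x\<close>. The multiplier is a polynomial in
  \<open>x\<close>, so it commutes with \<open>x\<close>.\<close>

lemma cut_strongly_regular:
  assumes e: "e \<in> hom0 k k" "comp0 t e e = e" and x: "x \<in> cut t k k e e"
  obtains m w where "w \<in> cut t k k e e" "comp0 t x w = comp0 t w x"
    "x [^]\<^bsub>cut_monoid t k e\<^esub> Suc m = comp0 t (x [^]\<^bsub>cut_monoid t k e\<^esub> Suc (Suc m)) w"
proof -
  interpret monoid "cut_monoid t k e" using e by (rule monoid_cut)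
  let ?pw = "\<lambda>i :: nat. x [^]\<^bsub>cut_monoid t k e\<^esub> i"
  have pw: "?pw i \<in> cut t k k e e" for i using nat_pow_closed[of x i] x by simp
  then have pS: "?pw (Suc i) \<in> hom0 k k" for i unfolding cut_def by blast
  obtain N m c where c: "m \<le> N" "c m \<noteq> 0" "\<And>i. i < m \<Longrightarrow> c i = 0"
      "(\<Sum>i \<le> N. scale (c i) (?pw (Suc i))) = 0"
    by (rule hom0_linear_relation[of "\<lambda>i. ?pw (Suc i)", OF pS]) blast
  \<comment> \<open>Dividing the relation by \<open>- c m\<close> and splitting off
    \<open>Suc (Suc m)\<close> factors from the power \<open>Suc i\<close> leaves exponent
    \<open>i - Suc m\<close>.\<close>
  define w where "w = (\<Sum>i \<in> {m<..N}. scale (- (c i / c m)) (?pw (i - Suc m)))"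
  have "w \<in> cut t k k e e" unfolding w_def by (intro cut_sum cut_scale pw)
  moreover have "comp0 t x (?pw i) = comp0 t (?pw i) x" for i
    using nat_pow_Suc2[of x i] x by (simp add: nat_pow_Suc)
  then have "comp0 t x w = comp0 t w x"
    by (simp add: w_def comp0_sum_left comp0_sum_right comp0_scale_left comp0_scale_right)
  moreover have "?pw (Suc m) = comp0 t (?pw (Suc (Suc m))) w"
  proof (rule poly_mapping_eqI)
    fix q
    have pm: "comp0 t (?pw (Suc (Suc m))) (?pw (i - Suc m)) = ?pw (Suc i)" if "i \<in> {m<..N}" for i
    proof -
      have "Suc (Suc m) + (i - Suc m) = Suc i" using that by auto
      then show ?thesis using nat_pow_mult[of x "Suc (Suc m)" "i - Suc m"] x by (simp only: cut_monoid_simps)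
    qed
    have "{..N} = insert m ({..<m} \<union> {m<..N})" using c(1) by auto
    moreover have "{..<m} \<inter> {m<..N} = {}" by auto
    ultimately have eq0: "0 = scale (c m) (?pw (Suc m)) + (\<Sum>i \<in> {m<..N}. scale (c i) (?pw (Suc i)))"
      using c(3,4) by (simp add: sum.union_disjoint del: nat_pow_Suc Group.nat_pow_Suc)
    have "0 = c m * lookup (?pw (Suc m)) q + (\<Sum>i \<in> {m<..N}. c i * lookup (?pw (Suc i)) q)"
      using arg_cong[OF eq0, of "\<lambda>f. lookup f q"]
      by (simp only: lookup_add lookup_scale lookup_sum lookup_zero)
    then have "lookup (?pw (Suc m)) q =
        - (\<Sum>i \<in> {m<..N}. c i * lookup (?pw (Suc i)) q) / c m"
      using c(2) by (simp add: field_simps add_eq_0_iff)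
    also have "\<dots> = (\<Sum>i \<in> {m<..N}. - (c i / c m) * lookup (?pw (Suc i)) q)"
      by (simp add: sum_negf sum_divide_distrib)
    also have "\<dots> = lookup (comp0 t (?pw (Suc (Suc m))) w) q"
      unfolding w_def comp0_sum_right comp0_scale_right lookup_sum lookup_scale
      by (intro sum.cong refl) (simp only: pm)
    finally show "lookup (?pw (Suc m)) q = lookup (comp0 t (?pw (Suc (Suc m))) w) q" .
  qed
  ultimately show thesis using that by blast
qed

lemma lookup_comp0: "lookup (comp0 t g f) r =
  (\<Sum>q \<in> keys g. \<Sum>p \<in> keys f.
    (if stack q p = r then t ^ loops q p * lookup g q * lookup f p else 0))"
  unfolding comp0_def lookup_sum by (intro sum.cong refl) (simp add: lookup_single when_def)

section \<open>The corner of \<open>h\<^sub>a\<close>\<close>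

definition h_unit :: "nat list \<Rightarrow> lincomb" where
  "h_unit a = single (h_part a) 1"

abbreviation h_hom :: "complex \<Rightarrow> nat list \<Rightarrow> nat list \<Rightarrow> lincomb set" where
  "h_hom t a b \<equiv> cut t (h_size a) (h_size b) (h_unit b) (h_unit a)"

lemma hom0_h_unit: "set a \<subseteq> {0, 1} \<Longrightarrow> h_unit a \<in> hom0 (h_size a) (h_size a)"
  unfolding h_unit_def by (intro hom0_single h_part_NC_even)

lemma h_unit_idem: "set a \<subseteq> {0, 1} \<Longrightarrow> comp0 t (h_unit a) (h_unit a) = h_unit a"
  by (simp add: h_unit_def comp0_single stack_h_part_h_part loops_h_part)

lemma h_unit_in: "set a \<subseteq> {0, 1} \<Longrightarrow> h_unit a \<in> h_hom t a a"
  by (simp add: cut_def hom0_h_unit h_unit_idem)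

lemma cut_subset:
  assumes "e \<in> cut t k k h h" "h \<in> hom0 k k" "x \<in> cut t k k e e"
  shows "x \<in> cut t k k h h"
proof -
  have e: "e \<in> hom0 k k" "comp0 t h e = e" "comp0 t e h = e"
    and x: "x \<in> hom0 k k" "comp0 t e x = x" "comp0 t x e = x"
    using assms by (auto simp: cut_def)
  have "comp0 t h x = x" using hom0_assoc[OF x(1) e(1) assms(2), of t] e x by simp
  moreover have "comp0 t x h = x" using hom0_assoc[OF assms(2) e(1) x(1), of t] e x by simp
  ultimately show ?thesis using x by (simp add: cut_def)
qed

lemma corner_h_part:
  assumes a: "set a \<subseteq> {0, 1}"
  shows "corner t (h_size a) (h_part a) = h_hom t a a"
proof (intro equalityI subsetI)
  note h = hom0_h_unit[OF a] h_unit_idem[OF a, of t]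
  fix y assume "y \<in> corner t (h_size a) (h_part a)"
  then obtain x where x: "x \<in> hom0 (h_size a) (h_size a)" "y = comp0 t (h_unit a) (comp0 t x (h_unit a))"
    by (auto simp: corner_def h_unit_def)
  have xh: "comp0 t x (h_unit a) \<in> hom0 (h_size a) (h_size a)" by (rule hom0_comp0[OF h(1) x(1)])
  have "y \<in> hom0 (h_size a) (h_size a)" unfolding x(2) by (rule hom0_comp0[OF xh h(1)])
  moreover have "comp0 t (h_unit a) y = y"
    unfolding x(2) using hom0_assoc[OF xh h(1) h(1), of t] h(2) by simp
  moreover have "comp0 t y (h_unit a) = y"
    unfolding x(2) using hom0_assoc[OF h(1) xh h(1), of t] hom0_assoc[OF h(1) h(1) x(1), of t] h(2) by simp
  ultimately show "y \<in> h_hom t a a" by (simp add: cut_def)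
next
  fix y assume "y \<in> h_hom t a a"
  then show "y \<in> corner t (h_size a) (h_part a)"
    unfolding corner_def h_unit_def[symmetric] by (force simp: cut_def)
qed

text \<open>An element fixed by both units is supported on stacks \<open>h_part b\<close> below
  something and \<open>h_part a\<close> above something. These inherit the upper and lower
  connections, so the through-block bounds hold and \<open>NC_even_rigid\<close> settles the
  extremal case.\<close>

lemma h_hom_keys:
  assumes ab: "set a \<subseteq> {0, 1}" "set b \<subseteq> {0, 1}" and x: "x \<in> h_hom t a b"
    and q: "q \<in> keys x"
  shows "q \<in> NC_even (h_size a) (h_size b)"
    "through q \<le> length a" "through q \<le> length b"
    "length a \<le> through q \<Longrightarrow> length b \<le> through q \<Longrightarrow> a = b \<and> q = h_part a"
proof -
  have xh: "x \<in> hom0 (h_size a) (h_size b)" "comp0 t (h_unit b) x = x" "comp0 t x (h_unit a) = x"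
    using x by (auto simp: cut_def)
  note P = h_part_partitions[OF ab(1)] h_part_partitions[OF ab(2)]
  have kp: "r \<in> partitions (h_size a) (h_size b)" if "r \<in> keys x" for r
    using xh(1) that by (auto simp: hom0_def NC_even_def)
  obtain r where r: "r \<in> keys x" "q = stack (h_part b) r"
    using keys_comp0[of q t "h_unit b" x] q xh(2) by (auto simp: h_unit_def)
  obtain r' where r': "r' \<in> keys x" "q = stack r' (h_part a)"
    using keys_comp0[of q t x "h_unit a"] q xh(3) by (auto simp: h_unit_def)
  show qNC: "q \<in> NC_even (h_size a) (h_size b)" using xh(1) q by (auto simp: hom0_def)
  show "through q \<le> length a"
    using through_stack_le(2)[OF P(1) kp[OF r'(1)]] through_stack_le(1)[OF P(1) kp[OF r'(1)]]
      through_h_part[OF ab(1)] r' by simp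
  show "through q \<le> length b"
    using through_stack_le(2)[OF kp[OF r(1)] P(2)] through_h_part[OF ab(2)] r by simp
  assume "length a \<le> through q" "length b \<le> through q"
  then show "a = b \<and> q = h_part a"
  proof (intro NC_even_rigid[OF ab qNC])
    fix x y assume "x \<in> range Up" "y \<in> range Up" "same (h_part a) x y"
    then show "same q x y" using same_stack_upper[OF P(1) kp[OF r'(1)]] r'(2) by auto
  next
    fix x y assume "x \<in> range Lo" "y \<in> range Lo" "same (h_part b) x y"
    then show "same q x y" using same_stack_lower[OF kp[OF r(1)] P(2)] r(2) by auto
  qed
qed

definition chi :: "nat list \<Rightarrow> lincomb \<Rightarrow> complex" where
  "chi a x = lookup x (h_part a)"

text \<open>Factors of a product equal to \<open>h\<^sub>a\<close> have at least as many through-blocks as \<open>h\<^sub>a\<close>, hence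
  equal \<open>h\<^sub>a\<close>; so \<open>chi\<close> is the quotient map \<open>pEp \<rightarrow> pEp / I\<^sub>p\<close>.\<close>

lemma chi_comp0:
  assumes a: "set a \<subseteq> {0, 1}" and x: "x \<in> h_hom t a a" and y: "y \<in> h_hom t a a"
  shows "chi a (comp0 t x y) = chi a x * chi a y"
proof -
  let ?h = "h_part a"
  have iff: "stack q p = ?h \<longleftrightarrow> q = ?h \<and> p = ?h"
    if q: "q \<in> keys x" and p: "p \<in> keys y" for q p
  proof
    assume s: "stack q p = ?h"
    have "p \<in> partitions (h_size a) (h_size a)" "q \<in> partitions (h_size a) (h_size a)"
      using h_hom_keys(1)[OF a a x q] h_hom_keys(1)[OF a a y p] by (auto simp: NC_even_def)
    then have "length a \<le> through p" "length a \<le> through q"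
      using through_stack_le[of p _ _ q] s through_h_part[OF a] by metis+
    then show "q = ?h \<and> p = ?h"
      using h_hom_keys(4)[OF a a x q] h_hom_keys(4)[OF a a y p] by blast
  qed (simp add: stack_h_part_h_part[OF a])
  have "chi a (comp0 t x y) = (\<Sum>q \<in> keys x. \<Sum>p \<in> keys y.
      if p = ?h then if q = ?h then lookup x ?h * lookup y ?h else 0 else 0)"
    unfolding chi_def lookup_comp0
    by (intro sum.cong refl) (auto simp: iff loops_h_part[OF a])
  also have "\<dots> = chi a x * chi a y"
    by (cases "?h \<in> keys y") (auto simp: chi_def in_keys_iff)
  finally show ?thesis .
qed

lemma chi_add: "chi a (x + y) = chi a x + chi a y"
  by (simp add: chi_def lookup_add)

lemma chi_h_unit [simp]: "chi a (h_unit a) = 1"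
  by (simp add: chi_def h_unit_def)

text \<open>In the corner only \<open>h_part a\<close> reaches \<open>length a\<close>
  through-blocks, so lying in the ideal means having coefficient zero there.\<close>

lemma lifts_unit_iff:
  assumes a: "set a \<subseteq> {0, 1}"
  shows "lifts_unit t (h_size a) (h_part a) e \<longleftrightarrow>
    primitive_idempotent t (h_hom t a a) e \<and> chi a e = 1"
proof -
  have "e - h_unit a \<in> corner_ideal t (h_size a) (h_part a) \<longleftrightarrow> chi a e = 1" if e: "e \<in> h_hom t a a"
  proof -
    have d: "e - h_unit a \<in> h_hom t a a" using e h_unit_in[OF a] by (rule cut_diff)
    have "(\<forall>q \<in> keys (e - h_unit a). through q < length a) \<longleftrightarrow>
        h_part a \<notin> keys (e - h_unit a)"
      using h_hom_keys(2,4)[OF a a d] through_h_part[OF a] by (metis leI order_less_irrefl)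
    also have "\<dots> \<longleftrightarrow> chi a e = 1"
      by (simp add: in_keys_iff lookup_minus chi_def h_unit_def)
    finally show ?thesis using d by (simp add: corner_ideal_def corner_h_part[OF a] through_h_part[OF a])
  qed
  then show ?thesis
    unfolding lifts_unit_def corner_h_part[OF a] loops_h_part[OF a]
    by (auto simp: primitive_idempotent_def h_unit_def)
qed

text \<open>The idempotent produced by the stable powers of \<open>x\<close> is \<open>0\<close> or \<open>e\<close>, and it is not \<open>0\<close> since
  \<open>chi a x \<noteq> 0\<close>.\<close>

lemma primitive_invertible:
  assumes a: "set a \<subseteq> {0, 1}" and e: "primitive_idempotent t (h_hom t a a) e" "chi a e = 1"
    and x: "x \<in> cut t (h_size a) (h_size a) e e" and chi: "chi a x \<noteq> 0"
  shows "\<exists>y \<in> cut t (h_size a) (h_size a) e e. comp0 t x y = e \<and> comp0 t y x = e"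
proof -
  let ?K = "h_size a"
  have eh: "e \<in> h_hom t a a" "comp0 t e e = e" using e(1) by (auto simp: primitive_idempotent_def)
  then have e0: "e \<in> hom0 ?K ?K" by (simp add: cut_def)
  interpret monoid "cut_monoid t ?K e" using e0 eh(2) by (rule monoid_cut)
  let ?M = "cut_monoid t ?K e"
  obtain m w where w: "w \<in> cut t ?K ?K e e" "comp0 t x w = comp0 t w x"
      "x [^]\<^bsub>?M\<^esub> Suc m = comp0 t (x [^]\<^bsub>?M\<^esub> Suc (Suc m)) w"
    using cut_strongly_regular[OF e0 eh(2) x] by blast
  have xc: "x \<in> carrier ?M" "w \<in> carrier ?M" using x w(1) by simp_all
  obtain f y where f: "f \<in> cut t ?K ?K e e" "y \<in> cut t ?K ?K e e" and ff: "comp0 t f f = f"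
    and xf: "comp0 t (x [^]\<^bsub>?M\<^esub> Suc m) f = x [^]\<^bsub>?M\<^esub> Suc m" and y: "comp0 t x y = f" "comp0 t y x = f"
    by (rule strongly_regular_idempotent[of x w m, unfolded cut_monoid_simps]) (use x w in simp_all)
  have pc: "x [^]\<^bsub>?M\<^esub> n \<in> cut t ?K ?K e e" for n :: nat using nat_pow_closed[OF xc(1), of n] by simp
  have cute: "y \<in> h_hom t a a" if "y \<in> cut t ?K ?K e e" for y
    by (rule cut_subset[OF eh(1) hom0_h_unit[OF a] that])
  have f_e: "comp0 t e f = f" "comp0 t f e = f" using f(1) by (simp_all add: cut_def)
  have e_cut: "e \<in> cut t ?K ?K e e" using e0 eh(2) by (simp add: cut_def)
  have "f = e"
  proof (rule ccontr)
    assume "f \<noteq> e"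
    have "f \<noteq> 0"
    proof
      assume "f = 0"
      then have "chi a (x [^]\<^bsub>?M\<^esub> Suc m) = 0" using xf by (simp add: chi_def)
      moreover have "chi a (x [^]\<^bsub>?M\<^esub> n) = chi a x ^ n" for n :: nat
        using chi_comp0[OF a cute cute] x pc e(2) by (induction n) auto
      ultimately have "chi a x ^ Suc m = 0" by (simp only:)
      then show False using chi by simp
    qed
    \<comment> \<open>If \<open>f\<close> were neither \<open>0\<close> nor \<open>e\<close>, then
      \<open>e = f + (e - f)\<close> would be a nontrivial orthogonal decomposition of the primitive
      \<open>e\<close>.\<close>
    moreover have "comp0 t (e - f) (e - f) = e - f" "comp0 t f (e - f) = 0" "comp0 t (e - f) f = 0"
      using ff f_e eh(2) by (simp_all add: comp0_diff_left comp0_diff_right)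
    moreover have "f \<in> h_hom t a a" "e - f \<in> h_hom t a a"
      using f(1) by (auto intro: cute cut_diff[OF e_cut])
    ultimately show False
      using e(1) ff \<open>f \<noteq> e\<close> unfolding primitive_idempotent_def
      by (metis add.commute diff_add_cancel eq_iff_diff_eq_0)
  qed
  then show ?thesis using f(2) y by blast
qed

text \<open>If no idempotent with \<open>chi a\<close> equal to \<open>1\<close> were primitive,
  each would split properly, and one summand would again have value \<open>1\<close>. Starting from
  \<open>h_unit a\<close> this gives an infinite strictly decreasing chain of idempotents,
  impossible in finite dimension.\<close>

lemma ex_primitive_lift:
  assumes a: "set a \<subseteq> {0, 1}"
  shows "\<exists>e. primitive_idempotent t (h_hom t a a) e \<and> chi a e = 1"
proof (rule ccontr)
  assume none: "\<not> ?thesis"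
  define I where "I e \<longleftrightarrow> e \<in> h_hom t a a \<and> comp0 t e e = e \<and> chi a e = 1" for e
  define Q where "Q e e' \<longleftrightarrow> e' \<noteq> e \<and> comp0 t e e' = e' \<and> comp0 t e' e = e'" for e e'
  have step: "\<exists>e'. I e' \<and> Q e e'" if e: "I e" for e
  proof -
    have "e \<noteq> 0" using e by (auto simp: I_def chi_def)
    then obtain f g where fg: "f \<in> h_hom t a a" "g \<in> h_hom t a a" "f \<noteq> 0" "g \<noteq> 0"
        "comp0 t f f = f" "comp0 t g g = g" "comp0 t f g = 0" "comp0 t g f = 0" "e = f + g"
      using none e unfolding primitive_idempotent_def I_def by blast
    \<comment> \<open>\<open>chi a\<close> maps idempotents to \<open>0\<close> or \<open>1\<close>,
      and the two values add up to \<open>1\<close>.\<close>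
    have "chi a f * chi a f = chi a f" using chi_comp0[OF a fg(1,1)] fg(5) by simp
    moreover have "chi a f + chi a g = 1" using e fg(9) by (simp add: I_def flip: chi_add)
    ultimately consider "chi a f = 1" | "chi a g = 1" by auto
    then show ?thesis
    proof cases
      case 1
      then have "I f \<and> Q e f" using fg by (simp add: I_def Q_def comp0_add_left comp0_add_right)
      then show ?thesis by blast
    next
      case 2
      then have "I g \<and> Q e g" using fg by (simp add: I_def Q_def comp0_add_left comp0_add_right)
      then show ?thesis by blast
    qed
  qed
  have "I (h_unit a)" using h_unit_in[OF a] h_unit_idem[OF a] by (simp add: I_def)
  then have "\<exists>E. \<forall>n :: nat. I (E n) \<and> Q (E n) (E (Suc n))"
    using step by (intro dependent_nat_choice[of "\<lambda>_. I" "\<lambda>_. Q"]) blast+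
  then obtain E where E: "\<And>n :: nat. I (E n)" "\<And>n. Q (E n) (E (Suc n))" by blast
  have Eh: "E n \<in> hom0 (h_size a) (h_size a)" for n using E(1)[of n] by (simp add: I_def cut_def)
  have le: "comp0 t (E i) (E j) = E j" if "i \<le> j" for i j
    using that
  proof (induction j rule: dec_induct)
    case base
    then show ?case using E(1)[of i] by (simp add: I_def)
  next
    case (step j)
    have EE: "comp0 t (E j) (E (Suc j)) = E (Suc j)" using E(2)[of j] by (simp add: Q_def)
    show ?case using hom0_assoc[OF Eh[of "Suc j"] Eh[of j] Eh[of i], of t] step.IH EE by simp
  qed
  obtain N m c where c: "m \<le> N" "c m \<noteq> 0" "\<And>i. i < m \<Longrightarrow> c i = 0" "(\<Sum>i \<le> N. scale (c i) (E i)) = 0"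
    by (rule hom0_linear_relation[of E, OF Eh]) blast
  \<comment> \<open>Left multiplication by \<open>?d\<close> annihilates every \<open>E i\<close>
    with \<open>i > m\<close> and sends \<open>E m\<close> to \<open>?d\<close>, so it reduces the
    relation to \<open>scale (c m) ?d = 0\<close>.\<close>
  let ?d = "E m - E (Suc m)"
  have d: "scale (c i) (comp0 t ?d (E i)) = (if i = m then scale (c m) ?d else 0)" for i
  proof (cases i m rule: linorder_cases)
    case less
    then show ?thesis using c(3) by simp
  next
    case equal
    have "comp0 t (E (Suc m)) (E m) = E (Suc m)" using E(2)[of m] by (simp add: Q_def)
    then show ?thesis using equal le[of m m] by (simp add: comp0_diff_left)
  next
    case greater
    then show ?thesis using le[of m i] le[of "Suc m" i] by (simp add: comp0_diff_left)
  qed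
  have "0 = comp0 t ?d (\<Sum>i \<le> N. scale (c i) (E i))" using c(4) by simp
  also have "\<dots> = (\<Sum>i \<le> N. if i = m then scale (c m) ?d else 0)"
    unfolding comp0_sum_right comp0_scale_right d ..
  also have "\<dots> = scale (c m) ?d" using c(1) by simp
  finally have "lookup (scale (c m) ?d) q = 0" for q by simp
  then have "?d = 0" using c(2) by (intro poly_mapping_eqI) simp
  then show False using E(2)[of m] by (simp add: Q_def)
qed

section \<open>Matrices of morphisms\<close>

lemma add_hom_dim: "x \<in> add_hom ks ls \<Longrightarrow> dim_row x = length ls \<and> dim_col x = length ks"
  by (auto simp: add_hom_def)

lemma add_hom_entry: "x \<in> add_hom ks ls \<Longrightarrow> i < length ls \<Longrightarrow> j < length ks \<Longrightarrow> x $$ (i, j) \<in> hom0 (ks ! j) (ls ! i)"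
  by (auto simp: add_hom_def)

lemma add_hom_mat:
  "(\<And>i j. i < length ls \<Longrightarrow> j < length ks \<Longrightarrow> f (i, j) \<in> hom0 (ks ! j) (ls ! i)) \<Longrightarrow>
    mat (length ls) (length ks) f \<in> add_hom ks ls"
  by (auto simp: add_hom_def)

lemma add_comp_index [simp]:
  "i < dim_row y \<Longrightarrow> j < dim_col x \<Longrightarrow>
    add_comp t y x $$ (i, j) = (\<Sum>r < dim_row x. comp0 t (y $$ (i, r)) (x $$ (r, j)))"
  "dim_row (add_comp t y x) = dim_row y" "dim_col (add_comp t y x) = dim_col x"
  by (simp_all add: add_comp_def)

lemma add_comp_entry:
  "add_comp t y x = z \<Longrightarrow> i < dim_row y \<Longrightarrow> j < dim_col x \<Longrightarrow>
    (\<Sum>r < dim_row x. comp0 t (y $$ (i, r)) (x $$ (r, j))) = z $$ (i, j)"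
  by auto

lemma add_comp_hom:
  assumes "x \<in> add_hom ks ls" "y \<in> add_hom ls ms"
  shows "add_comp t y x \<in> add_hom ks ms"
  unfolding add_comp_def add_hom_dim[OF assms(1), THEN conjunct2] add_hom_dim[OF assms(2), THEN conjunct1]
    add_hom_dim[OF assms(1), THEN conjunct1]
  by (rule add_hom_mat) (auto intro!: hom0_sum hom0_comp0 add_hom_entry[OF assms(1)] add_hom_entry[OF assms(2)])

lemma add_comp_assoc:
  assumes x: "x \<in> add_hom ks ls" and y: "y \<in> add_hom ls ms" and z: "z \<in> add_hom ms ns"
  shows "add_comp t z (add_comp t y x) = add_comp t (add_comp t z y) x"
proof (rule eq_matI)
  note d = add_hom_dim[OF x] add_hom_dim[OF y] add_hom_dim[OF z]
  fix i j assume "i < dim_row (add_comp t (add_comp t z y) x)" "j < dim_col (add_comp t (add_comp t z y) x)"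
  then have ij: "i < length ns" "j < length ks" using d by simp_all
  have "add_comp t z (add_comp t y x) $$ (i, j) =
    (\<Sum>r < length ms. \<Sum>s < length ls. comp0 t (z $$ (i, r)) (comp0 t (y $$ (r, s)) (x $$ (s, j))))"
    using d ij by (simp add: comp0_sum_right)
  also have "\<dots> = (\<Sum>r < length ms. \<Sum>s < length ls. comp0 t (comp0 t (z $$ (i, r)) (y $$ (r, s))) (x $$ (s, j)))"
    by (intro sum.cong refl hom0_assoc[OF add_hom_entry[OF x] add_hom_entry[OF y] add_hom_entry[OF z]])
      (use ij in auto)
  also have "\<dots> = (\<Sum>s < length ls. \<Sum>r < length ms. comp0 t (comp0 t (z $$ (i, r)) (y $$ (r, s))) (x $$ (s, j)))"
    by (rule sum.swap)
  also have "\<dots> = add_comp t (add_comp t z y) x $$ (i, j)"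
    using d ij by (simp add: comp0_sum_left)
  finally show "add_comp t z (add_comp t y x) $$ (i, j) = add_comp t (add_comp t z y) x $$ (i, j)" .
qed simp_all

lemma Rep_iff: "X \<in> Rep t \<longleftrightarrow> snd X \<in> add_hom (fst X) (fst X) \<and> add_comp t (snd X) (snd X) = snd X"
  by (cases X) (simp add: Rep_def)

text \<open>Because both idempotents may be applied twice, the two-sided condition of
  \<open>rep_hom\<close> separates into one condition on each side.\<close>

lemma rep_hom_iff:
  assumes "X \<in> Rep t" "Y \<in> Rep t"
  shows "x \<in> rep_hom t X Y \<longleftrightarrow>
    x \<in> add_hom (fst X) (fst Y) \<and> add_comp t (snd Y) x = x \<and> add_comp t x (snd X) = x"
proof
  note X = assms(1)[unfolded Rep_iff] and Y = assms(2)[unfolded Rep_iff]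
  assume "x \<in> rep_hom t X Y"
  then have x: "x \<in> add_hom (fst X) (fst Y)" "add_comp t (snd Y) (add_comp t x (snd X)) = x"
    by (auto simp: rep_hom_def)
  have xX: "add_comp t x (snd X) \<in> add_hom (fst X) (fst Y)" using X x by (blast intro: add_comp_hom)
  have "add_comp t (snd Y) x = x"
    using add_comp_assoc[OF xX, of "snd Y" "fst Y" "snd Y" "fst Y" t] Y x by simp
  moreover from this have "add_comp t x (snd X) = x"
    using add_comp_assoc[of "snd X" "fst X" "fst X" x "fst Y" "snd Y" "fst Y" t] X Y x by simp
  ultimately show "x \<in> add_hom (fst X) (fst Y) \<and> add_comp t (snd Y) x = x \<and> add_comp t x (snd X) = x"
    using x by simp
qed (auto simp: rep_hom_def)

lemma rep_hom_comp:
  assumes XYZ: "X \<in> Rep t" "Y \<in> Rep t" "Z \<in> Rep t" and f: "f \<in> rep_hom t X Y" and g: "g \<in> rep_hom t Y Z"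
  shows "add_comp t g f \<in> rep_hom t X Z"
proof -
  note f' = f[unfolded rep_hom_iff[OF XYZ(1,2)]] and g' = g[unfolded rep_hom_iff[OF XYZ(2,3)]]
  note X = XYZ(1)[unfolded Rep_iff] and Z = XYZ(3)[unfolded Rep_iff]
  have "add_comp t (snd Z) (add_comp t g f) = add_comp t g f"
    using add_comp_assoc[of f _ _ g _ "snd Z" "fst Z" t] f' g' Z by metis
  moreover have "add_comp t (add_comp t g f) (snd X) = add_comp t g f"
    using add_comp_assoc[of "snd X" "fst X" "fst X" f _ g _ t] f' g' X by metis
  ultimately show ?thesis
    unfolding rep_hom_iff[OF XYZ(1,3)] using add_comp_hom f' g' by blast
qed

lemma rep_id_hom: "X \<in> Rep t \<Longrightarrow> rep_id X \<in> rep_hom t X X"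
  by (simp add: rep_hom_iff rep_id_def Rep_iff)

lemma rep_hom_id:
  assumes "X \<in> Rep t" "Y \<in> Rep t" "f \<in> rep_hom t X Y"
  shows "add_comp t (rep_id Y) f = f" "add_comp t f (rep_id X) = f"
  using assms by (simp_all add: rep_hom_iff rep_id_def)

lemma rep_hom_assoc:
  assumes "W \<in> Rep t" "X \<in> Rep t" "Y \<in> Rep t" "Z \<in> Rep t"
    "f \<in> rep_hom t W X" "g \<in> rep_hom t X Y" "h \<in> rep_hom t Y Z"
  shows "add_comp t h (add_comp t g f) = add_comp t (add_comp t h g) f"
  using assms by (intro add_comp_assoc[of f "fst W" "fst X" g "fst Y" h "fst Z"]) (simp_all add: rep_hom_iff)

lemma equiv_rep_iso: "equiv (Rep t) (rep_iso t)"
proof (rule equivI)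
  show "rep_iso t \<subseteq> Rep t \<times> Rep t" by (auto simp: rep_iso_def)
  show "refl_on (Rep t) (rep_iso t)"
  proof (rule refl_onI)
    fix X assume X: "X \<in> Rep t"
    then have "add_comp t (rep_id X) (rep_id X) = rep_id X" by (simp add: Rep_iff rep_id_def)
    then show "(X, X) \<in> rep_iso t" using X rep_id_hom[OF X] by (auto simp: rep_iso_def)
  qed
  show "sym (rep_iso t)" by (rule symI) (auto simp: rep_iso_def)
  show "trans (rep_iso t)"
  proof (rule transI)
    fix X Y Z assume "(X, Y) \<in> rep_iso t" "(Y, Z) \<in> rep_iso t"
    then obtain u v u' v' where R: "X \<in> Rep t" "Y \<in> Rep t" "Z \<in> Rep t"
      and u: "u \<in> rep_hom t X Y" "v \<in> rep_hom t Y X" "add_comp t v u = rep_id X" "add_comp t u v = rep_id Y"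
      and u': "u' \<in> rep_hom t Y Z" "v' \<in> rep_hom t Z Y" "add_comp t v' u' = rep_id Y" "add_comp t u' v' = rep_id Z"
      by (auto simp: rep_iso_def)
    have hom: "add_comp t u' u \<in> rep_hom t X Z" "add_comp t v v' \<in> rep_hom t Z X"
      using rep_hom_comp R u u' by blast+
    have "add_comp t (add_comp t v v') (add_comp t u' u) = add_comp t v (add_comp t v' (add_comp t u' u))"
      using rep_hom_assoc[OF R(1,3,2,1) hom(1) u'(2) u(2)] by simp
    also have "\<dots> = add_comp t v u"
      using rep_hom_assoc[OF R(1,2,3,2) u(1) u'(1,2)] u' rep_hom_id[OF R(1,2) u(1)] by simp
    finally have 1: "add_comp t (add_comp t v v') (add_comp t u' u) = rep_id X" using u by simp
    have "add_comp t (add_comp t u' u) (add_comp t v v') = add_comp t u' (add_comp t u (add_comp t v v'))"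
      using rep_hom_assoc[OF R(3,1,2,3) hom(2) u(1) u'(1)] by simp
    also have "\<dots> = add_comp t u' v'"
      using rep_hom_assoc[OF R(3,2,1,2) u'(2) u(2,1)] u rep_hom_id[OF R(3,2) u'(2)] by simp
    finally have "add_comp t (add_comp t u' u) (add_comp t v v') = rep_id Z" using u' by simp
    with 1 hom R show "(X, Z) \<in> rep_iso t" unfolding rep_iso_def by blast
  qed
qed

lemma sum_lessThan_add: "(\<Sum>r < n + m. f r) = (\<Sum>r < n. f r) + (\<Sum>r < m. f (n + r))"
  for f :: "nat \<Rightarrow> 'a::comm_monoid_add" and n m :: nat
  by (induction m) (simp_all add: add.assoc)

lemma rep_sum_index:
  assumes "Y \<in> Rep t" "Z \<in> Rep t" "i < length (fst Y) + length (fst Z)" "j < length (fst Y) + length (fst Z)"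
  shows "snd (rep_sum Y Z) $$ (i, j) =
    (if i < length (fst Y) then if j < length (fst Y) then snd Y $$ (i, j) else 0
     else if j < length (fst Y) then 0 else snd Z $$ (i - length (fst Y), j - length (fst Y)))"
  using assms add_hom_dim[of "snd Y" "fst Y" "fst Y"] add_hom_dim[of "snd Z" "fst Z" "fst Z"]
  by (auto simp: rep_sum_def Rep_iff)

lemma rep_sum_Rep:
  assumes Y: "Y \<in> Rep t" and Z: "Z \<in> Rep t"
  shows "rep_sum Y Z \<in> Rep t"
proof -
  let ?n = "length (fst Y)" and ?m = "length (fst Z)" and ?S = "snd (rep_sum Y Z)"
  have d: "dim_row (snd Y) = ?n" "dim_col (snd Y) = ?n" "dim_row (snd Z) = ?m" "dim_col (snd Z) = ?m"
    using Y Z add_hom_dim by (auto simp: Rep_iff)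
  then have dS: "dim_row ?S = ?n + ?m" "dim_col ?S = ?n + ?m" by (simp_all add: rep_sum_def)
  have "?S \<in> add_hom (fst Y @ fst Z) (fst Y @ fst Z)"
    unfolding add_hom_def
  proof (intro CollectI conjI allI impI)
    show "?S \<in> carrier_mat (length (fst Y @ fst Z)) (length (fst Y @ fst Z))"
      by (rule carrier_matI) (simp_all add: dS)
    fix i j assume ij: "i < length (fst Y @ fst Z)" "j < length (fst Y @ fst Z)"
    then show "?S $$ (i, j) \<in> hom0 ((fst Y @ fst Z) ! j) ((fst Y @ fst Z) ! i)"
      using rep_sum_index[OF Y Z, of i j] add_hom_entry[of "snd Y" "fst Y" "fst Y" i j]
        add_hom_entry[of "snd Z" "fst Z" "fst Z" "i - ?n" "j - ?n"] Y Z
      by (auto simp: nth_append Rep_iff)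
  qed
  moreover have "add_comp t ?S ?S = ?S"
  proof (rule eq_matI)
    fix i j assume "i < dim_row ?S" "j < dim_col ?S"
    then have ij: "i < ?n + ?m" "j < ?n + ?m" using dS by simp_all
    have eY: "(\<Sum>r < ?n. comp0 t (snd Y $$ (i, r)) (snd Y $$ (r, j))) = snd Y $$ (i, j)" if "i < ?n" "j < ?n" for i j
      using Y that d add_comp_entry[of t "snd Y" "snd Y" "snd Y" i j] by (simp add: Rep_iff)
    have eZ: "(\<Sum>r < ?m. comp0 t (snd Z $$ (i, r)) (snd Z $$ (r, j))) = snd Z $$ (i, j)" if "i < ?m" "j < ?m" for i j
      using Z that d add_comp_entry[of t "snd Z" "snd Z" "snd Z" i j] by (simp add: Rep_iff)
    show "add_comp t ?S ?S $$ (i, j) = ?S $$ (i, j)"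
      using ij dS eY[of i j] eZ[of "i - ?n" "j - ?n"] by (auto simp: sum_lessThan_add rep_sum_index[OF Y Z])
  qed (use dS in simp_all)
  ultimately show ?thesis by (simp add: Rep_iff rep_sum_def)
qed

text \<open>The additive and idempotent completions together split every idempotent endomorphism:
  \<open>F\<close> and \<open>e - F\<close> are orthogonal, and their images form a direct sum
  decomposition.\<close>

lemma rep_iso_split:
  assumes X: "(ks, e) \<in> Rep t" and F: "F \<in> add_hom ks ks" "add_comp t F F = F"
    "add_comp t e F = F" "add_comp t F e = F"
  shows "(ks, F) \<in> Rep t" "(ks, e - F) \<in> Rep t" "((ks, e), rep_sum (ks, F) (ks, e - F)) \<in> rep_iso t"
proof -
  let ?n = "length ks"
  define G where "G = e - F"
  have e: "e \<in> add_hom ks ks" "add_comp t e e = e" using X by (auto simp: Rep_iff)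
  note d = add_hom_dim[OF e(1)] add_hom_dim[OF F(1)]
  have dG: "dim_row G = ?n" "dim_col G = ?n" using d by (simp_all add: G_def)
  have Gij: "G $$ (i, j) = e $$ (i, j) - F $$ (i, j)" if "i < ?n" "j < ?n" for i j
    using that d by (simp add: G_def)
  have entry: "(\<Sum>r < ?n. comp0 t (A $$ (i, r)) (B $$ (r, j))) = C $$ (i, j)"
    if "add_comp t A B = C" "i < ?n" "j < ?n" "dim_row A = ?n" "dim_row B = ?n" "dim_col B = ?n" for A B C i j
    using add_comp_entry[OF that(1), of i j] that by simp
  have EF: "(\<Sum>r < ?n. comp0 t (e $$ (i, r)) (e $$ (r, j))) = e $$ (i, j)"
    "(\<Sum>r < ?n. comp0 t (F $$ (i, r)) (F $$ (r, j))) = F $$ (i, j)"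
    "(\<Sum>r < ?n. comp0 t (e $$ (i, r)) (F $$ (r, j))) = F $$ (i, j)"
    "(\<Sum>r < ?n. comp0 t (F $$ (i, r)) (e $$ (r, j))) = F $$ (i, j)"
    if "i < ?n" "j < ?n" for i j
    using entry[OF e(2)] entry[OF F(2)] entry[OF F(3)] entry[OF F(4)] that d by simp_all
  have GG: "(\<Sum>r < ?n. comp0 t (G $$ (i, r)) (G $$ (r, j))) = G $$ (i, j)"
    and FG: "(\<Sum>r < ?n. comp0 t (F $$ (i, r)) (G $$ (r, j))) = 0"
    and GF: "(\<Sum>r < ?n. comp0 t (G $$ (i, r)) (F $$ (r, j))) = 0"
    and eG: "(\<Sum>r < ?n. comp0 t (e $$ (i, r)) (G $$ (r, j))) = G $$ (i, j)"
    and Ge: "(\<Sum>r < ?n. comp0 t (G $$ (i, r)) (e $$ (r, j))) = G $$ (i, j)"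
    if "i < ?n" "j < ?n" for i j
    using that by (simp_all add: Gij comp0_diff_left comp0_diff_right sum_subtractf EF)
  note FF = EF(2) and eF = EF(3) and Fe = EF(4)
  have Gh: "G $$ (i, j) \<in> hom0 (ks ! j) (ks ! i)" and Fh: "F $$ (i, j) \<in> hom0 (ks ! j) (ks ! i)"
    if "i < ?n" "j < ?n" for i j
    using that add_hom_entry[OF e(1)] add_hom_entry[OF F(1)] by (simp_all add: Gij hom0_diff)
  have G: "G \<in> add_hom ks ks" using Gh dG by (auto simp: add_hom_def)
  show Y: "(ks, F) \<in> Rep t" using F by (simp add: Rep_iff)
  have "add_comp t G G = G" by (rule eq_matI) (simp_all add: dG GG)
  then have Z: "(ks, G) \<in> Rep t" using G by (simp add: Rep_iff)
  then show "(ks, e - F) \<in> Rep t" by (simp add: G_def)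
  let ?S = "rep_sum (ks, F) (ks, G)"
  have S: "?S \<in> Rep t" using Y Z by (rule rep_sum_Rep)
  have fS: "fst ?S = ks @ ks" by (simp add: rep_sum_def)
  have dS: "dim_row (snd ?S) = ?n + ?n" "dim_col (snd ?S) = ?n + ?n"
    using d dG by (simp_all add: rep_sum_def)
  note iS = rep_sum_index[OF Y Z, unfolded fst_conv snd_conv]
  \<comment> \<open>\<open>u\<close> puts \<open>F\<close> above \<open>G\<close> and
    \<open>v\<close> puts \<open>F\<close> beside \<open>G\<close>. Then \<open>v\<close> after
    \<open>u\<close> is \<open>F + G = e\<close>, and the other composite is block diagonal since
    the mixed products vanish.\<close>
  define u where "u = mat (?n + ?n) ?n (\<lambda>(i, j). if i < ?n then F $$ (i, j) else G $$ (i - ?n, j))"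
  define v where "v = mat ?n (?n + ?n) (\<lambda>(i, j). if j < ?n then F $$ (i, j) else G $$ (i, j - ?n))"
  have uh: "u \<in> add_hom ks (ks @ ks)" and vh: "v \<in> add_hom (ks @ ks) ks"
    using Fh Gh by (auto simp: u_def v_def add_hom_def nth_append)
  have du: "dim_row u = ?n + ?n" "dim_col u = ?n" "dim_row v = ?n" "dim_col v = ?n + ?n"
    by (simp_all add: u_def v_def)
  have uij: "u $$ (i, j) = (if i < ?n then F $$ (i, j) else G $$ (i - ?n, j))" if "i < ?n + ?n" "j < ?n" for i j
    using that by (simp add: u_def)
  have vij: "v $$ (i, j) = (if j < ?n then F $$ (i, j) else G $$ (i, j - ?n))" if "i < ?n" "j < ?n + ?n" for i j
    using that by (simp add: v_def)
  have "u \<in> rep_hom t (ks, e) ?S"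
    unfolding rep_hom_iff[OF X S] fS fst_conv snd_conv
  proof (intro conjI uh eq_matI)
    fix i j assume "i < dim_row u" "j < dim_col u"
    then have ij: "i < ?n + ?n" "j < ?n" using du by simp_all
    show "add_comp t (snd ?S) u $$ (i, j) = u $$ (i, j)"
      using ij by (auto simp: dS du sum_lessThan_add iS uij FF GG)
    show "add_comp t u e $$ (i, j) = u $$ (i, j)"
      using ij d by (auto simp: du uij Fe Ge)
  qed (use d in \<open>simp_all add: du dS\<close>)
  moreover have "v \<in> rep_hom t ?S (ks, e)"
    unfolding rep_hom_iff[OF S X] fS fst_conv snd_conv
  proof (intro conjI vh eq_matI)
    fix i j assume "i < dim_row v" "j < dim_col v"
    then have ij: "i < ?n" "j < ?n + ?n" using du by simp_all
    show "add_comp t v (snd ?S) $$ (i, j) = v $$ (i, j)"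
      using ij by (auto simp: dS du sum_lessThan_add iS vij FF GG)
    show "add_comp t e v $$ (i, j) = v $$ (i, j)"
      using ij d by (auto simp: du vij eF eG)
  qed (use d in \<open>simp_all add: du dS\<close>)
  moreover have "add_comp t v u = e"
  proof (rule eq_matI)
    fix i j assume "i < dim_row e" "j < dim_col e"
    then have ij: "i < ?n" "j < ?n" using d by simp_all
    then show "add_comp t v u $$ (i, j) = e $$ (i, j)"
      using FF[of i j] GG[of i j] Gij[of i j] by (simp add: du sum_lessThan_add uij vij)
  qed (use d in \<open>simp_all add: du\<close>)
  moreover have "add_comp t u v = snd ?S"
  proof (rule eq_matI)
    fix i j assume "i < dim_row (snd ?S)" "j < dim_col (snd ?S)"
    then have ij: "i < ?n + ?n" "j < ?n + ?n" using dS by simp_all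
    then show "add_comp t u v $$ (i, j) = snd ?S $$ (i, j)"
      by (auto simp: du uij vij FF GG FG GF iS)
  qed (simp_all add: du dS)
  ultimately show "((ks, e), rep_sum (ks, F) (ks, e - F)) \<in> rep_iso t"
    using X S unfolding G_def[symmetric] rep_iso_def rep_id_def by auto
qed

text \<open>From \<open>f\<close> after \<open>g\<close> being the identity, \<open>g\<close> after
  \<open>f\<close> is an idempotent of \<open>X\<close>. Indecomposability makes it zero or the
  identity; the latter says that \<open>f\<close> and \<open>g\<close> are inverse.\<close>

lemma rep_iso_of_summand:
  assumes X: "X \<in> Rep t" "indecomposable t X" and Y: "Y \<in> Rep t" "\<not> rep_zero Y"
    and f: "f \<in> rep_hom t X Y" and g: "g \<in> rep_hom t Y X" and fg: "add_comp t f g = rep_id Y"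
  shows "(X, Y) \<in> rep_iso t"
proof -
  obtain ks e where Xe: "X = (ks, e)" by (cases X)
  define F where "F = add_comp t g f"
  have Fh: "F \<in> rep_hom t X X" unfolding F_def using rep_hom_comp[OF X(1) Y(1) X(1) f g] .
  then have F: "F \<in> add_hom ks ks" "add_comp t e F = F" "add_comp t F e = F"
    using X(1) by (auto simp: rep_hom_iff Xe)
  have fF: "add_comp t f F = f"
    unfolding F_def using rep_hom_assoc[OF X(1) Y(1) X(1) Y(1) f g f] fg rep_hom_id[OF X(1) Y(1) f] by simp
  have "add_comp t F F = F"
    using rep_hom_assoc[OF X(1) X(1) Y(1) X(1) Fh f g] fF by (simp add: F_def)
  note s = rep_iso_split[OF X(1)[unfolded Xe] F(1) this F(2,3)]
  then consider "rep_zero (ks, F)" | "rep_zero (ks, e - F)"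
    using X(2) unfolding indecomposable_def Xe by blast
  then show ?thesis
  proof cases
    \<comment> \<open>If \<open>F\<close> vanishes, so does \<open>f\<close>, because
      \<open>f\<close> after \<open>F\<close> equals \<open>f\<close>; then the identity of
      \<open>Y\<close> vanishes too.\<close>
    case 1
    then have "F = 0\<^sub>m (length ks) (length ks)" by (simp add: rep_zero_def rep_id_def)
    moreover have "dim_col f = length ks" "dim_row f = length (fst Y)" "dim_col g = length (fst Y)"
      using f g X(1) Y(1) add_hom_dim by (auto simp: rep_hom_iff Xe)
    moreover have "dim_row g = length ks"
      using g X(1) Y(1) add_hom_dim by (auto simp: rep_hom_iff Xe)
    moreover have "f $$ (i, j) = 0" if "i < length (fst Y)" "j < length ks" for i j
      using add_comp_entry[OF fF, of i j] that calculation by simp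
    ultimately have "rep_id Y $$ (i, j) = 0" if "i < length (fst Y)" "j < length (fst Y)" for i j
      using add_comp_entry[OF fg, of i j] that by simp
    moreover have "dim_row (rep_id Y) = length (fst Y)" "dim_col (rep_id Y) = length (fst Y)"
      using Y(1) add_hom_dim by (auto simp: Rep_iff rep_id_def)
    ultimately have "rep_id Y = 0\<^sub>m (length (fst Y)) (length (fst Y))"
      by (intro eq_matI) auto
    then show ?thesis using Y(2) by (simp add: rep_zero_def)
  next
    case 2
    then have eF: "e - F = 0\<^sub>m (length ks) (length ks)" by (simp add: rep_zero_def rep_id_def)
    have d: "dim_row F = length ks" "dim_col F = length ks" "dim_row e = length ks" "dim_col e = length ks"
      using add_hom_dim[OF F(1)] X(1) add_hom_dim[of e ks ks] by (auto simp: Xe Rep_iff)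
    have "F = e"
    proof (rule eq_matI)
      fix i j assume ij: "i < dim_row e" "j < dim_col e"
      then have "(e - F) $$ (i, j) = 0" using eF d by simp
      then show "F $$ (i, j) = e $$ (i, j)" using ij d by simp
    qed (simp_all add: d)
    then show ?thesis using X(1) Y(1) f g fg by (auto simp: rep_iso_def rep_id_def F_def Xe)
  qed
qed

section \<open>Objects with one summand\<close>

definition image_obj :: "nat \<Rightarrow> lincomb \<Rightarrow> rep_obj" where
  "image_obj k e = ([k], mat 1 1 (\<lambda>_. e))"

lemma image_obj_simps [simp]: "fst (image_obj k e) = [k]" "snd (image_obj k e) = mat 1 1 (\<lambda>_. e)"
  by (simp_all add: image_obj_def)

lemma add_comp_mat11: "add_comp t (mat 1 1 (\<lambda>_. x)) (mat 1 1 (\<lambda>_. y)) = mat 1 1 (\<lambda>_. comp0 t x y)"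
  by (rule eq_matI) auto

lemma add_hom_mat11: "mat 1 1 (\<lambda>_. x) \<in> add_hom [k] [l] \<longleftrightarrow> x \<in> hom0 k l"
  by (auto simp: add_hom_def)

lemma mat11_eq_iff: "mat 1 1 (\<lambda>_. x) = mat 1 1 (\<lambda>_. y) \<longleftrightarrow> x = y"
proof
  assume "mat 1 1 (\<lambda>_. x) = mat 1 1 (\<lambda>_. y)"
  then have "mat 1 1 (\<lambda>_. x) $$ (0, 0) = mat 1 1 (\<lambda>_. y) $$ (0, 0)" by simp
  then show "x = y" by simp
qed simp

lemma image_obj_Rep: "e \<in> hom0 k k \<Longrightarrow> comp0 t e e = e \<Longrightarrow> image_obj k e \<in> Rep t"
  by (simp add: Rep_iff add_hom_mat11 add_comp_mat11 del: One_nat_def)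

lemma rep_zero_image_obj: "rep_zero (image_obj k e) \<longleftrightarrow> e = 0"
proof -
  have "0\<^sub>m 1 1 = mat 1 1 (\<lambda>_. 0 :: lincomb)" by (rule eq_matI) auto
  then show ?thesis using mat11_eq_iff[of e 0] by (simp add: rep_zero_def rep_id_def)
qed

lemma rep_hom_image_obj:
  assumes "e \<in> hom0 k k" "comp0 t e e = e" "f \<in> hom0 l l" "comp0 t f f = f"
  shows "x \<in> rep_hom t (image_obj k e) (image_obj l f) \<longleftrightarrow> (\<exists>y \<in> cut t k l f e. x = mat 1 1 (\<lambda>_. y))"
proof
  assume x: "x \<in> rep_hom t (image_obj k e) (image_obj l f)"
  then have "dim_row x = 1" "dim_col x = 1"
    using add_hom_dim[of x "[k]" "[l]"] by (auto simp: rep_hom_def)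
  then have "x = mat 1 1 (\<lambda>_. x $$ (0, 0))" by (intro eq_matI) auto
  moreover from this have "x $$ (0, 0) \<in> cut t k l f e"
    using x unfolding rep_hom_iff[OF image_obj_Rep[OF assms(1,2)] image_obj_Rep[OF assms(3,4)]]
    by (simp add: cut_def) (metis add_comp_mat11 add_hom_mat11 mat11_eq_iff One_nat_def)
  ultimately show "\<exists>y \<in> cut t k l f e. x = mat 1 1 (\<lambda>_. y)" by blast
next
  assume "\<exists>y \<in> cut t k l f e. x = mat 1 1 (\<lambda>_. y)"
  then show "x \<in> rep_hom t (image_obj k e) (image_obj l f)"
    unfolding rep_hom_iff[OF image_obj_Rep[OF assms(1,2)] image_obj_Rep[OF assms(3,4)]]
    by (auto simp: cut_def add_comp_mat11 add_hom_mat11 simp del: One_nat_def)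
qed

text \<open>The projections of a direct sum onto its summands, carried back along the isomorphism,
  are orthogonal idempotents with sum \<open>e\<close>. Primitivity kills one of them, and with it
  the corresponding summand.\<close>

lemma primitive_indecomposable:
  assumes h: "h \<in> hom0 k k" and e: "primitive_idempotent t (cut t k k h h) e"
  shows "indecomposable t (image_obj k e)"
  unfolding indecomposable_def
proof (intro ballI impI)
  fix Y Z assume Y: "Y \<in> Rep t" and Z: "Z \<in> Rep t" and "(image_obj k e, rep_sum Y Z) \<in> rep_iso t"
  let ?S = "rep_sum Y Z" and ?n = "length (fst Y)" and ?m = "length (fst Z)"
  have eh: "e \<in> cut t k k h h" "comp0 t e e = e" using e by (auto simp: primitive_idempotent_def)
  then have e0: "e \<in> hom0 k k" by (simp add: cut_def)
  have X: "image_obj k e \<in> Rep t" using e0 eh(2) by (rule image_obj_Rep)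
  have S: "?S \<in> Rep t" using Y Z by (rule rep_sum_Rep)
  obtain u v where u: "u \<in> rep_hom t (image_obj k e) ?S" and v: "v \<in> rep_hom t ?S (image_obj k e)"
    and vu: "add_comp t v u = mat 1 1 (\<lambda>_. e)" and uv: "add_comp t u v = snd ?S"
    using \<open>(image_obj k e, ?S) \<in> rep_iso t\<close> by (auto simp: rep_iso_def rep_id_def)
  have fS: "fst ?S = fst Y @ fst Z" by (simp add: rep_sum_def)
  note u' = u[unfolded rep_hom_iff[OF X S]] and v' = v[unfolded rep_hom_iff[OF S X]]
  define U where "U r = u $$ (r, 0)" for r
  define V where "V r = v $$ (0, r)" for r
  define K where "K r = (fst Y @ fst Z) ! r" for r
  have du: "dim_row u = ?n + ?m" "dim_col u = 1" "dim_row v = 1" "dim_col v = ?n + ?m"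
    using u' v' add_hom_dim fS by fastforce+
  have Uh: "U r \<in> hom0 k (K r)" and Vh: "V r \<in> hom0 (K r) k" if "r < ?n + ?m" for r
    using that add_hom_entry[of u "[k]" "fst Y @ fst Z" r 0] add_hom_entry[of v "fst Y @ fst Z" "[k]" 0 r] u' v' fS
    by (simp_all add: U_def V_def K_def)
  have dS: "dim_row (snd ?S) = ?n + ?m" "dim_col (snd ?S) = ?n + ?m"
    using S add_hom_dim[of "snd ?S" "fst ?S" "fst ?S"] fS by (auto simp: Rep_iff)
  have UV: "comp0 t (U r) (V s) = snd ?S $$ (r, s)" if "r < ?n + ?m" "s < ?n + ?m" for r s
    using that du add_comp_entry[OF uv, of r s] by (simp add: U_def V_def)
  have SU: "(\<Sum>s < ?n + ?m. comp0 t (snd ?S $$ (r, s)) (U s)) = U r" if "r < ?n + ?m" for r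
    using that du dS u' add_comp_entry[of t "snd ?S" u u r 0] by (simp add: U_def)
  have eV: "comp0 t e (V r) = V r" and Ue: "comp0 t (U r) e = U r" if "r < ?n + ?m" for r
    using that du u' v' add_comp_entry[of t u "mat 1 1 (\<lambda>_. e)" u r 0]
      add_comp_entry[of t "mat 1 1 (\<lambda>_. e)" v v 0 r] by (simp_all add: U_def V_def)
  have iS: "snd ?S $$ (r, s) = (if r < ?n then if s < ?n then snd Y $$ (r, s) else 0
      else if s < ?n then 0 else snd Z $$ (r - ?n, s - ?n))" if "r < ?n + ?m" "s < ?n + ?m" for r s
    using rep_sum_index[OF Y Z that] .
  have vue: "(\<Sum>r < ?n + ?m. comp0 t (V r) (U r)) = e"
    using du add_comp_entry[OF vu, of 0 0] by (simp add: U_def V_def)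
  \<comment> \<open>For an index set \<open>I\<close> of summands this is the endomorphism "project
    to \<open>I\<close>" of the direct sum, conjugated by \<open>u\<close> and
    \<open>v\<close>.\<close>
  define P where "P I = (\<Sum>r \<in> I. comp0 t (V r) (U r))" for I
  have Ph: "P I \<in> hom0 k k" if "I \<subseteq> {..<?n + ?m}" for I
    unfolding P_def using that Uh Vh by (intro hom0_sum hom0_comp0[of _ _ "K _"]) auto
  have eP: "comp0 t e (P I) = P I" "comp0 t (P I) e = P I" if "I \<subseteq> {..<?n + ?m}" for I
  proof -
    have "comp0 t e (comp0 t (V r) (U r)) = comp0 t (V r) (U r)"
      "comp0 t (comp0 t (V r) (U r)) e = comp0 t (V r) (U r)" if "r \<in> I" for r
    proof -
      have r: "r < ?n + ?m" using that \<open>I \<subseteq> _\<close> by auto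
      show "comp0 t e (comp0 t (V r) (U r)) = comp0 t (V r) (U r)"
        using hom0_assoc[OF Uh[OF r] Vh[OF r] e0, of t] eV[OF r] by simp
      show "comp0 t (comp0 t (V r) (U r)) e = comp0 t (V r) (U r)"
        using hom0_assoc[OF e0 Uh[OF r] Vh[OF r], of t] Ue[OF r] by simp
    qed
    then show "comp0 t e (P I) = P I" "comp0 t (P I) e = P I"
      by (simp_all add: P_def comp0_sum_left comp0_sum_right)
  qed
  let ?A = "{..<?n}" and ?B = "{?n..<?n + ?m}"
  have UP: "comp0 t (U r) (P I) = (\<Sum>s \<in> I. comp0 t (snd ?S $$ (r, s)) (U s))"
    if "r < ?n + ?m" "I \<subseteq> {..<?n + ?m}" for r I
    unfolding P_def comp0_sum_right
  proof (rule sum.cong[OF refl])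
    fix s assume "s \<in> I"
    then have s: "s < ?n + ?m" using that(2) by auto
    show "comp0 t (U r) (comp0 t (V s) (U s)) = comp0 t (snd ?S $$ (r, s)) (U s)"
      using hom0_assoc[OF Uh[OF s] Vh[OF s] Uh[OF that(1)], of t] UV[OF that(1) s] by simp
  qed
  have sub: "?A \<subseteq> {..<?n + ?m}" "?B \<subseteq> {..<?n + ?m}" by auto
  have AB: "{..<?n + ?m} = ?A \<union> ?B" "?A \<inter> ?B = {}" by auto
  have SU': "U r = (\<Sum>s \<in> ?A. comp0 t (snd ?S $$ (r, s)) (U s)) + (\<Sum>s \<in> ?B. comp0 t (snd ?S $$ (r, s)) (U s))"
    if "r < ?n + ?m" for r
    using SU[OF that] unfolding AB(1) by (simp add: sum.union_disjoint[OF _ _ AB(2)])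
  \<comment> \<open>The identity of the direct sum is block diagonal, so the rows of
    \<open>u\<close> in the first block are fixed by \<open>P ?A\<close> and annihilated by
    \<open>P ?B\<close>.\<close>
  have UA: "comp0 t (U r) (P ?B) = 0" "comp0 t (U r) (P ?A) = U r" if r: "r \<in> ?A" for r
  proof -
    have "(\<Sum>s \<in> ?B. comp0 t (snd ?S $$ (r, s)) (U s)) = 0"
      using r by (intro sum.neutral) (auto simp: iS)
    then show "comp0 t (U r) (P ?B) = 0" "comp0 t (U r) (P ?A) = U r"
      using UP[OF _ sub(1), of r] UP[OF _ sub(2), of r] SU'[of r] r by simp_all
  qed
  have UB: "comp0 t (U r) (P ?A) = 0" "comp0 t (U r) (P ?B) = U r" if r: "r \<in> ?B" for r
  proof -
    have "(\<Sum>s \<in> ?A. comp0 t (snd ?S $$ (r, s)) (U s)) = 0"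
      using r by (intro sum.neutral) (auto simp: iS)
    then show "comp0 t (U r) (P ?A) = 0" "comp0 t (U r) (P ?B) = U r"
      using UP[OF _ sub(1), of r] UP[OF _ sub(2), of r] SU'[of r] r by simp_all
  qed
  have PP: "comp0 t (P I) (P J) = (\<Sum>r \<in> I. comp0 t (V r) (comp0 t (U r) (P J)))"
    if "I \<subseteq> {..<?n + ?m}" "J \<subseteq> {..<?n + ?m}" for I J
  proof -
    have "comp0 t (comp0 t (V r) (U r)) (P J) = comp0 t (V r) (comp0 t (U r) (P J))" if "r \<in> I" for r
    proof -
      have r: "r < ?n + ?m" using that \<open>I \<subseteq> _\<close> by auto
      show ?thesis using hom0_assoc[OF Ph[OF \<open>J \<subseteq> _\<close>] Uh[OF r] Vh[OF r], of t] by simp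
    qed
    then show ?thesis by (simp add: P_def[of I] comp0_sum_left)
  qed
  have P1: "comp0 t (P I) (P I) = P I" if "I \<subseteq> {..<?n + ?m}" "\<And>r. r \<in> I \<Longrightarrow> comp0 t (U r) (P I) = U r" for I
  proof -
    have "comp0 t (P I) (P I) = (\<Sum>r \<in> I. comp0 t (V r) (U r))"
      unfolding PP[OF that(1,1)] by (rule sum.cong) (simp_all only: that(2))
    then show ?thesis by (simp only: P_def)
  qed
  have P0: "comp0 t (P I) (P J) = 0" if "I \<subseteq> {..<?n + ?m}" "J \<subseteq> {..<?n + ?m}"
    "\<And>r. r \<in> I \<Longrightarrow> comp0 t (U r) (P J) = 0" for I J
    unfolding PP[OF that(1,2)] using that(3) by simp
  have prods: "comp0 t (P ?A) (P ?A) = P ?A" "comp0 t (P ?A) (P ?B) = 0"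
    "comp0 t (P ?B) (P ?B) = P ?B" "comp0 t (P ?B) (P ?A) = 0"
    using sub UA UB by (blast intro: P1 P0)+
  have inc: "P ?A \<in> cut t k k h h" "P ?B \<in> cut t k k h h"
    using cut_subset[OF eh(1) h] Ph[OF sub(1)] Ph[OF sub(2)] eP[OF sub(1)] eP[OF sub(2)]
    unfolding cut_def[of t k k e e] by blast+
  have "e = P ?A + P ?B"
    using vue unfolding P_def AB(1) by (simp add: sum.union_disjoint[OF _ _ AB(2)])
  then consider "P ?A = 0" | "P ?B = 0"
    using e inc prods unfolding primitive_idempotent_def by blast
  then show "rep_zero Y \<or> rep_zero Z"
  proof cases
    case 1
    \<comment> \<open>A row fixed by \<open>P ?A = 0\<close> is zero, and the entries of the
      identity of \<open>Y\<close> are products with such rows.\<close>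
    then have U0: "U r = 0" if "r < ?n" for r using UA(2)[of r] that by simp
    have "snd Y = 0\<^sub>m ?n ?n"
    proof (rule eq_matI)
      fix i j assume "i < dim_row (0\<^sub>m ?n ?n :: lincomb mat)" "j < dim_col (0\<^sub>m ?n ?n :: lincomb mat)"
      then show "snd Y $$ (i, j) = 0\<^sub>m ?n ?n $$ (i, j)" using UV[of i j] iS[of i j] U0[of i] by simp
    qed (use Y add_hom_dim in \<open>auto simp: Rep_iff\<close>)
    then show ?thesis by (simp add: rep_zero_def rep_id_def)
  next
    case 2
    then have U0: "U r = 0" if "?n \<le> r" "r < ?n + ?m" for r using UB(2)[of r] that by simp
    have "snd Z = 0\<^sub>m ?m ?m"
    proof (rule eq_matI)
      fix i j assume "i < dim_row (0\<^sub>m ?m ?m :: lincomb mat)" "j < dim_col (0\<^sub>m ?m ?m :: lincomb mat)"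
      then show "snd Z $$ (i, j) = 0\<^sub>m ?m ?m $$ (i, j)"
        using UV[of "?n + i" "?n + j"] iS[of "?n + i" "?n + j"] U0[of "?n + i"] by simp
    qed (use Z add_hom_dim in \<open>auto simp: Rep_iff\<close>)
    then show ?thesis by (simp add: rep_zero_def rep_id_def)
  qed
qed

lemma cut_mono:
  assumes h: "e \<in> cut t l l h h" "h \<in> hom0 l l" and h': "f \<in> cut t k k h' h'" "h' \<in> hom0 k k"
    and x: "x \<in> cut t k l e f"
  shows "x \<in> cut t k l h h'"
proof -
  have e: "e \<in> hom0 l l" "comp0 t h e = e" and f: "f \<in> hom0 k k" "comp0 t f h' = f"
    and x: "x \<in> hom0 k l" "comp0 t e x = x" "comp0 t x f = x"
    using assms by (auto simp: cut_def)
  have "comp0 t h x = x" using hom0_assoc[OF x(1) e(1) h(2), of t] e x by simp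
  moreover have "comp0 t x h' = x" using hom0_assoc[OF h'(2) f(1) x(1), of t] f x by simp
  ultimately show ?thesis using x by (simp add: cut_def)
qed

section \<open>Lifted idempotents and their isomorphism classes\<close>

definition is_lift :: "complex \<Rightarrow> nat list \<Rightarrow> lincomb \<Rightarrow> bool" where
  "is_lift t a e \<longleftrightarrow> set a \<subseteq> {0, 1} \<and> primitive_idempotent t (h_hom t a a) e \<and> chi a e = 1"

lemma is_liftD:
  assumes "is_lift t a e"
  shows "set a \<subseteq> {0, 1}" "e \<in> h_hom t a a" "e \<in> hom0 (h_size a) (h_size a)" "comp0 t e e = e" "chi a e = 1"
    "image_obj (h_size a) e \<in> Rep t" "\<not> rep_zero (image_obj (h_size a) e)"
    "indecomposable t (image_obj (h_size a) e)"
proof -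
  show a: "set a \<subseteq> {0, 1}" and e: "e \<in> h_hom t a a" "comp0 t e e = e" and "chi a e = 1"
    using assms by (auto simp: is_lift_def primitive_idempotent_def)
  then show e0: "e \<in> hom0 (h_size a) (h_size a)" by (simp add: cut_def)
  show "image_obj (h_size a) e \<in> Rep t" using e0 e(2) by (rule image_obj_Rep)
  show "\<not> rep_zero (image_obj (h_size a) e)"
    using assms by (auto simp: rep_zero_image_obj is_lift_def primitive_idempotent_def)
  show "indecomposable t (image_obj (h_size a) e)"
    using assms by (intro primitive_indecomposable[OF hom0_h_unit[OF a]]) (simp add: is_lift_def)
qed

text \<open>The composite \<open>x\<close> is invertible in the endomorphisms of the lift by
  \<open>primitive_invertible\<close>. Composing \<open>g\<close> with the inverse turns
  \<open>f\<close> into a split epimorphism, and \<open>X\<close> is indecomposable.\<close>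

lemma rep_iso_of_chi:
  assumes e: "is_lift t a e" and X: "X \<in> Rep t" "indecomposable t X"
    and f: "f \<in> rep_hom t X (image_obj (h_size a) e)" and g: "g \<in> rep_hom t (image_obj (h_size a) e) X"
    and fg: "add_comp t f g = mat 1 1 (\<lambda>_. x)" and chi: "chi a x \<noteq> 0"
  shows "(X, image_obj (h_size a) e) \<in> rep_iso t"
proof -
  note E = is_liftD[OF e]
  let ?Y = "image_obj (h_size a) e"
  have homY: "z \<in> rep_hom t ?Y ?Y \<longleftrightarrow> (\<exists>y \<in> cut t (h_size a) (h_size a) e e. z = mat 1 1 (\<lambda>_. y))" for z
    by (rule rep_hom_image_obj[OF E(3,4) E(3,4)])
  have "x \<in> cut t (h_size a) (h_size a) e e"
    using homY[of "mat 1 1 (\<lambda>_. x)"] rep_hom_comp[OF E(6) X(1) E(6) g f] fg by (auto simp only: mat11_eq_iff)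
  then obtain y where y: "y \<in> cut t (h_size a) (h_size a) e e" "comp0 t x y = e"
    using primitive_invertible[OF E(1) _ E(5) _ chi] e by (auto simp: is_lift_def)
  let ?y = "mat 1 1 (\<lambda>_. y)"
  have yh: "?y \<in> rep_hom t ?Y ?Y" using homY y by blast
  show ?thesis
  proof (rule rep_iso_of_summand[OF X E(6,7) f])
    show "add_comp t g ?y \<in> rep_hom t ?Y X" using rep_hom_comp[OF E(6,6) X(1) yh g] .
    have "add_comp t f (add_comp t g ?y) = add_comp t (mat 1 1 (\<lambda>_. x)) ?y"
      using rep_hom_assoc[OF E(6,6) X(1) E(6) yh g f] fg by simp
    then show "add_comp t f (add_comp t g ?y) = rep_id ?Y"
      using y(2) by (simp add: add_comp_mat11 rep_id_def del: One_nat_def)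
  qed
qed

text \<open>The composites of \<open>e\<close> and \<open>e'\<close> in either order are morphisms
  between the two images, and \<open>chi a\<close>, being multiplicative, takes the value
  \<open>1\<close> on their product.\<close>

lemma is_lift_unique:
  assumes e: "is_lift t a e" and e': "is_lift t a e'"
  shows "(image_obj (h_size a) e', image_obj (h_size a) e) \<in> rep_iso t"
proof (rule rep_iso_of_chi[OF e])
  note E = is_liftD[OF e] and E' = is_liftD[OF e']
  show "image_obj (h_size a) e' \<in> Rep t" "indecomposable t (image_obj (h_size a) e')" by fact+
  let ?f = "comp0 t e e'" and ?g = "comp0 t e' e"
  have h: "?f \<in> hom0 (h_size a) (h_size a)" "?g \<in> hom0 (h_size a) (h_size a)"
    by (rule hom0_comp0[OF E'(3) E(3)], rule hom0_comp0[OF E(3) E'(3)])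
  have "?f \<in> cut t (h_size a) (h_size a) e e'"
    unfolding cut_def using h hom0_assoc[OF E'(3) E(3) E(3), of t] hom0_assoc[OF E'(3) E'(3) E(3), of t] E(4) E'(4)
    by simp
  then show "mat 1 1 (\<lambda>_. ?f) \<in> rep_hom t (image_obj (h_size a) e') (image_obj (h_size a) e)"
    unfolding rep_hom_image_obj[OF E'(3,4) E(3,4)] by blast
  have "?g \<in> cut t (h_size a) (h_size a) e' e"
    unfolding cut_def using h hom0_assoc[OF E(3) E'(3) E'(3), of t] hom0_assoc[OF E(3) E(3) E'(3), of t] E(4) E'(4)
    by simp
  then show "mat 1 1 (\<lambda>_. ?g) \<in> rep_hom t (image_obj (h_size a) e) (image_obj (h_size a) e')"
    unfolding rep_hom_image_obj[OF E(3,4) E'(3,4)] by blast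
  show "add_comp t (mat 1 1 (\<lambda>_. ?f)) (mat 1 1 (\<lambda>_. ?g)) = mat 1 1 (\<lambda>_. comp0 t ?f ?g)"
    by (rule add_comp_mat11)
  have hu: "h_unit a \<in> hom0 (h_size a) (h_size a)" using E(1) by (rule hom0_h_unit)
  have "?f \<in> h_hom t a a" "?g \<in> h_hom t a a"
    by (rule cut_comp0[OF E'(2) E(2) hu hu hu], rule cut_comp0[OF E(2) E'(2) hu hu hu])
  then show "chi a (comp0 t ?f ?g) \<noteq> 0"
    using chi_comp0[OF E(1)] E(2,5) E'(2,5) by simp
qed

text \<open>\<open>lift_class\<close> is a union over all lifts; \<open>is_lift_unique\<close>
  collapses it to the class of any one of them.\<close>

lemma phi_conv_class:
  assumes e: "is_lift t a e"
  shows "phi t a = rep_iso t `` {image_obj (h_size a) e}"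
proof -
  note E = is_liftD[OF e]
  have "phi t a = rep_iso t `` {image_obj (h_size a) e' | e'. is_lift t a e'}"
    unfolding phi_def lift_class_def lifts_unit_iff[OF E(1)] image_obj_def is_lift_def
    using E(1) by simp
  also have "\<dots> = rep_iso t `` {image_obj (h_size a) e}"
  proof (intro equalityI subsetI)
    fix Y assume "Y \<in> rep_iso t `` {image_obj (h_size a) e' | e'. is_lift t a e'}"
    then obtain e' where e': "is_lift t a e'" "(image_obj (h_size a) e', Y) \<in> rep_iso t" by blast
    have "(image_obj (h_size a) e, Y) \<in> rep_iso t"
      using equiv_rep_iso[of t] is_lift_unique[OF e'(1) e] e'(2) by (meson equivE transD)
    then show "Y \<in> rep_iso t `` {image_obj (h_size a) e}" by simp
  next
    fix Y assume "Y \<in> rep_iso t `` {image_obj (h_size a) e}"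
    then show "Y \<in> rep_iso t `` {image_obj (h_size a) e' | e'. is_lift t a e'}"
      using e by auto
  qed
  finally show ?thesis .
qed

lemma ex_lift: "set a \<subseteq> {0, 1} \<Longrightarrow> \<exists>e. is_lift t a e"
  using ex_primitive_lift[of a t] by (simp add: is_lift_def)

lemma phi_in_indec_classes:
  assumes "set a \<subseteq> {0, 1}" shows "phi t a \<in> indec_classes t"
proof -
  obtain e where e: "is_lift t a e" using ex_lift[OF assms] by blast
  show ?thesis
    unfolding phi_conv_class[OF e] indec_classes_def using is_liftD(6-8)[OF e] by (intro quotientI) simp
qed

text \<open>The coefficient \<open>1\<close> at \<open>h_part a\<close> in \<open>v\<close> after
  \<open>u\<close> forces a partition in \<open>u\<close> with at least \<open>length a\<close>
  through-blocks, and likewise \<open>v\<close> contains one with at least \<open>length b\<close>.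
  Since partitions in \<open>v\<close> have at most \<open>length a\<close>, the one found in
  \<open>u\<close> is extremal and rigid.\<close>

lemma is_lift_iso_imp_eq:
  assumes e: "is_lift t a e" and f: "is_lift t b f"
    and iso: "(image_obj (h_size a) e, image_obj (h_size b) f) \<in> rep_iso t"
  shows "a = b"
proof -
  note E = is_liftD[OF e] and F = is_liftD[OF f]
  obtain u v where u: "u \<in> cut t (h_size a) (h_size b) f e" and v: "v \<in> cut t (h_size b) (h_size a) e f"
    and vu: "comp0 t v u = e" and uv: "comp0 t u v = f"
    using iso unfolding rep_iso_def
    by (auto simp: rep_hom_image_obj[OF E(3,4) F(3,4)] rep_hom_image_obj[OF F(3,4) E(3,4)] rep_id_def
        add_comp_mat11 mat11_eq_iff simp del: One_nat_def)
  have hu: "u \<in> h_hom t a b" and hv: "v \<in> h_hom t b a"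
    using cut_mono[OF F(2) hom0_h_unit[OF F(1)] E(2) hom0_h_unit[OF E(1)] u]
      cut_mono[OF E(2) hom0_h_unit[OF E(1)] F(2) hom0_h_unit[OF F(1)] v] by blast+
  have key: "\<exists>p \<in> keys y. length c \<le> through p"
    if "chi c (comp0 t x y) = 1" "set c \<subseteq> {0, 1}" "x \<in> h_hom t d c" "y \<in> h_hom t c d" "set d \<subseteq> {0, 1}" for c d x y
  proof -
    have "h_part c \<in> keys (comp0 t x y)" using that(1) by (simp add: chi_def in_keys_iff)
    then obtain q p where qp: "q \<in> keys x" "p \<in> keys y" "h_part c = stack q p"
      using keys_comp0 by blast
    have "p \<in> partitions (h_size c) (h_size d)" "q \<in> partitions (h_size d) (h_size c)"
      using h_hom_keys(1)[OF that(2,5,4) qp(2)] h_hom_keys(1)[OF that(5,2,3) qp(1)] by (auto simp: NC_even_def)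
    then have "length c \<le> through p" using through_stack_le(1) qp(3) through_h_part[OF that(2)] by metis
    then show ?thesis using qp by blast
  qed
  obtain p where p: "p \<in> keys u" "length a \<le> through p"
    using key[of a v u b] vu E(1,5) F(1) hu hv by auto
  obtain q where q: "q \<in> keys v" "length b \<le> through q"
    using key[of b u v a] uv E(1) F(1,5) hu hv by auto
  have "length b \<le> length a" using q h_hom_keys(3)[OF F(1) E(1) hv q(1)] by simp
  then show "a = b" using p h_hom_keys(4)[OF E(1) F(1) hu p(1)] by simp
qed

section \<open>Every indecomposable object comes from a lift\<close>

text \<open>Composing the three factors yields \<open>p\<close> with some power of \<open>t\<close>;
  as \<open>t \<noteq> 0\<close>, its inverse can be put into the coefficient of
  \<open>v\<close>.\<close>

lemma factor_single:
  assumes t: "t \<noteq> 0" and p: "p \<in> NC_even k l"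
  obtains a U V where "set a \<subseteq> {0, 1}" "length a = through p" "V \<in> hom0 k (h_size a)" "U \<in> hom0 (h_size a) l"
    "comp0 t U (comp0 t (h_unit a) V) = single p c"
proof -
  obtain a u v where f: "set a \<subseteq> {0, 1}" "length a = through p" "v \<in> NC_even k (h_size a)"
    "u \<in> NC_even (h_size a) l" "stack u (stack (h_part a) v) = p"
    by (rule NC_even_factor[OF p])
  let ?s = "t ^ loops u (stack (h_part a) v) * t ^ loops (h_part a) v"
  have "comp0 t (single u 1) (comp0 t (h_unit a) (single v (c / ?s))) = single p c"
    using t by (simp add: h_unit_def comp0_single f(5))
  then show thesis using that f by (blast intro: hom0_single)
qed

lemma comp0_if: "comp0 t (if Q then x else 0) y = (if Q then comp0 t x y else 0)"
  "comp0 t y (if Q then x else 0) = (if Q then comp0 t y x else 0)"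
  by simp_all

text \<open>Take a partition \<open>p\<^sub>0\<close> with the most through-blocks in the matrix \<open>e = e e e\<close>. It occurs in
  a product whose outer factors are partitions with equally many through-blocks; these factor through
  some \<open>h\<^sub>a\<close>, and the product in between has a nonzero coefficient at \<open>h\<^sub>a\<close>.\<close>

lemma ex_chi_nonzero:
  assumes t: "t \<noteq> 0" and X: "(ks, e) \<in> Rep t" "\<not> rep_zero (ks, e)"
  obtains a r s V U where "set a \<subseteq> {0, 1}" "r < length ks" "s < length ks"
    "V \<in> hom0 (ks ! r) (h_size a)" "U \<in> hom0 (h_size a) (ks ! s)"
    "chi a (comp0 t (h_unit a) (comp0 t (comp0 t V (comp0 t (e $$ (r, s)) U)) (h_unit a))) \<noteq> 0"
proof -
  let ?n = "length ks"
  have e: "e \<in> add_hom ks ks" "add_comp t e e = e" using X by (auto simp: Rep_iff)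
  have d: "dim_row e = ?n" "dim_col e = ?n" using add_hom_dim[OF e(1)] by auto
  have eh: "e $$ (i, j) \<in> hom0 (ks ! j) (ks ! i)" if "i < ?n" "j < ?n" for i j
    using add_hom_entry[OF e(1) that] .
  have ee: "(\<Sum>r < ?n. comp0 t (e $$ (i, r)) (e $$ (r, j))) = e $$ (i, j)" if "i < ?n" "j < ?n" for i j
    using add_comp_entry[OF e(2), of i j] that d by simp
  define T where "T = (\<Union>i \<in> {..<?n}. \<Union>j \<in> {..<?n}. keys (e $$ (i, j)))"
  have finT: "finite T" by (simp add: T_def)
  have "T \<noteq> {}"
  proof
    assume "T = {}"
    then have "e $$ (i, j) = 0" if "i < ?n" "j < ?n" for i j using that by (auto simp: T_def)
    then have "e = 0\<^sub>m ?n ?n" using d by (intro eq_matI) auto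
    then show False using X(2) by (simp add: rep_zero_def rep_id_def)
  qed
  then obtain p0 where p0: "p0 \<in> T" "\<And>p. p \<in> T \<Longrightarrow> through p \<le> through p0"
    using finT Max_in[of "through ` T"] Max_ge[of "through ` T"] by (metis (no_types, lifting) finite_imageI image_iff image_is_empty imageI)
  then obtain i j where ij: "i < ?n" "j < ?n" "p0 \<in> keys (e $$ (i, j))" by (auto simp: T_def)
  let ?s = "\<lambda>f. (\<Sum>p \<in> keys f. single p (lookup f p))"
  \<comment> \<open>Only the outer two factors of the triple product are expanded into partitions;
    the middle entry stays whole, since it becomes the element tested by \<open>chi\<close>.\<close>
  have "e $$ (i, j) = (\<Sum>r < ?n. comp0 t (e $$ (i, r)) (\<Sum>s < ?n. comp0 t (e $$ (r, s)) (e $$ (s, j))))"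
    using ee ij by simp
  also have "\<dots> = (\<Sum>r < ?n. \<Sum>s < ?n. comp0 t (e $$ (i, r)) (comp0 t (e $$ (r, s)) (e $$ (s, j))))"
    by (simp add: comp0_sum_right)
  also have "\<dots> = (\<Sum>r < ?n. \<Sum>s < ?n. comp0 t (?s (e $$ (i, r))) (comp0 t (e $$ (r, s)) (?s (e $$ (s, j)))))"
    unfolding sum_single_lookup ..
  also have "\<dots> = (\<Sum>r < ?n. \<Sum>s < ?n. \<Sum>p' \<in> keys (e $$ (s, j)). \<Sum>p \<in> keys (e $$ (i, r)).
      comp0 t (single p (lookup (e $$ (i, r)) p)) (comp0 t (e $$ (r, s))
        (single p' (lookup (e $$ (s, j)) p'))))"
    unfolding comp0_sum_left comp0_sum_right ..
  finally have "lookup (\<Sum>r < ?n. \<Sum>s < ?n. \<Sum>p' \<in> keys (e $$ (s, j)). \<Sum>p \<in> keys (e $$ (i, r)).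
      comp0 t (single p (lookup (e $$ (i, r)) p)) (comp0 t (e $$ (r, s))
        (single p' (lookup (e $$ (s, j)) p')))) p0 \<noteq> 0"
    using ij(3) by (simp add: in_keys_iff)
  then obtain r s p p' where rs: "r < ?n" "s < ?n" and p: "p \<in> keys (e $$ (i, r))"
      and p': "p' \<in> keys (e $$ (s, j))"
      and nz: "lookup (comp0 t (single p (lookup (e $$ (i, r)) p))
        (comp0 t (e $$ (r, s)) (single p' (lookup (e $$ (s, j)) p')))) p0 \<noteq> 0"
    unfolding lookup_sum by (elim sum.not_neutral_contains_not_neutral) auto
  let ?c = "lookup (e $$ (i, r)) p" and ?c' = "lookup (e $$ (s, j)) p'"
  have pT: "p \<in> T" "p' \<in> T" using p p' rs ij by (auto simp: T_def)
  have pNC: "p \<in> NC_even (ks ! r) (ks ! i)" "p' \<in> NC_even (ks ! j) (ks ! s)"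
    using p p' eh[OF ij(1) rs(1)] eh[OF rs(2) ij(2)] by (auto simp: hom0_def)
  obtain a U V where a: "set a \<subseteq> {0, 1}" "length a = through p" "V \<in> hom0 (ks ! r) (h_size a)"
      "U \<in> hom0 (h_size a) (ks ! i)" "comp0 t U (comp0 t (h_unit a) V) = single p ?c"
    by (rule factor_single[OF t pNC(1)])
  obtain b U' V' where b: "set b \<subseteq> {0, 1}" "length b = through p'" "V' \<in> hom0 (ks ! j) (h_size b)"
      "U' \<in> hom0 (h_size b) (ks ! s)" "comp0 t U' (comp0 t (h_unit b) V') = single p' ?c'"
    by (rule factor_single[OF t pNC(2)])
  note Ha = hom0_h_unit[OF a(1)] and Hb = hom0_h_unit[OF b(1)] and E = eh[OF rs]
  define y where "y = comp0 t V (comp0 t (e $$ (r, s)) U')"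
  define z where "z = comp0 t (h_unit a) (comp0 t y (h_unit b))"
  have EU: "comp0 t (e $$ (r, s)) U' \<in> hom0 (h_size b) (ks ! r)" using b(4) E by (rule hom0_comp0)
  have y: "y \<in> hom0 (h_size b) (h_size a)" unfolding y_def using EU a(3) by (rule hom0_comp0)
  have yb: "comp0 t y (h_unit b) \<in> hom0 (h_size b) (h_size a)" using Hb y by (rule hom0_comp0)
  have z: "z \<in> hom0 (h_size b) (h_size a)" unfolding z_def using yb Ha by (rule hom0_comp0)
  have zh: "z \<in> h_hom t b a"
  proof -
    have "comp0 t (h_unit a) z = z"
      unfolding z_def using hom0_assoc[OF yb Ha Ha, of t] h_unit_idem[OF a(1)] by simp
    moreover have "comp0 t z (h_unit b) = z"
      unfolding z_def using hom0_assoc[OF Hb yb Ha, of t] hom0_assoc[OF Hb Hb y, of t] h_unit_idem[OF b(1)] by simp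
    ultimately show ?thesis using z by (simp add: cut_def)
  qed
  have HV: "comp0 t (h_unit a) V \<in> hom0 (ks ! r) (h_size a)" using a(3) Ha by (rule hom0_comp0)
  have HV': "comp0 t (h_unit b) V' \<in> hom0 (ks ! j) (h_size b)" using b(3) Hb by (rule hom0_comp0)
  have "comp0 t (single p ?c) (comp0 t (e $$ (r, s)) (single p' ?c')) =
      comp0 t (comp0 t U (comp0 t (h_unit a) V)) (comp0 t (comp0 t (e $$ (r, s)) U') (comp0 t (h_unit b) V'))"
    unfolding a(5)[symmetric] b(5)[symmetric] using hom0_assoc[OF HV' b(4) E, of t] by simp
  also have "\<dots> = comp0 t U (comp0 t (comp0 t (h_unit a) V) (comp0 t (comp0 t (e $$ (r, s)) U') (comp0 t (h_unit b) V')))"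
    using hom0_assoc[OF hom0_comp0[OF HV' EU, of t] HV a(4), of t] by simp
  also have "comp0 t (comp0 t (h_unit a) V) (comp0 t (comp0 t (e $$ (r, s)) U') (comp0 t (h_unit b) V')) =
      comp0 t (h_unit a) (comp0 t y (comp0 t (h_unit b) V'))"
    using hom0_assoc[OF hom0_comp0[OF HV' EU, of t] a(3) Ha, of t] hom0_assoc[OF HV' EU a(3), of t] by (simp add: y_def)
  also have "\<dots> = comp0 t z V'"
    using hom0_assoc[OF b(3) Hb y, of t] hom0_assoc[OF b(3) yb Ha, of t] by (simp add: z_def)
  finally have "p0 \<in> keys (comp0 t U (comp0 t z V'))" using nz by (simp add: in_keys_iff)
  then obtain q w where q: "q \<in> keys U" "p0 = stack q w" "w \<in> keys (comp0 t z V')"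
    using keys_comp0 by blast
  then obtain x v' where x: "x \<in> keys z" "v' \<in> keys V'" "w = stack x v'"
    using keys_comp0 by blast
  have P: "q \<in> partitions (h_size a) (ks ! i)" "w \<in> partitions (ks ! j) (h_size a)"
    "x \<in> partitions (h_size b) (h_size a)" "v' \<in> partitions (ks ! j) (h_size b)"
    using q x a(4) z b(3) hom0_comp0[OF b(3) z, of t] by (auto simp: hom0_def NC_even_def)
  \<comment> \<open>\<open>x\<close> is a factor of \<open>p0\<close>, so it has at least as many
    through-blocks; by maximality of \<open>p0\<close> these number at least \<open>length a\<close>
    and \<open>length b\<close>, the counts of \<open>p\<close> and \<open>p'\<close>. Rigidity
    gives \<open>b = a\<close> and identifies \<open>x\<close>.\<close>
  have "through p0 \<le> through x"
    using through_stack_le(1)[OF P(2,1)] through_stack_le(2)[OF P(4,3)] q(2) x(3) by simp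
  moreover have "length a \<le> through p0" "length b \<le> through p0" using p0(2) pT a(2) b(2) by simp_all
  ultimately have "b = a" "x = h_part b" using h_hom_keys(4)[OF b(1) a(1) zh x(1)] by simp_all
  then have "chi a z \<noteq> 0" using x(1) by (simp add: chi_def in_keys_iff)
  then show thesis using that[OF a(1) rs a(3)] b(4) \<open>b = a\<close> unfolding z_def y_def by blast
qed

text \<open>The morphisms \<open>V\<close> and \<open>U\<close> with nonvanishing \<open>chi\<close>
  are extended by zero to the whole sum and cut down by the idempotents on both sides. Cutting by
  the lift does not change \<open>chi\<close>, which is \<open>1\<close> on it, so
  \<open>rep_iso_of_chi\<close> applies.\<close>

lemma indecomposable_iso_lift:
  assumes t: "t \<noteq> 0" and X: "X \<in> Rep t" "\<not> rep_zero X" "indecomposable t X"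
  shows "\<exists>a e. is_lift t a e \<and> (X, image_obj (h_size a) e) \<in> rep_iso t"
proof -
  obtain ks e where Xe: "X = (ks, e)" by (cases X)
  let ?n = "length ks"
  have e: "e \<in> add_hom ks ks" "add_comp t e e = e" using X by (auto simp: Rep_iff Xe)
  have d: "dim_row e = ?n" "dim_col e = ?n" using add_hom_dim[OF e(1)] by auto
  obtain a r s V U where a: "set a \<subseteq> {0, 1}" and rs: "r < ?n" "s < ?n"
    and V: "V \<in> hom0 (ks ! r) (h_size a)" and U: "U \<in> hom0 (h_size a) (ks ! s)"
    and nz: "chi a (comp0 t (h_unit a) (comp0 t (comp0 t V (comp0 t (e $$ (r, s)) U)) (h_unit a))) \<noteq> 0"
    by (rule ex_chi_nonzero[OF t X(1,2)[unfolded Xe]])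
  let ?K = "h_size a"
  note H = hom0_h_unit[OF a]
  obtain \<epsilon> where \<epsilon>: "is_lift t a \<epsilon>" using ex_lift[OF a] by blast
  note L = is_liftD[OF \<epsilon>]
  have L\<epsilon>: "comp0 t \<epsilon> (h_unit a) = \<epsilon>" "comp0 t (h_unit a) \<epsilon> = \<epsilon>" using L(2) by (simp_all add: cut_def)
  define A where "A = comp0 t \<epsilon> V"
  define B where "B = comp0 t U \<epsilon>"
  have A: "A \<in> hom0 (ks ! r) ?K" unfolding A_def using V L(3) by (rule hom0_comp0)
  have B: "B \<in> hom0 ?K (ks ! s)" unfolding B_def using L(3) U by (rule hom0_comp0)
  have \<epsilon>A: "comp0 t \<epsilon> A = A" unfolding A_def using hom0_assoc[OF V L(3) L(3), of t] L(4) by simp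
  have B\<epsilon>: "comp0 t B \<epsilon> = B" unfolding B_def using hom0_assoc[OF L(3) L(3) U, of t] L(4) by simp
  \<comment> \<open>\<open>\<rho>\<close> reads only summand \<open>r\<close> and
    \<open>\<gamma>\<close> feeds only summand \<open>s\<close>, so placing \<open>e\<close> between
    them extracts the single entry in row \<open>r\<close> and column \<open>s\<close>.\<close>
  define \<rho> where "\<rho> = mat 1 ?n (\<lambda>(i, j). if j = r then A else 0)"
  define \<gamma> where "\<gamma> = mat ?n 1 (\<lambda>(i, j). if i = s then B else 0)"
  have \<rho>: "\<rho> \<in> add_hom ks [?K]" and \<gamma>: "\<gamma> \<in> add_hom [?K] ks"
    using A B by (auto simp: \<rho>_def \<gamma>_def add_hom_def)
  have M: "mat 1 1 (\<lambda>_. \<epsilon>) \<in> add_hom [?K] [?K]" using L(3) by (simp only: add_hom_mat11)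
  have \<epsilon>\<rho>: "add_comp t (mat 1 1 (\<lambda>_. \<epsilon>)) \<rho> = \<rho>"
    by (rule eq_matI) (auto simp: \<rho>_def comp0_if \<epsilon>A)
  have \<gamma>\<epsilon>: "add_comp t \<gamma> (mat 1 1 (\<lambda>_. \<epsilon>)) = \<gamma>"
    by (rule eq_matI) (auto simp: \<gamma>_def comp0_if B\<epsilon>)
  let ?f = "add_comp t \<rho> e" and ?g = "add_comp t e \<gamma>"
  have fh: "?f \<in> rep_hom t X (image_obj ?K \<epsilon>)"
    unfolding rep_hom_iff[OF X(1) L(6)] unfolding Xe fst_conv snd_conv image_obj_simps
    using add_comp_hom[OF e(1) \<rho>] add_comp_assoc[OF e(1) \<rho> M, of t] add_comp_assoc[OF e(1) e(1) \<rho>, of t] \<epsilon>\<rho> e(2)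
    by simp
  have gh: "?g \<in> rep_hom t (image_obj ?K \<epsilon>) X"
    unfolding rep_hom_iff[OF L(6) X(1)] unfolding Xe fst_conv snd_conv image_obj_simps
    using add_comp_hom[OF \<gamma> e(1)] add_comp_assoc[OF M \<gamma> e(1), of t] add_comp_assoc[OF \<gamma> e(1) e(1), of t] \<gamma>\<epsilon> e(2)
    by simp
  have E: "e $$ (r, s) \<in> hom0 (ks ! s) (ks ! r)" using add_hom_entry[OF e(1) rs] .
  let ?x = "comp0 t (comp0 t A (e $$ (r, s))) B"
  have "add_comp t ?f ?g = add_comp t ?f \<gamma>"
    using add_comp_assoc[OF add_comp_hom[OF \<gamma> e(1), of t] e(1) \<rho>, of t] add_comp_assoc[OF \<gamma> e(1) e(1), of t]
      add_comp_assoc[OF \<gamma> e(1) \<rho>, of t] e(2) by simp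
  also have "\<dots> = mat 1 1 (\<lambda>_. ?x)"
    by (rule eq_matI) (use rs d in \<open>auto simp: \<rho>_def \<gamma>_def comp0_if comp0_sum_left\<close>)
  finally have fg: "add_comp t ?f ?g = mat 1 1 (\<lambda>_. ?x)" .
  define y where "y = comp0 t V (comp0 t (e $$ (r, s)) U)"
  define z where "z = comp0 t (h_unit a) (comp0 t y (h_unit a))"
  have EU: "comp0 t (e $$ (r, s)) U \<in> hom0 ?K (ks ! r)" using U E by (rule hom0_comp0)
  have y: "y \<in> hom0 ?K ?K" unfolding y_def using EU V by (rule hom0_comp0)
  have yH: "comp0 t y (h_unit a) \<in> hom0 ?K ?K" using H y by (rule hom0_comp0)
  have "z \<in> corner t ?K (h_part a)"
    unfolding corner_def z_def h_unit_def using y by blast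
  then have z: "z \<in> h_hom t a a" by (simp only: corner_h_part[OF a])
  have "?x = comp0 t \<epsilon> (comp0 t y \<epsilon>)"
  proof -
    have "?x = comp0 t A (comp0 t (e $$ (r, s)) B)" using hom0_assoc[OF B E A, of t] by simp
    also have "comp0 t (e $$ (r, s)) B = comp0 t (comp0 t (e $$ (r, s)) U) \<epsilon>"
      unfolding B_def by (rule hom0_assoc[OF L(3) U E])
    also have "comp0 t A \<dots> = comp0 t \<epsilon> (comp0 t V (comp0 t (comp0 t (e $$ (r, s)) U) \<epsilon>))"
      unfolding A_def using hom0_assoc[OF hom0_comp0[OF L(3) EU, of t] V L(3), of t] by simp
    also have "comp0 t V (comp0 t (comp0 t (e $$ (r, s)) U) \<epsilon>) = comp0 t y \<epsilon>"
      unfolding y_def by (rule hom0_assoc[OF L(3) EU V])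
    finally show ?thesis .
  qed
  \<comment> \<open>The lift absorbs \<open>h_unit a\<close> on both sides, so the units may be
    inserted around \<open>y\<close>; this moves the product into the corner, where
    \<open>chi a\<close> is multiplicative.\<close>
  also have "\<dots> = comp0 t \<epsilon> (comp0 t z \<epsilon>)"
  proof -
    have "comp0 t z \<epsilon> = comp0 t (h_unit a) (comp0 t y \<epsilon>)"
      unfolding z_def using hom0_assoc[OF L(3) yH H, of t] hom0_assoc[OF L(3) H y, of t] L\<epsilon> by simp
    then have "comp0 t \<epsilon> (comp0 t z \<epsilon>) = comp0 t \<epsilon> (comp0 t (h_unit a) (comp0 t y \<epsilon>))" by simp
    also have "\<dots> = comp0 t \<epsilon> (comp0 t y \<epsilon>)"
      using hom0_assoc[OF hom0_comp0[OF L(3) y, of t] H L(3), of t] L\<epsilon> by simp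
    finally show ?thesis by simp
  qed
  finally have xz: "?x = comp0 t \<epsilon> (comp0 t z \<epsilon>)" .
  have "comp0 t z \<epsilon> \<in> h_hom t a a" by (rule cut_comp0[OF L(2) z H H H])
  then have "chi a ?x = chi a z"
    unfolding xz using chi_comp0[OF a L(2)] chi_comp0[OF a z L(2)] L(5) by simp
  then have "chi a ?x \<noteq> 0" using nz by (simp add: z_def y_def)
  then show ?thesis using rep_iso_of_chi[OF \<epsilon> X(1,3) fh gh fg] \<epsilon> by blast
qed

theorem proposition5p13:
  fixes t :: complex
  assumes "t \<noteq> 0"
  shows "bij_betw (phi t) (\<Union>b. {a :: nat list. length a = b \<and> set a \<subseteq> {0, 1}}) (indec_classes t)"
proof (rule bij_betw_imageI)
  have dom: "(\<Union>b. {a :: nat list. length a = b \<and> set a \<subseteq> {0, 1}}) = {a. set a \<subseteq> {0, 1}}" by auto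
  show "inj_on (phi t) (\<Union>b. {a :: nat list. length a = b \<and> set a \<subseteq> {0, 1}})"
    unfolding dom
  proof (rule inj_onI, unfold mem_Collect_eq)
    fix a b :: "nat list" assume ab: "set a \<subseteq> {0, 1}" "set b \<subseteq> {0, 1}" "phi t a = phi t b"
    obtain e f where e: "is_lift t a e" and f: "is_lift t b f" using ex_lift ab by meson
    have "(image_obj (h_size a) e, image_obj (h_size b) f) \<in> rep_iso t"
      using ab(3) eq_equiv_class_iff[OF equiv_rep_iso is_liftD(6)[OF e] is_liftD(6)[OF f]]
      by (simp add: phi_conv_class[OF e] phi_conv_class[OF f])
    then show "a = b" using is_lift_iso_imp_eq[OF e f] by blast
  qed
  show "phi t ` (\<Union>b. {a :: nat list. length a = b \<and> set a \<subseteq> {0, 1}}) = indec_classes t"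
    unfolding dom
  proof (intro equalityI subsetI)
    fix C assume "C \<in> indec_classes t"
    then obtain X where X: "X \<in> Rep t" "\<not> rep_zero X" "indecomposable t X" "C = rep_iso t `` {X}"
      by (auto simp: indec_classes_def elim: quotientE)
    obtain a e where ae: "is_lift t a e" "(X, image_obj (h_size a) e) \<in> rep_iso t"
      using indecomposable_iso_lift[OF assms X(1-3)] by blast
    then have "C = phi t a"
      using equiv_class_eq[OF equiv_rep_iso ae(2)] X(4) phi_conv_class[OF ae(1)] by simp
    then show "C \<in> phi t ` {a. set a \<subseteq> {0, 1}}" using is_liftD(1)[OF ae(1)] by blast
  next
    fix C assume "C \<in> phi t ` {a. set a \<subseteq> {0, 1}}"
    then show "C \<in> indec_classes t" using phi_in_indec_classes by blast
  qed
qed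

end
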